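(* There is a universal constant $C<\infty$ such that if $u:\mathbb{D}\to\mathbb{R}$ is harmonic with $u(0)=0$ and $$\int_{\mathbb{D}}|\nabla u(z)|^2\,\frac{dA(z)}{\pi}\le1,$$ then $$\int_0^{2\pi}\exp\left(u^\star(e^{i\theta})^2\right)d\theta\le C,$$ where $u^\star$ is the trace of $u$ on $\partial\mathbb{D}$, i.e. $u^\star(\zeta)=\lim_{t\uparrow1}u(t\zeta)$ for $\mathcal{H}_1$-a.e. $\zeta\in\partial\mathbb{D}$.
   Context: $\mathbb{D}=\{z\in\mathbb{C}:|z|<1\}$ is the unit disk, $dA$ is area (two-dimensional Lebesgue) measure, and $\mathcal{H}_1$ is one-dimensional Hausdorff measure. *)

theory Defs
  imports "HOL-Analysis.Analysis"
begin

definition partial_deriv :: "'a::euclidean_space \<Rightarrow> ('a \<Rightarrow> real) \<Rightarrow> 'a \<Rightarrow> real" where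
  "partial_deriv b f x = frechet_derivative f (at x) b"

definition C1_on :: "'a::euclidean_space set \<Rightarrow> ('a \<Rightarrow> real) \<Rightarrow> bool" where
  "C1_on S f \<longleftrightarrow> (\<forall>x\<in>S. f differentiable (at x)) \<and>
     (\<forall>b\<in>Basis. continuous_on S (partial_deriv b f))"

definition C2_on :: "'a::euclidean_space set \<Rightarrow> ('a \<Rightarrow> real) \<Rightarrow> bool" where
  "C2_on S f \<longleftrightarrow> C1_on S f \<and> (\<forall>b\<in>Basis. C1_on S (partial_deriv b f))"

definition gradient :: "('a::euclidean_space \<Rightarrow> real) \<Rightarrow> 'a \<Rightarrow> 'a" where
  "gradient f x = (\<Sum>b\<in>Basis. partial_deriv b f x *\<^sub>R b)"

definition laplacian :: "('a::euclidean_space \<Rightarrow> real) \<Rightarrow> 'a \<Rightarrow> real" where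
  "laplacian f x = (\<Sum>b\<in>Basis. partial_deriv b (partial_deriv b f) x)"

text \<open>Meant for open \<open>S\<close>; values of \<open>f\<close> outside \<open>S\<close> are then irrelevant. On the complex plane
  \<open>Basis = {1, \<i>}\<close>, so the partial derivatives are those in the real and imaginary directions.\<close>

definition harmonic_on :: "'a::euclidean_space set \<Rightarrow> ('a \<Rightarrow> real) \<Rightarrow> bool" where
  "harmonic_on S f \<longleftrightarrow> C2_on S f \<and> (\<forall>x\<in>S. laplacian f x = 0)"

text \<open>The covering sets are required to be bounded because \<open>diameter\<close> is unspecified on
  unbounded sets. The empty set is allowed and has diameter \<open>0\<close>, so finite covers are included.\<close>

definition hausdorff1_pre :: "real \<Rightarrow> 'a::metric_space set \<Rightarrow> ennreal" where
  "hausdorff1_pre \<delta> A =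
     (INF U \<in> {U :: nat \<Rightarrow> 'a set. A \<subseteq> (\<Union>i. U i) \<and> (\<forall>i. bounded (U i) \<and> diameter (U i) \<le> \<delta>)}.
        \<Sum>i. ennreal (diameter (U i)))"

definition hausdorff1 :: "'a::metric_space set \<Rightarrow> ennreal" where
  "hausdorff1 A = (SUP \<delta>\<in>{0<..}. hausdorff1_pre \<delta> A)"

definition has_radial_limit :: "(complex \<Rightarrow> real) \<Rightarrow> real \<Rightarrow> complex \<Rightarrow> bool" where
  "has_radial_limit u l \<zeta> \<longleftrightarrow> ((\<lambda>t::real. u (of_real t * \<zeta>)) \<longlongrightarrow> l) (at_left 1)"

text \<open>Unspecified at those \<open>\<zeta>\<close> where there is no (finite) radial limit.\<close>

definition trace_circle :: "(complex \<Rightarrow> real) \<Rightarrow> complex \<Rightarrow> real" where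
  "trace_circle u \<zeta> = (THE l. has_radial_limit u l \<zeta>)"

end

theory Submission
  imports Defs "HOL-Probability.Probability_Measure"
begin

text \<open>
  The proof follows Beurling and Marshall: one estimate for averages over subsets of a circle is
  applied to \<open>h \<circ> u\<close> for well chosen functions \<open>h\<close>, and the resulting information about the
  level sets of \<open>u\<close> is summed by an argument of Moser, Adams and Garsia.

  \<^bold>\<open>Averages over sets.\<close> Let \<open>v\<close> be of class \<open>C\<^sup>1\<close> on the disk with Dirichlet integral \<open>pi * D\<close>, and
  let \<open>E\<close> be a part of a circle \<open>\<bar>z\<bar> = R < 1\<close>, of normalised length \<open>l\<close>. The average of \<open>v\<close> over \<open>E\<close>
  exceeds the average over the circle by at most \<open>sqrt (D * (ln (1 / l) + 3 / 2))\<close>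
  (\<open>trace_pairing_bound\<close>). This is the duality between the half-order norm \<open>\<Sum>\<bar>k\<bar> \<bar>a\<^sub>k\<bar>\<^sup>2\<close> of the
  Fourier coefficients, which is at most \<open>D / 2\<close> (\<open>trace_energy_le\<close>), and the dual norm of the
  indicator of \<open>E\<close>: its coefficients are at most \<open>l\<close>, which gives a harmonic sum up to the
  frequency \<open>1 / l\<close>, and Bessel's inequality controls the others (\<open>dual_energy_bound\<close>). As \<open>v\<close>
  need not be harmonic, \<open>v = h \<circ> u\<close> is allowed.

  \<^bold>\<open>Level sets.\<close> With \<open>v = u\<close> the estimate says that \<open>{u \<ge> t}\<close> has length at most a constant times
  \<open>exp (- t\<^sup>2)\<close>, which falls just short of integrability of \<open>exp (u\<^sup>2)\<close>. But a level \<open>s\<close> where this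
  bound is nearly attained must have used up nearly all of the energy: truncating \<open>u\<close> at \<open>s\<close>
  leaves only the energy of \<open>{u \<le> s}\<close> (\<open>level_vs_energy_below\<close>). Stretching \<open>u\<close> by a large factor
  above \<open>s\<close> is then cheap, and shows that there are no nearly extremal levels far beyond \<open>s\<close>
  (\<open>level_vs_energy_beyond\<close>). The normalisation \<open>u 0 = 0\<close> enters through the mean value property:
  \<open>u\<close> has average \<open>0\<close> on every circle, and a composition \<open>h \<circ> u\<close> with \<open>h\<close> the identity below \<open>s\<close>
  has an average that is controlled by the tiny \<open>excess\<close> of \<open>u\<close> over \<open>s\<close>.

  \<^bold>\<open>Summation.\<close> Let \<open>t\<^sub>k\<close> be the level that \<open>u\<close> reaches on a set of length about \<open>exp (- k)\<close>. The
  integral of \<open>exp (u\<^sup>2)\<close> over \<open>{u > 0}\<close> is at most \<open>\<Sum> exp (t\<^sub>k\<^sup>2 - k)\<close>. By the previous paragraph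
  the number of \<open>k\<close> with \<open>k - t\<^sub>k\<^sup>2 \<le> n\<close> is \<open>O(n + 1)\<close>, so the sum is bounded by a constant
  (\<open>level_sum_bound\<close>). The same applies to \<open>- u\<close>.

  All this takes place on circles of radius \<open>R < 1\<close> with constants that do not depend on \<open>R\<close>, and
  Fatou's lemma carries the bound to the trace. The radial limits exist because almost every radius
  carries finite energy, so that \<open>u\<close> is Hoelder continuous of order one half along it.
\<close>

section \<open>Polar coordinates\<close>

lemma lborel_complex_eq:
  "(lborel :: complex measure) = distr (lborel \<Otimes>\<^sub>M lborel) borel (\<lambda>p. Complex (fst p) (snd p))"
proof (rule lborel_eqI)
  have meas: "(\<lambda>p. Complex (fst p) (snd p)) \<in> borel_measurable (lborel \<Otimes>\<^sub>M lborel)"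
    unfolding lborel_prod Complex_eq
    by (simp, intro borel_measurable_continuous_onI continuous_intros)
  fix l u :: complex
  assume lu: "\<And>b. b \<in> Basis \<Longrightarrow> l \<bullet> b \<le> u \<bullet> b"
  have pre: "(\<lambda>p. Complex (fst p) (snd p)) -` box l u \<inter> space (lborel \<Otimes>\<^sub>M lborel)
      = {Re l<..<Re u} \<times> {Im l<..<Im u}"
    by (auto simp: in_box_complex_iff space_pair_measure)
  have "Re l \<le> Re u" "Im l \<le> Im u"
    using lu[of 1] lu[of \<i>] by (auto simp: Basis_complex_def)
  then show "emeasure (distr (lborel \<Otimes>\<^sub>M lborel) borel (\<lambda>p. Complex (fst p) (snd p))) (box l u)
      = (\<Prod>b\<in>Basis. (u - l) \<bullet> b)"
    using meas by (simp add: emeasure_distr pre lborel.emeasure_pair_measure_Times Basis_complex_def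
        ennreal_mult)
qed simp

lemma nn_integral_lborel_complex:
  fixes f :: "complex \<Rightarrow> ennreal"
  assumes [measurable]: "f \<in> borel_measurable borel"
  shows "(\<integral>\<^sup>+z. f z \<partial>lborel) = (\<integral>\<^sup>+x. \<integral>\<^sup>+y. f (Complex x y) \<partial>lborel \<partial>lborel)"
proof -
  have meas[measurable]: "(\<lambda>p. Complex (fst p) (snd p)) \<in> borel_measurable (lborel \<Otimes>\<^sub>M lborel)"
    unfolding lborel_prod Complex_eq
    by (simp, intro borel_measurable_continuous_onI continuous_intros)
  show ?thesis
    by (subst lborel_complex_eq) (simp add: nn_integral_distr lborel.nn_integral_fst[symmetric])
qed

text \<open>The substitution \<open>s = tan \<theta>\<close> is made on the ranges \<open>{-n..n}\<close>, where everything is smooth up to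
  the ends, and monotone convergence removes the cut-off.\<close>

lemma nn_integral_arctan:
  fixes f :: "real \<Rightarrow> ennreal"
  assumes f[measurable]: "f \<in> borel_measurable borel"
  shows "(\<integral>\<^sup>+s. f s * ennreal (1 / (1 + s\<^sup>2)) \<partial>lborel)
    = (\<integral>\<^sup>+\<theta>. f (tan \<theta>) * indicator {-pi/2<..<pi/2} \<theta> \<partial>lborel)"
proof -
  define g where "g s = f s * ennreal (1 / (1 + s\<^sup>2))" for s
  have [measurable]: "g \<in> borel_measurable borel" unfolding g_def by measurable
  have tan_meas[measurable]: "(tan :: real \<Rightarrow> real) \<in> borel_measurable borel"
    unfolding tan_def by measurable
  define a where "a n = arctan (real (Suc n))" for n :: nat
  have a: "-pi/2 < -a n" "- a n \<le> a n" "a n < pi/2" "0 < a n" for n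
    using arctan_bounded[of "real (Suc n)"] zero_less_arctan_iff[of "real (Suc n)"] unfolding a_def by auto
  have 1: "(\<integral>\<^sup>+s. g s * indicator {-real (Suc n)..real (Suc n)} s \<partial>lborel)
      = (\<integral>\<^sup>+\<theta>. f (tan \<theta>) * indicator {-a n..a n} \<theta> \<partial>lborel)" for n
  proof -
    have cosnz: "cos x \<noteq> 0" if "x \<in> {-a n..a n}" for x
      using that a[of n] cos_gt_zero_pi[of x] by force
    have "(\<integral>\<^sup>+s. g s * indicator {tan (-a n)..tan (a n)} s \<partial>lborel) =
             (\<integral>\<^sup>+x. g (tan x) * ennreal (inverse ((cos x)\<^sup>2)) * indicator {-a n..a n} x \<partial>lborel)"
    proof (rule nn_integral_substitution_aux)
      show "(tan has_real_derivative inverse ((cos x)\<^sup>2)) (at x)" if "x \<in> {-a n..a n}" for x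
        using DERIV_tan[OF cosnz[OF that]] .
      show "continuous_on {- a n..a n} (\<lambda>x. inverse ((cos x)\<^sup>2))"
        using cosnz by (intro continuous_intros) auto
    qed (use a[of n] in \<open>auto\<close>)
    also have "(\<integral>\<^sup>+x. g (tan x) * ennreal (inverse ((cos x)\<^sup>2)) * indicator {-a n..a n} x \<partial>lborel)
        = (\<integral>\<^sup>+\<theta>. f (tan \<theta>) * indicator {-a n..a n} \<theta> \<partial>lborel)"
    proof (intro nn_integral_cong)
      fix x :: real
      show "g (tan x) * ennreal (inverse ((cos x)\<^sup>2)) * indicator {-a n..a n} x
          = f (tan x) * indicator {-a n..a n} x"
      proof (cases "x \<in> {-a n..a n}")
        case True
        have "1 / (1 + (tan x)\<^sup>2) * inverse ((cos x)\<^sup>2) = 1"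
          unfolding tan_sec[OF cosnz[OF True]] using cosnz[OF True] by (simp only: power_inverse) (simp add: divide_inverse)
        then have "ennreal (1 / (1 + (tan x)\<^sup>2)) * ennreal (inverse ((cos x)\<^sup>2)) = 1"
          by (subst ennreal_mult[symmetric]) auto
        then show ?thesis
          unfolding g_def by (simp add: mult.assoc)
      qed simp
    qed
    finally show ?thesis by (simp add: a_def tan_arctan)
  qed
  have mono_a: "a m \<le> a n" if "m \<le> n" for m n
    using that by (simp add: a_def arctan_le_iff)
  have U1: "(\<Union>n. {-real (Suc n)..real (Suc n)}) = (UNIV::real set)"
  proof safe
    fix x :: real
    obtain n where "\<bar>x\<bar> \<le> real n" using real_arch_simple by blast
    then have "x \<in> {-real (Suc n)..real (Suc n)}" by auto
    then show "x \<in> (\<Union>n. {-real (Suc n)..real (Suc n)})" by blast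
  qed auto
  have U2: "(\<Union>n. {-a n..a n}) = {-pi/2<..<pi/2}"
  proof safe
    fix x :: real assume x: "x \<in> {-pi/2<..<pi/2}"
    obtain n where n: "\<bar>tan x\<bar> \<le> real n" using real_arch_simple by blast
    have "tan x \<le> real (Suc n)" "- real (Suc n) \<le> tan x" using n by auto
    then have "arctan (tan x) \<le> arctan (real (Suc n))" "arctan (- real (Suc n)) \<le> arctan (tan x)"
      by (simp_all only: arctan_le_iff)
    then have "x \<in> {-a n..a n}"
      using x by (simp add: a_def arctan_tan arctan_minus[symmetric] del: arctan_minus of_nat_Suc)
    then show "x \<in> (\<Union>n. {-a n..a n})" by blast
  next
    fix x n assume "x \<in> {-a n..a n}"
    then show "x \<in> {-pi/2<..<pi/2}" using a[of n] by auto
  qed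
  have lim: "(\<integral>\<^sup>+x. F x * indicator (\<Union>n. {-b n..b n}) x \<partial>lborel)
      = (SUP n. \<integral>\<^sup>+x. F x * indicator {-b n..b n} x \<partial>lborel)"
    if [measurable]: "F \<in> borel_measurable borel" and b: "\<And>m n. m \<le> n \<Longrightarrow> b m \<le> b n"
    for F :: "real \<Rightarrow> ennreal" and b :: "nat \<Rightarrow> real"
  proof -
    have "incseq (\<lambda>n. {-b n..b n})"
      unfolding incseq_def using b by fastforce
    then have "emeasure (density lborel F) (\<Union>n. {-b n..b n}) = (SUP n. emeasure (density lborel F) {-b n..b n})"
      by (intro SUP_emeasure_incseq[symmetric]) auto
    then show ?thesis
      by (simp add: emeasure_density sets.countable_UN)
  qed
  show ?thesis
    using lim[of g "\<lambda>n. real (Suc n)"] lim[of "\<lambda>\<theta>. f (tan \<theta>)" a] mono_a 1 U1 U2 by (simp add: g_def)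
qed

text \<open>Polar coordinates as a chain of one-dimensional substitutions and Tonelli: \<open>y = x s\<close> for fixed \<open>x\<close>,
  then \<open>x = r / sqrt (1 + s\<^sup>2)\<close> for a fixed slope \<open>s\<close>, and finally \<open>s = tan \<theta>\<close>. This describes the lines
  through the origin by a signed \<open>r\<close> and \<open>\<theta> \<in> {-pi/2<..<pi/2}\<close>; the rays with \<open>r < 0\<close> are then
  turned by \<open>pi\<close> to supply the other half of the angles.\<close>

lemma nn_integral_polar:
  fixes f :: "complex \<Rightarrow> ennreal"
  assumes f[measurable]: "f \<in> borel_measurable borel"
  shows "(\<integral>\<^sup>+z. f z \<partial>lborel)
    = (\<integral>\<^sup>+r\<in>{0<..}. (\<integral>\<^sup>+\<theta>\<in>{0..2*pi}. f (of_real r * cis \<theta>) \<partial>lborel) * ennreal r \<partial>lborel)"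
proof -
  have [measurable]: "(\<lambda>p. Complex (fst p) (snd p)) \<in> borel_measurable (borel \<Otimes>\<^sub>M borel)"
    unfolding borel_prod Complex_eq by (intro borel_measurable_continuous_onI continuous_intros)
  have mC[measurable (raw)]: "(\<lambda>x. Complex (a x) (b x)) \<in> borel_measurable M"
    if "a \<in> borel_measurable M" "b \<in> borel_measurable M" for a b and M :: "'b measure"
    using that unfolding Complex_eq by measurable
  have [measurable]: "cis \<in> borel_measurable borel"
    by (intro borel_measurable_continuous_onI continuous_intros)
  define c where "c s = 1 / sqrt (1 + s\<^sup>2)" for s :: real
  have [measurable]: "c \<in> borel_measurable borel" unfolding c_def by measurable
  have c: "c s > 0" "c s * c s = 1 / (1 + s\<^sup>2)" for s
    by (auto simp: c_def add_pos_nonneg)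
  define F where "F r s = f (Complex (r * c s) (r * c s * s))" for r s
  have [measurable]: "(\<lambda>(r,s). F r s) \<in> borel_measurable (borel \<Otimes>\<^sub>M borel)"
    unfolding F_def by measurable
  define H where "H r = (\<integral>\<^sup>+\<theta>\<in>{-pi/2<..<pi/2}. f (of_real r * cis \<theta>) \<partial>lborel)" for r
  have [measurable]: "H \<in> borel_measurable borel" unfolding H_def by measurable
  have "(\<integral>\<^sup>+z. f z \<partial>lborel) = (\<integral>\<^sup>+x. \<integral>\<^sup>+y. f (Complex x y) \<partial>lborel \<partial>lborel)"
    by (rule nn_integral_lborel_complex) fact
  also have "\<dots> = (\<integral>\<^sup>+x. \<integral>\<^sup>+s. f (Complex x (x * s)) * ennreal \<bar>x\<bar> \<partial>lborel \<partial>lborel)"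
  proof (intro nn_integral_cong_AE)
    have "AE x in lborel. x \<noteq> (0::real)" by (rule AE_lborel_singleton)
    then show "AE x in lborel. (\<integral>\<^sup>+y. f (Complex x y) \<partial>lborel)
        = (\<integral>\<^sup>+s. f (Complex x (x * s)) * ennreal \<bar>x\<bar> \<partial>lborel)"
    proof eventually_elim
      case (elim x)
      show ?case
        using nn_integral_real_affine[of "\<lambda>y. f (Complex x y)" x 0] elim
        by (simp add: nn_integral_multc) (simp add: mult.commute)
    qed
  qed
  also have "\<dots> = (\<integral>\<^sup>+s. \<integral>\<^sup>+x. f (Complex x (x * s)) * ennreal \<bar>x\<bar> \<partial>lborel \<partial>lborel)"
    by (rule lborel_pair.Fubini') measurable
  also have "\<dots> = (\<integral>\<^sup>+s. \<integral>\<^sup>+r. F r s * ennreal \<bar>r\<bar> * ennreal (1 / (1 + s\<^sup>2)) \<partial>lborel \<partial>lborel)"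
  proof (rule nn_integral_cong)
    fix s :: real
    have "(\<integral>\<^sup>+x. f (Complex x (x * s)) * ennreal \<bar>x\<bar> \<partial>lborel)
        = ennreal (c s) * (\<integral>\<^sup>+r. F r s * ennreal \<bar>c s * r\<bar> \<partial>lborel)"
      using nn_integral_real_affine[of "\<lambda>x. f (Complex x (x * s)) * ennreal \<bar>x\<bar>" "c s" 0] c(1)[of s]
      by (simp add: F_def mult_ac)
    also have "\<dots> = (\<integral>\<^sup>+r. F r s * ennreal \<bar>r\<bar> * ennreal (c s * c s) \<partial>lborel)"
      using c(1)[of s] by (simp add: nn_integral_cmult[symmetric] abs_mult ennreal_mult mult_ac)
    finally show "(\<integral>\<^sup>+x. f (Complex x (x * s)) * ennreal \<bar>x\<bar> \<partial>lborel)
        = (\<integral>\<^sup>+r. F r s * ennreal \<bar>r\<bar> * ennreal (1 / (1 + s\<^sup>2)) \<partial>lborel)"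
      unfolding c(2) .
  qed
  also have "\<dots> = (\<integral>\<^sup>+r. \<integral>\<^sup>+s. F r s * ennreal \<bar>r\<bar> * ennreal (1 / (1 + s\<^sup>2)) \<partial>lborel \<partial>lborel)"
    by (rule lborel_pair.Fubini'[symmetric]) measurable
  also have "\<dots> = (\<integral>\<^sup>+r. ennreal \<bar>r\<bar> * H r \<partial>lborel)"
  proof (intro nn_integral_cong)
    fix r :: real
    have "(\<integral>\<^sup>+s. F r s * ennreal \<bar>r\<bar> * ennreal (1 / (1 + s\<^sup>2)) \<partial>lborel)
       = ennreal \<bar>r\<bar> * (\<integral>\<^sup>+s. F r s * ennreal (1 / (1 + s\<^sup>2)) \<partial>lborel)"
      by (simp add: nn_integral_cmult[symmetric] mult_ac)
    also have "(\<integral>\<^sup>+s. F r s * ennreal (1 / (1 + s\<^sup>2)) \<partial>lborel)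
       = (\<integral>\<^sup>+\<theta>\<in>{-pi/2<..<pi/2}. F r (tan \<theta>) \<partial>lborel)"
      by (rule nn_integral_arctan) measurable
    also have "\<dots> = H r"
      unfolding H_def
    proof (intro nn_integral_cong)
      fix \<theta> :: real
      have "F r (tan \<theta>) = f (of_real r * cis \<theta>)" if "\<theta> \<in> {-pi/2<..<pi/2}"
      proof -
        have cp: "cos \<theta> > 0" using that by (intro cos_gt_zero_pi) auto
        have "1 + (tan \<theta>)\<^sup>2 = (1 / cos \<theta>)\<^sup>2"
          using cp sin_cos_squared_add[of \<theta>] by (simp add: tan_def field_simps)
        then have "c (tan \<theta>) = cos \<theta>" using cp by (simp add: c_def)
        then show ?thesis using cp unfolding F_def
          by (intro arg_cong[of _ _ f]) (simp add: complex_eq_iff tan_def)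
      qed
      then show "F r (tan \<theta>) * indicator {-pi/2<..<pi/2} \<theta>
          = f (of_real r * cis \<theta>) * indicator {-pi/2<..<pi/2} \<theta>"
        by (auto split: split_indicator)
    qed
    finally show "(\<integral>\<^sup>+s. F r s * ennreal \<bar>r\<bar> * ennreal (1 / (1 + s\<^sup>2)) \<partial>lborel) = ennreal \<bar>r\<bar> * H r" .
  qed
  also have "\<dots> = (\<integral>\<^sup>+r. ennreal \<bar>r\<bar> * H r * indicator {0<..} r + ennreal \<bar>r\<bar> * H r * indicator {..<0} r \<partial>lborel)"
    by (intro nn_integral_cong) (auto split: split_indicator)
  also have "\<dots> = (\<integral>\<^sup>+r. ennreal \<bar>r\<bar> * H r * indicator {0<..} r \<partial>lborel)
      + (\<integral>\<^sup>+r. ennreal \<bar>r\<bar> * H r * indicator {..<0} r \<partial>lborel)"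
    by (rule nn_integral_add) auto
  also have "(\<integral>\<^sup>+r. ennreal \<bar>r\<bar> * H r * indicator {..<0} r \<partial>lborel)
      = (\<integral>\<^sup>+r. ennreal \<bar>r\<bar> * H (-r) * indicator {0<..} r \<partial>lborel)"
    by (subst nn_integral_real_affine[of _ "-1" 0])
       (auto intro!: nn_integral_cong split: split_indicator)
  also have "(\<integral>\<^sup>+r. ennreal \<bar>r\<bar> * H r * indicator {0<..} r \<partial>lborel) + \<dots>
      = (\<integral>\<^sup>+r\<in>{0<..}. (H r + H (-r)) * ennreal r \<partial>lborel)"
    by (subst nn_integral_add[symmetric])
       (auto intro!: nn_integral_cong split: split_indicator simp: algebra_simps)
  also have "\<dots> = (\<integral>\<^sup>+r\<in>{0<..}. (\<integral>\<^sup>+\<theta>\<in>{0..2*pi}. f (of_real r * cis \<theta>) \<partial>lborel) * ennreal r \<partial>lborel)"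
  proof (intro nn_integral_cong, goal_cases)
    case (1 r)
    let ?g = "\<lambda>\<theta>. f (of_real r * cis \<theta>)"
    have a: "H (-r) = (\<integral>\<^sup>+\<theta>\<in>{pi/2<..<3*pi/2}. ?g \<theta> \<partial>lborel)"
      unfolding H_def
      by (subst nn_integral_real_affine[of _ 1 "-pi"])
         (auto intro!: nn_integral_cong simp: cis_mult[symmetric] cis_divide[symmetric] split: split_indicator)
    have b: "(\<integral>\<^sup>+\<theta>\<in>{-pi/2<..<0}. ?g \<theta> \<partial>lborel) = (\<integral>\<^sup>+\<theta>\<in>{3*pi/2<..<2*pi}. ?g \<theta> \<partial>lborel)"
      by (subst nn_integral_real_affine[of _ 1 "-2*pi"])
         (auto intro!: nn_integral_cong simp: cis_mult[symmetric] cis_divide[symmetric] split: split_indicator)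
    have "H r = (\<integral>\<^sup>+\<theta>. ?g \<theta> * indicator {-pi/2<..<0} \<theta> + ?g \<theta> * indicator {0..<pi/2} \<theta> \<partial>lborel)"
      unfolding H_def by (intro nn_integral_cong) (auto split: split_indicator)
    also have "\<dots> = (\<integral>\<^sup>+\<theta>\<in>{-pi/2<..<0}. ?g \<theta> \<partial>lborel) + (\<integral>\<^sup>+\<theta>\<in>{0..<pi/2}. ?g \<theta> \<partial>lborel)"
      by (rule nn_integral_add) auto
    finally have "H r + H (-r) = (\<integral>\<^sup>+\<theta>. ?g \<theta> * indicator {3*pi/2<..<2*pi} \<theta>
        + ?g \<theta> * indicator {0..<pi/2} \<theta> + ?g \<theta> * indicator {pi/2<..<3*pi/2} \<theta> \<partial>lborel)"
      unfolding a b by (simp add: nn_integral_add)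
    also have "\<dots> = (\<integral>\<^sup>+\<theta>\<in>{0..2*pi}. ?g \<theta> \<partial>lborel)"
    proof (intro nn_integral_cong_AE)
      have "AE \<theta> in lborel. \<theta> \<noteq> pi/2" "AE \<theta> in lborel. \<theta> \<noteq> 3*pi/2" "AE \<theta> in lborel. \<theta> \<noteq> 2*pi"
        by (rule AE_lborel_singleton)+
      then show "AE \<theta> in lborel. ?g \<theta> * indicator {3*pi/2<..<2*pi} \<theta>
        + ?g \<theta> * indicator {0..<pi/2} \<theta> + ?g \<theta> * indicator {pi/2<..<3*pi/2} \<theta>
        = ?g \<theta> * indicator {0..2*pi} \<theta>"
        by eventually_elim (auto split: split_indicator)
    qed
    finally show ?case by simp
  qed
  finally show ?thesis .
qed

section \<open>Fourier coefficients on the circle\<close>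

text \<open>Normalised to total mass one, so that averages over a circle are expectations and Bessel's
  inequality carries no factor \<open>2 pi\<close>.\<close>

definition circ :: "real measure" where
  "circ = uniform_measure lborel {0..2*pi}"

lemma sets_circ[simp, measurable_cong]: "sets circ = sets borel"
  and space_circ[simp]: "space circ = UNIV"
  by (auto simp: circ_def)

interpretation circ: prob_space circ
  unfolding circ_def by (rule prob_space_uniform_measure) auto

lemma measure_circ_UNIV[simp]: "measure circ UNIV = 1" and emeasure_circ_UNIV[simp]: "emeasure circ UNIV = 1"
  using circ.prob_space circ.emeasure_space_1 by simp_all

lemma nn_integral_circ:
  assumes "f \<in> borel_measurable borel"
  shows "(\<integral>\<^sup>+\<theta>. f \<theta> \<partial>circ) = (\<integral>\<^sup>+\<theta>\<in>{0..2*pi}. f \<theta> \<partial>lborel) / ennreal (2*pi)"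
  using assms by (simp add: circ_def nn_integral_uniform_measure)

lemma circ_eq_density: "circ = density lborel (\<lambda>\<theta>. ennreal (indicator {0..2*pi} \<theta> / (2*pi)))"
  unfolding circ_def uniform_measure_def
  by (intro arg_cong[of _ _ "density lborel"] ext)
     (auto simp: divide_ennreal[symmetric] split: split_indicator)

lemma integral_circ:
  fixes f :: "real \<Rightarrow> 'a::euclidean_space"
  assumes f: "continuous_on UNIV f"
  shows "(\<integral>\<theta>. f \<theta> \<partial>circ) = integral {0..2*pi} f /\<^sub>R (2*pi)"
proof -
  have [measurable]: "f \<in> borel_measurable borel" using f by (rule borel_measurable_continuous_onI)
  have "(\<integral>\<theta>. f \<theta> \<partial>circ) = (\<integral>\<theta>. (indicator {0..2*pi} \<theta> / (2*pi)) *\<^sub>R f \<theta> \<partial>lborel)"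
    unfolding circ_eq_density by (subst integral_density) auto
  also have "\<dots> = (LINT \<theta>:{0..2*pi}|lborel. f \<theta>) /\<^sub>R (2*pi)"
  proof -
    have "(\<lambda>\<theta>. (indicator {0..2*pi} \<theta> / (2*pi)) *\<^sub>R f \<theta>)
        = (\<lambda>\<theta>. inverse (2*pi) *\<^sub>R (indicator {0..2*pi} \<theta> *\<^sub>R f \<theta>))"
      by (intro ext) (auto split: split_indicator simp: inverse_eq_divide)
    then have "(\<integral>\<theta>. (indicator {0..2*pi} \<theta> / (2*pi)) *\<^sub>R f \<theta> \<partial>lborel)
        = (\<integral>\<theta>. inverse (2*pi) *\<^sub>R (indicator {0..2*pi} \<theta> *\<^sub>R f \<theta>) \<partial>lborel)" by (rule arg_cong)
    then show ?thesis unfolding set_lebesgue_integral_def by (simp only: integral_scaleR_right)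
  qed
  also have "(LINT \<theta>:{0..2*pi}|lborel. f \<theta>) = integral {0..2*pi} f"
    by (intro set_borel_integral_eq_integral borel_integrable_atLeastAtMost')
       (rule continuous_on_subset[OF f], simp)
  finally show ?thesis .
qed

lemma AE_circ_Icc: "AE \<theta> in circ. \<theta> \<in> {0..2*pi}"
  unfolding circ_def by (rule AE_uniform_measureI) auto

lemma integrable_circ_continuous:
  fixes f :: "real \<Rightarrow> 'a::euclidean_space"
  assumes f: "continuous_on UNIV f"
  shows "integrable circ f"
proof -
  have [measurable]: "f \<in> borel_measurable borel" using f by (rule borel_measurable_continuous_onI)
  have "compact (f ` {0..2*pi})"
    by (intro compact_continuous_image continuous_on_subset[OF f]) auto
  then obtain B where B: "\<forall>x\<in>{0..2*pi}. norm (f x) \<le> B"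
    using compact_imp_bounded bounded_iff by (metis imageI)
  show ?thesis
    by (rule circ.integrable_const_bound[where B=B]) (use AE_circ_Icc B in \<open>auto elim: eventually_mono\<close>)
qed

lemma integral_circ_cis: "(\<integral>\<theta>. cis (of_int k * \<theta>) \<partial>circ) = (if k = 0 then 1 else 0)"
proof (cases "k = 0")
  case True then show ?thesis by simp
next
  case False
  have "((\<lambda>\<theta>. cis (of_int k * \<theta>)) has_integral
     (cis (of_int k * (2*pi)) / (\<i> * of_int k) - cis (of_int k * 0) / (\<i> * of_int k))) {0..2*pi}"
  proof (rule fundamental_theorem_of_calculus)
    fix x :: real
    show "((\<lambda>\<theta>. cis (of_int k * \<theta>) / (\<i> * of_int k)) has_vector_derivative cis (of_int k * x)) (at x within {0..2*pi})"
      unfolding cis_conv_exp using False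
      by (auto intro!: derivative_eq_intros has_vector_derivative_real_field simp: field_simps)
  qed simp
  moreover have "cis (of_int k * (2*pi)) = 1"
    using cis_multiple_2pi[of "of_int k"] by (simp add: mult_ac)
  ultimately have "integral {0..2*pi} (\<lambda>\<theta>. cis (of_int k * \<theta>)) = 0"
    by (simp add: integral_unique)
  then show ?thesis
    using False by (subst integral_circ) (auto intro!: continuous_intros)
qed

text \<open>A class that is closed under all operations below and consists of integrable functions, so that
  linearity of the integral needs no further side conditions.\<close>

definition bdd_borel :: "(real \<Rightarrow> complex) \<Rightarrow> bool" where
  "bdd_borel f \<longleftrightarrow> f \<in> borel_measurable borel \<and> bounded (range f)"

lemma bdd_borelI: "f \<in> borel_measurable borel \<Longrightarrow> (\<And>x. cmod (f x) \<le> B) \<Longrightarrow> bdd_borel f"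
  unfolding bdd_borel_def bounded_iff by auto

lemma bdd_borelE:
  assumes "bdd_borel f"
  obtains B where "f \<in> borel_measurable borel" "\<And>x. cmod (f x) \<le> B"
  using assms unfolding bdd_borel_def bounded_iff by auto

lemma bdd_borel_measurable: "bdd_borel f \<Longrightarrow> f \<in> borel_measurable borel"
  by (simp add: bdd_borel_def)

lemma bdd_borel_add: "bdd_borel f \<Longrightarrow> bdd_borel g \<Longrightarrow> bdd_borel (\<lambda>x. f x + g x)"
  by (elim bdd_borelE, rule bdd_borelI) (auto intro: norm_triangle_le add_mono)

lemma bdd_borel_diff: "bdd_borel f \<Longrightarrow> bdd_borel g \<Longrightarrow> bdd_borel (\<lambda>x. f x - g x)"
  by (elim bdd_borelE, rule bdd_borelI) (auto intro: norm_triangle_le_diff add_mono)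

lemma bdd_borel_mult: "bdd_borel f \<Longrightarrow> bdd_borel g \<Longrightarrow> bdd_borel (\<lambda>x. f x * g x)"
  by (elim bdd_borelE, rule bdd_borelI)
     (auto simp: norm_mult intro!: mult_mono intro: order_trans[OF norm_ge_zero])

lemma bdd_borel_cnj: "bdd_borel f \<Longrightarrow> bdd_borel (\<lambda>x. cnj (f x))"
  by (elim bdd_borelE, rule bdd_borelI)
     (auto intro: borel_measurable_continuous_onI[THEN measurable_compose[rotated]] continuous_intros)

lemma bdd_borel_const: "bdd_borel (\<lambda>x. c)"
  by (rule bdd_borelI) auto

lemma bdd_borel_cis: "bdd_borel (\<lambda>x. cis (c * x))"
  by (rule bdd_borelI[where B=1]) (auto intro!: borel_measurable_continuous_onI continuous_intros)

lemma bdd_borel_sum: "(\<And>k. k \<in> K \<Longrightarrow> bdd_borel (f k)) \<Longrightarrow> bdd_borel (\<lambda>x. \<Sum>k\<in>K. f k x)"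
  by (induction K rule: infinite_finite_induct) (auto intro: bdd_borel_add bdd_borel_const)

lemma bdd_borel_indicator: "E \<in> sets borel \<Longrightarrow> bdd_borel (\<lambda>x. of_real (indicator E x))"
  by (rule bdd_borelI[where B=1]) (auto simp: indicator_def)

lemmas bdd_borel_intros = bdd_borel_add bdd_borel_diff bdd_borel_mult bdd_borel_cnj bdd_borel_const
  bdd_borel_cis bdd_borel_sum bdd_borel_indicator

lemma bdd_borel_integrable: "bdd_borel f \<Longrightarrow> integrable circ f"
  by (elim bdd_borelE, rule circ.integrable_const_bound) auto

definition fcoeff :: "(real \<Rightarrow> complex) \<Rightarrow> int \<Rightarrow> complex" where
  "fcoeff f k = (\<integral>\<theta>. f \<theta> * cis (- of_int k * \<theta>) \<partial>circ)"

lemma fcoeff_diff: "bdd_borel f \<Longrightarrow> bdd_borel g \<Longrightarrow> fcoeff (\<lambda>x. f x - g x) k = fcoeff f k - fcoeff g k"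
  unfolding fcoeff_def left_diff_distrib
  by (intro Bochner_Integration.integral_diff bdd_borel_integrable bdd_borel_intros)

lemma fcoeff_cnj: "fcoeff (\<lambda>x. cnj (f x)) k = cnj (fcoeff f (-k))"
proof -
  have "(\<lambda>\<theta>. cnj (f \<theta>) * cis (- of_int k * \<theta>)) = (\<lambda>\<theta>. cnj (f \<theta> * cis (- of_int (- k) * \<theta>)))"
    by (simp add: cis_cnj)
  then show ?thesis unfolding fcoeff_def by (simp only: Bochner_Integration.integral_cnj)
qed

lemma fcoeff_cis_sum:
  assumes "finite K"
  shows "fcoeff (\<lambda>\<theta>. \<Sum>k\<in>K. c k * cis (of_int k * \<theta>)) j = (if j \<in> K then c j else 0)"
proof -
  have "fcoeff (\<lambda>\<theta>. \<Sum>k\<in>K. c k * cis (of_int k * \<theta>)) j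
      = (\<integral>\<theta>. (\<Sum>k\<in>K. c k * cis (of_int (k - j) * \<theta>)) \<partial>circ)"
    unfolding fcoeff_def sum_distrib_right
    by (intro Bochner_Integration.integral_cong refl sum.cong) (simp add: cis_mult algebra_simps)
  also have "\<dots> = (\<Sum>k\<in>K. \<integral>\<theta>. c k * cis (of_int (k - j) * \<theta>) \<partial>circ)"
    by (intro Bochner_Integration.integral_sum bdd_borel_integrable bdd_borel_intros)
  also have "\<dots> = (\<Sum>k\<in>K. if k = j then c k else 0)"
    by (intro sum.cong refl) (simp only: integral_mult_right_zero integral_circ_cis, simp)
  finally show ?thesis using assms by simp
qed

text \<open>Pythagoras: a partial Fourier sum is an orthogonal projection. The identity, and not only Bessel's
  inequality, is used to estimate the remainder of the expansion of an indicator.\<close>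

lemma bessel_identity:
  assumes f: "bdd_borel f" and K: "finite K"
  shows "(\<integral>\<theta>. (cmod (f \<theta> - (\<Sum>k\<in>K. fcoeff f k * cis (of_int k * \<theta>))))\<^sup>2 \<partial>circ)
     = (\<integral>\<theta>. (cmod (f \<theta>))\<^sup>2 \<partial>circ) - (\<Sum>k\<in>K. (cmod (fcoeff f k))\<^sup>2)"
proof -
  define g where "g \<theta> = (\<Sum>k\<in>K. fcoeff f k * cis (of_int k * \<theta>))" for \<theta>
  have g: "bdd_borel g" unfolding g_def by (intro bdd_borel_intros)
  define S where "S = (\<Sum>k\<in>K. (cmod (fcoeff f k))\<^sup>2)"
  have pair: "(\<integral>\<theta>. q \<theta> * cnj (g \<theta>) \<partial>circ) = (\<Sum>k\<in>K. fcoeff q k * cnj (fcoeff f k))" if "bdd_borel q" for q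
  proof -
    have "(\<integral>\<theta>. q \<theta> * cnj (g \<theta>) \<partial>circ) = (\<integral>\<theta>. (\<Sum>k\<in>K. (q \<theta> * cis (- of_int k * \<theta>)) * cnj (fcoeff f k)) \<partial>circ)"
      unfolding g_def cnj_sum sum_distrib_left
      by (intro Bochner_Integration.integral_cong refl sum.cong) (simp add: cis_cnj mult_ac)
    also have "\<dots> = (\<Sum>k\<in>K. \<integral>\<theta>. (q \<theta> * cis (- of_int k * \<theta>)) * cnj (fcoeff f k) \<partial>circ)"
      by (intro Bochner_Integration.integral_sum bdd_borel_integrable bdd_borel_intros that)
    finally show ?thesis by (simp add: fcoeff_def)
  qed
  have 1: "(\<integral>\<theta>. f \<theta> * cnj (g \<theta>) \<partial>circ) = of_real S"
    unfolding pair[OF f] S_def of_real_sum complex_norm_square ..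
  have 2: "(\<integral>\<theta>. g \<theta> * cnj (g \<theta>) \<partial>circ) = of_real S"
  proof -
    have "fcoeff g k = fcoeff f k" if "k \<in> K" for k
      using fcoeff_cis_sum[OF K, of "fcoeff f" k] that unfolding g_def by simp
    then show ?thesis unfolding pair[OF g] S_def of_real_sum complex_norm_square by simp
  qed
  have 3: "(\<integral>\<theta>. g \<theta> * cnj (f \<theta>) \<partial>circ) = of_real S"
  proof -
    have "(\<lambda>\<theta>. g \<theta> * cnj (f \<theta>)) = (\<lambda>\<theta>. cnj (f \<theta> * cnj (g \<theta>)))"
      by (simp add: mult.commute)
    then show ?thesis by (simp only: Bochner_Integration.integral_cnj 1 complex_cnj_complex_of_real)
  qed
  have "complex_of_real (\<integral>\<theta>. (cmod (f \<theta> - g \<theta>))\<^sup>2 \<partial>circ)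
      = (\<integral>\<theta>. (f \<theta> - g \<theta>) * cnj (f \<theta> - g \<theta>) \<partial>circ)"
    by (subst integral_complex_of_real[symmetric]) (simp only: complex_norm_square)
  also have "\<dots> = (\<integral>\<theta>. (f \<theta> * cnj (f \<theta>) - f \<theta> * cnj (g \<theta>)) - (g \<theta> * cnj (f \<theta>) - g \<theta> * cnj (g \<theta>)) \<partial>circ)"
    by (intro Bochner_Integration.integral_cong refl) (simp add: algebra_simps)
  also have "\<dots> = (\<integral>\<theta>. f \<theta> * cnj (f \<theta>) \<partial>circ) - of_real S"
    using f g by (simp add: 1 2 3 Bochner_Integration.integral_diff bdd_borel_integrable bdd_borel_intros)
  also have "(\<integral>\<theta>. f \<theta> * cnj (f \<theta>) \<partial>circ) = of_real (\<integral>\<theta>. (cmod (f \<theta>))\<^sup>2 \<partial>circ)"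
    by (subst integral_complex_of_real[symmetric]) (simp only: complex_norm_square)
  finally show ?thesis
    unfolding g_def S_def of_real_diff[symmetric] of_real_eq_iff .
qed

lemma bessel_inequality:
  assumes "bdd_borel f" and "finite K"
  shows "(\<Sum>k\<in>K. (cmod (fcoeff f k))\<^sup>2) \<le> (\<integral>\<theta>. (cmod (f \<theta>))\<^sup>2 \<partial>circ)"
  using bessel_identity[OF assms]
    Bochner_Integration.integral_nonneg[of circ "\<lambda>\<theta>. (cmod (f \<theta> - (\<Sum>k\<in>K. fcoeff f k * cis (of_int k * \<theta>))))\<^sup>2"]
  by simp

inductive trig_poly :: "(real \<Rightarrow> complex) \<Rightarrow> bool" where
  monom: "trig_poly (\<lambda>\<theta>. c * cis (of_int k * \<theta>))"
| add: "trig_poly p \<Longrightarrow> trig_poly q \<Longrightarrow> trig_poly (\<lambda>\<theta>. p \<theta> + q \<theta>)"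

lemma trig_poly_mult:
  assumes "trig_poly p" "trig_poly q"
  shows "trig_poly (\<lambda>\<theta>. p \<theta> * q \<theta>)"
  using assms(1)
proof induction
  case (monom c k)
  show ?case using assms(2)
  proof induction
    case (monom d j)
    have "(\<lambda>\<theta>. c * cis (of_int k * \<theta>) * (d * cis (of_int j * \<theta>)))
        = (\<lambda>\<theta>. (c * d) * cis (of_int (k + j) * \<theta>))"
      by (intro ext) (simp add: cis_mult[symmetric] algebra_simps)
    then show ?case by (simp only: trig_poly.monom)
  qed (auto simp: distrib_left intro: trig_poly.add)
qed (auto simp: distrib_right intro: trig_poly.add)

lemma trig_poly_bdd_borel: "trig_poly p \<Longrightarrow> bdd_borel p"
  by (induction rule: trig_poly.induct) (intro bdd_borel_intros; assumption)+

text \<open>Polynomials in the coordinates of the plane are what the Stone-Weierstrass theorem provides;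
  on the circle they are trigonometric polynomials because \<open>cos\<close> and \<open>sin\<close> are.\<close>

lemma real_polynomial_function_trig_poly:
  assumes "real_polynomial_function g"
  shows "trig_poly (\<lambda>\<theta>. of_real (g (cis \<theta>)))"
  using assms
proof induction
  case (linear g)
  have "g (cis \<theta>) = cos \<theta> * g 1 + sin \<theta> * g \<i>" for \<theta>
  proof -
    have "cis \<theta> = cos \<theta> *\<^sub>R 1 + sin \<theta> *\<^sub>R \<i>" by (simp add: complex_eq_iff)
    then have "g (cis \<theta>) = g (cos \<theta> *\<^sub>R 1 + sin \<theta> *\<^sub>R \<i>)" by simp
    then show ?thesis
      using linear by (simp add: linear_simps bounded_linear.linear linear_add linear_cmul)
  qed
  then have "(\<lambda>\<theta>. complex_of_real (g (cis \<theta>))) =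
     (\<lambda>\<theta>. Complex (g 1 / 2) (- g \<i> / 2) * cis (of_int 1 * \<theta>) + Complex (g 1 / 2) (g \<i> / 2) * cis (of_int (-1) * \<theta>))"
    by (auto simp: complex_eq_iff fun_eq_iff)
  then show ?case by (simp only: trig_poly.intros)
next
  case (const c)
  show ?case using trig_poly.monom[of "of_real c" 0] by simp
qed (auto intro: trig_poly.add trig_poly_mult)

lemma trig_poly_orthogonal:
  assumes "trig_poly p"
  shows "\<exists>N. \<forall>f. bdd_borel f \<longrightarrow> (\<forall>k. \<bar>k\<bar> \<le> N \<longrightarrow> fcoeff f k = 0) \<longrightarrow> (\<integral>\<theta>. f \<theta> * p \<theta> \<partial>circ) = 0"
  using assms
proof induction
  case (monom c k)
  have "(\<integral>\<theta>. f \<theta> * (c * cis (of_int k * \<theta>)) \<partial>circ) = c * fcoeff f (-k)" for f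
    unfolding fcoeff_def Bochner_Integration.integral_mult_right_zero[symmetric] by (simp add: mult_ac)
  then show ?case by (intro exI[of _ "\<bar>k\<bar>"]) auto
next
  case (add p q)
  then obtain N1 N2 where N: "\<forall>f. bdd_borel f \<longrightarrow> (\<forall>k. \<bar>k\<bar> \<le> N1 \<longrightarrow> fcoeff f k = 0) \<longrightarrow> (\<integral>\<theta>. f \<theta> * p \<theta> \<partial>circ) = 0"
    "\<forall>f. bdd_borel f \<longrightarrow> (\<forall>k. \<bar>k\<bar> \<le> N2 \<longrightarrow> fcoeff f k = 0) \<longrightarrow> (\<integral>\<theta>. f \<theta> * q \<theta> \<partial>circ) = 0"
    by auto
  have "(\<integral>\<theta>. f \<theta> * (p \<theta> + q \<theta>) \<partial>circ) = 0"
    if f: "bdd_borel f" and z: "\<forall>k. \<bar>k\<bar> \<le> max N1 N2 \<longrightarrow> fcoeff f k = 0" for f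
  proof -
    have "(\<integral>\<theta>. f \<theta> * (p \<theta> + q \<theta>) \<partial>circ) = (\<integral>\<theta>. f \<theta> * p \<theta> \<partial>circ) + (\<integral>\<theta>. f \<theta> * q \<theta> \<partial>circ)"
      unfolding distrib_left using add.hyps[THEN trig_poly_bdd_borel] f
      by (intro Bochner_Integration.integral_add bdd_borel_integrable bdd_borel_intros)
    then show ?thesis using N f z by auto
  qed
  then show ?case by blast
qed

text \<open>An approximate Parseval identity for a continuous function against an indicator. The remainder of
  the Fourier expansion of the indicator is orthogonal to a trigonometric polynomial that is
  uniformly close to \<open>F\<close>, and by Bessel it has \<open>L\<^sup>1\<close> norm at most one, so it sees only the small
  difference between \<open>F\<close> and the polynomial.\<close>

lemma fourier_pairing:
  fixes F :: "complex \<Rightarrow> real"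
  assumes F: "continuous_on (sphere 0 1) F" and E: "E \<in> sets borel" and e: "e > 0"
  defines "v \<equiv> \<lambda>\<theta>. complex_of_real (F (cis \<theta>))"
  defines "\<eta> \<equiv> \<lambda>\<theta>. complex_of_real (indicator E \<theta>)"
  obtains N where "N \<ge> 0" "cmod ((\<integral>\<theta>. v \<theta> * \<eta> \<theta> \<partial>circ) - (\<Sum>k\<in>{-N..N}. fcoeff v k * cnj (fcoeff \<eta> k))) \<le> e"
proof -
  obtain g where g: "real_polynomial_function g" "\<And>x. x \<in> sphere 0 1 \<Longrightarrow> \<bar>F x - g x\<bar> < e"
    using Stone_Weierstrass_real_polynomial_function[OF compact_sphere F e] by metis
  define p where "p \<theta> = complex_of_real (g (cis \<theta>))" for \<theta>
  have tp: "trig_poly p" unfolding p_def by (rule real_polynomial_function_trig_poly) fact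
  then obtain N0 where N0: "\<And>f. bdd_borel f \<Longrightarrow> (\<And>k. \<bar>k\<bar> \<le> N0 \<Longrightarrow> fcoeff f k = 0) \<Longrightarrow> (\<integral>\<theta>. f \<theta> * p \<theta> \<partial>circ) = 0"
    using trig_poly_orthogonal by metis
  define N where "N = max N0 0"
  have N: "(\<integral>\<theta>. f \<theta> * p \<theta> \<partial>circ) = 0" if "bdd_borel f" "\<And>k. \<bar>k\<bar> \<le> N \<Longrightarrow> fcoeff f k = 0" for f
    by (rule N0[OF that(1)]) (simp add: that(2) N_def)
  have contv: "continuous_on UNIV v"
    unfolding v_def by (intro continuous_intros continuous_on_compose2[OF F]) auto
  have close: "cmod (v \<theta> - p \<theta>) \<le> e" for \<theta>
    using g(2)[of "cis \<theta>"] unfolding v_def p_def of_real_diff[symmetric] norm_of_real by simp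
  have p: "bdd_borel p" using tp by (rule trig_poly_bdd_borel)
  have v: "bdd_borel v"
  proof -
    have "bdd_borel (\<lambda>\<theta>. v \<theta> - p \<theta>)"
      by (rule bdd_borelI[OF borel_measurable_diff, where B=e])
         (use close contv p in \<open>auto intro: borel_measurable_continuous_onI bdd_borel_measurable\<close>)
    from bdd_borel_add[OF this p] show ?thesis by simp
  qed
  have \<eta>: "bdd_borel \<eta>" unfolding \<eta>_def by (rule bdd_borel_indicator) fact
  define S where "S \<theta> = (\<Sum>k\<in>{-N..N}. fcoeff \<eta> k * cis (of_int k * \<theta>))" for \<theta>
  have S: "bdd_borel S" unfolding S_def by (intro bdd_borel_intros)
  define f where "f \<theta> = cnj (\<eta> \<theta> - S \<theta>)" for \<theta>
  have f: "bdd_borel f" unfolding f_def by (intro bdd_borel_intros \<eta> S)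
  have z: "fcoeff f k = 0" if "\<bar>k\<bar> \<le> N" for k
  proof -
    have "fcoeff f k = cnj (fcoeff \<eta> (-k) - fcoeff S (-k))"
      unfolding f_def fcoeff_cnj using fcoeff_diff[OF \<eta> S] by simp
    also have "fcoeff S (-k) = fcoeff \<eta> (-k)"
      unfolding S_def using that by (subst fcoeff_cis_sum) auto
    finally show ?thesis by simp
  qed
  have fp: "(\<integral>\<theta>. f \<theta> * p \<theta> \<partial>circ) = 0" using N f z by blast
  have "(\<integral>\<theta>. f \<theta> * v \<theta> \<partial>circ) = (\<integral>\<theta>. v \<theta> * \<eta> \<theta> - (\<Sum>k\<in>{-N..N}. v \<theta> * cis (- of_int k * \<theta>) * cnj (fcoeff \<eta> k)) \<partial>circ)"
    by (intro Bochner_Integration.integral_cong refl)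
       (simp add: f_def S_def \<eta>_def algebra_simps cis_cnj sum_distrib_left cnj_sum)
  also have "\<dots> = (\<integral>\<theta>. v \<theta> * \<eta> \<theta> \<partial>circ) - (\<integral>\<theta>. (\<Sum>k\<in>{-N..N}. v \<theta> * cis (- of_int k * \<theta>) * cnj (fcoeff \<eta> k)) \<partial>circ)"
    by (intro Bochner_Integration.integral_diff bdd_borel_integrable bdd_borel_intros v \<eta>)
  also have "(\<integral>\<theta>. (\<Sum>k\<in>{-N..N}. v \<theta> * cis (- of_int k * \<theta>) * cnj (fcoeff \<eta> k)) \<partial>circ)
      = (\<Sum>k\<in>{-N..N}. \<integral>\<theta>. v \<theta> * cis (- of_int k * \<theta>) * cnj (fcoeff \<eta> k) \<partial>circ)"
    by (intro Bochner_Integration.integral_sum bdd_borel_integrable bdd_borel_intros v)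
  finally have eq: "(\<integral>\<theta>. f \<theta> * v \<theta> \<partial>circ)
      = (\<integral>\<theta>. v \<theta> * \<eta> \<theta> \<partial>circ) - (\<Sum>k\<in>{-N..N}. fcoeff v k * cnj (fcoeff \<eta> k))"
    by (simp add: fcoeff_def)
  have f2: "(\<integral>\<theta>. (cmod (f \<theta>))\<^sup>2 \<partial>circ) \<le> 1"
  proof -
    have "(\<integral>\<theta>. (cmod (f \<theta>))\<^sup>2 \<partial>circ) = (\<integral>\<theta>. (cmod (\<eta> \<theta> - S \<theta>))\<^sup>2 \<partial>circ)"
      unfolding f_def complex_mod_cnj ..
    also have "\<dots> = (\<integral>\<theta>. (cmod (\<eta> \<theta>))\<^sup>2 \<partial>circ) - (\<Sum>k\<in>{-N..N}. (cmod (fcoeff \<eta> k))\<^sup>2)"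
      unfolding S_def by (rule bessel_identity[OF \<eta>]) simp
    also have "\<dots> \<le> (\<integral>\<theta>. (cmod (\<eta> \<theta>))\<^sup>2 \<partial>circ)" by (simp add: sum_nonneg)
    also have "(\<lambda>\<theta>. (cmod (\<eta> \<theta>))\<^sup>2) = indicator E"
      by (auto simp: \<eta>_def indicator_def fun_eq_iff)
    also have "(\<integral>\<theta>. indicator E \<theta> \<partial>circ) \<le> (1::real)"
      using E by simp
    finally show ?thesis .
  qed
  have i2: "integrable circ (\<lambda>\<theta>. (cmod (f \<theta>))\<^sup>2)"
    using bdd_borel_integrable[OF bdd_borel_mult[OF f bdd_borel_cnj[OF f]]]
    unfolding complex_norm_square[symmetric] complex_of_real_integrable_eq .
  have i1: "integrable circ (\<lambda>\<theta>. cmod (f \<theta>))"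
    using bdd_borel_integrable[OF f] by simp
  have f1: "(\<integral>\<theta>. cmod (f \<theta>) \<partial>circ) \<le> 1"
  proof -
    have "(\<integral>\<theta>. cmod (f \<theta>) \<partial>circ) \<le> (\<integral>\<theta>. 1/2 + (cmod (f \<theta>))\<^sup>2 / 2 \<partial>circ)"
    proof (intro integral_mono)
      fix \<theta> show "cmod (f \<theta>) \<le> 1/2 + (cmod (f \<theta>))\<^sup>2 / 2"
        using sum_squares_bound[of 1 "cmod (f \<theta>)"] by simp
    qed (use i1 i2 in auto)
    also have "\<dots> = 1/2 + (\<integral>\<theta>. (cmod (f \<theta>))\<^sup>2 \<partial>circ) / 2"
      using i2 by simp
    finally show ?thesis using f2 by simp
  qed
  have "(\<integral>\<theta>. f \<theta> * v \<theta> \<partial>circ) = (\<integral>\<theta>. f \<theta> * (v \<theta> - p \<theta>) \<partial>circ)"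
    unfolding right_diff_distrib using fp
    by (subst Bochner_Integration.integral_diff) (auto intro!: bdd_borel_integrable bdd_borel_intros f v p)
  then have "cmod (\<integral>\<theta>. f \<theta> * v \<theta> \<partial>circ) \<le> (\<integral>\<theta>. cmod (f \<theta> * (v \<theta> - p \<theta>)) \<partial>circ)"
    using integral_norm_bound by metis
  also have "\<dots> \<le> (\<integral>\<theta>. cmod (f \<theta>) * e \<partial>circ)"
    using close f v p i1
    by (intro integral_mono integrable_norm bdd_borel_integrable bdd_borel_intros)
       (auto simp: norm_mult intro!: mult_left_mono)
  also have "\<dots> \<le> e"
    using f1 e by (simp add: mult_le_cancel_right1)
  finally have "cmod ((\<integral>\<theta>. v \<theta> * \<eta> \<theta> \<partial>circ) - (\<Sum>k\<in>{-N..N}. fcoeff v k * cnj (fcoeff \<eta> k))) \<le> e"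
    unfolding eq .
  moreover have "N \<ge> 0" by (simp add: N_def)
  ultimately show ?thesis using that by blast
qed

section \<open>Boundary averages and the half-order energy\<close>

lemma harm_le_ln:
  assumes "n > 0"
  shows "harm n \<le> 1 + ln (real n)"
  using assms
proof (induction n rule: nat_induct_non_zero)
  case 1 show ?case by (simp add: harm_def)
next
  case (Suc n)
  have "ln (real n / real (Suc n)) \<le> real n / real (Suc n) - 1"
    using Suc.hyps by (intro ln_le_minus_one) simp
  also have "\<dots> = - (1 / real (Suc n))" by (simp add: field_simps)
  finally have "1 / real (Suc n) \<le> ln (real (Suc n)) - ln (real n)"
    using Suc.hyps by (simp add: ln_div)
  moreover have "harm (Suc n) = harm n + 1 / real (Suc n)"
    by (simp add: harm_Suc inverse_eq_divide)
  ultimately show ?case using Suc.IH by linarith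
qed

lemma sum_inverse_abs_int:
  "(\<Sum>k\<in>{- int n..int n} - {0}. 1 / real_of_int \<bar>k\<bar>) = 2 * harm n"
proof (induction n)
  case 0 show ?case by (simp add: harm_def)
next
  case (Suc n)
  have "{- int (Suc n)..int (Suc n)} - {0} = insert (int (Suc n)) (insert (- int (Suc n)) ({- int n..int n} - {0}))"
    by auto
  then have "(\<Sum>k\<in>{- int (Suc n)..int (Suc n)} - {0}. 1 / real_of_int \<bar>k\<bar>)
     = 2 / real (Suc n) + (\<Sum>k\<in>{- int n..int n} - {0}. 1 / real_of_int \<bar>k\<bar>)"
    by (simp add: field_simps)
  then show ?case using Suc by (simp add: harm_Suc field_simps)
qed

text \<open>This is where the logarithm and its exact constant come from. The coefficients of an indicator are
  at most \<open>l\<close>; summing \<open>l\<^sup>2 / \<bar>k\<bar>\<close> over both signs up to the frequency \<open>n\<close> gives \<open>2 * l\<^sup>2 * ln n\<close> up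
  to lower order. Beyond \<open>n\<close> the weight is at most \<open>1 / n\<close> and Bessel's inequality bounds the squares
  by \<open>l\<close>. The choice \<open>n \<approx> 1 / l\<close> makes this second part as small as \<open>l\<^sup>2\<close>.\<close>

lemma dual_energy_bound:
  assumes E: "E \<in> sets borel" and l: "l = measure circ E" "0 < l"
  defines "\<eta> \<equiv> \<lambda>\<theta>. complex_of_real (indicator E \<theta>)"
  shows "(\<Sum>k\<in>{-N..N} - {0}. (cmod (fcoeff \<eta> k))\<^sup>2 / real_of_int \<bar>k\<bar>) \<le> l\<^sup>2 * (2 * ln (1 / l) + 3)"
proof -
  have l1: "l \<le> 1" using l by simp
  have \<eta>: "bdd_borel \<eta>" unfolding \<eta>_def by (rule bdd_borel_indicator) fact
  \<comment> \<open>The cut-off frequency; both parts of the sum are then of order \<open>l\<^sup>2\<close> up to the logarithm.\<close>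
  define n where "n = nat \<lfloor>1 / l\<rfloor>"
  have "1 \<le> 1 / l" using l l1 by simp
  then have n: "n > 0" "real n \<le> 1 / l" "1 / l < real n + 1"
    unfolding n_def by linarith+
  have int_l: "(\<integral>\<theta>. indicator E \<theta> \<partial>circ) = l" using E l by simp
  have coeff: "cmod (fcoeff \<eta> k) \<le> l" for k
  proof -
    have "cmod (fcoeff \<eta> k) \<le> (\<integral>\<theta>. cmod (\<eta> \<theta> * cis (- of_int k * \<theta>)) \<partial>circ)"
      unfolding fcoeff_def by (rule integral_norm_bound)
    also have "(\<lambda>\<theta>. cmod (\<eta> \<theta> * cis (- of_int k * \<theta>))) = indicator E"
      by (auto simp: \<eta>_def norm_mult indicator_def)
    finally show ?thesis using int_l by simp
  qed
  have sq: "(\<Sum>k\<in>{-N..N}. (cmod (fcoeff \<eta> k))\<^sup>2) \<le> l"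
  proof -
    have "(\<Sum>k\<in>{-N..N}. (cmod (fcoeff \<eta> k))\<^sup>2) \<le> (\<integral>\<theta>. (cmod (\<eta> \<theta>))\<^sup>2 \<partial>circ)"
      by (rule bessel_inequality[OF \<eta>]) simp
    also have "(\<lambda>\<theta>. (cmod (\<eta> \<theta>))\<^sup>2) = indicator E"
      by (auto simp: \<eta>_def indicator_def)
    finally show ?thesis using int_l by simp
  qed
  have tm: "(cmod (fcoeff \<eta> k))\<^sup>2 / real_of_int \<bar>k\<bar>
      \<le> (if \<bar>k\<bar> \<le> int n then l\<^sup>2 * (1 / real_of_int \<bar>k\<bar>) else 0) + l * (cmod (fcoeff \<eta> k))\<^sup>2"
    if "k \<noteq> 0" for k
  proof (cases "\<bar>k\<bar> \<le> int n")
    case True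
    have "(cmod (fcoeff \<eta> k))\<^sup>2 \<le> l\<^sup>2" using coeff[of k] by (intro power_mono) auto
    then have "(cmod (fcoeff \<eta> k))\<^sup>2 / real_of_int \<bar>k\<bar> \<le> l\<^sup>2 / real_of_int \<bar>k\<bar>"
      by (intro divide_right_mono) auto
    moreover have "0 \<le> l * (cmod (fcoeff \<eta> k))\<^sup>2" using l by simp
    ultimately show ?thesis using True by simp
  next
    case False
    then have "real n + 1 \<le> real_of_int \<bar>k\<bar>" by linarith
    then have "1 / l \<le> real_of_int \<bar>k\<bar>" using n by linarith
    then have "1 / real_of_int \<bar>k\<bar> \<le> l"
      using l that by (simp add: field_simps)
    then have "(cmod (fcoeff \<eta> k))\<^sup>2 * (1 / real_of_int \<bar>k\<bar>) \<le> (cmod (fcoeff \<eta> k))\<^sup>2 * l"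
      by (intro mult_left_mono) auto
    then show ?thesis using False by (simp add: mult.commute)
  qed
  have "(\<Sum>k\<in>{-N..N} - {0}. (cmod (fcoeff \<eta> k))\<^sup>2 / real_of_int \<bar>k\<bar>)
     \<le> (\<Sum>k\<in>{-N..N} - {0}. (if \<bar>k\<bar> \<le> int n then l\<^sup>2 * (1 / real_of_int \<bar>k\<bar>) else 0) + l * (cmod (fcoeff \<eta> k))\<^sup>2)"
    by (intro sum_mono tm) auto
  also have "\<dots> = (\<Sum>k\<in>{-N..N} - {0}. (if \<bar>k\<bar> \<le> int n then l\<^sup>2 * (1 / real_of_int \<bar>k\<bar>) else 0))
       + l * (\<Sum>k\<in>{-N..N} - {0}. (cmod (fcoeff \<eta> k))\<^sup>2)"
    by (simp add: sum.distrib sum_distrib_left)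
  also have "(\<Sum>k\<in>{-N..N} - {0}. (if \<bar>k\<bar> \<le> int n then l\<^sup>2 * (1 / real_of_int \<bar>k\<bar>) else 0))
       \<le> (\<Sum>k\<in>{- int n..int n} - {0}. l\<^sup>2 * (1 / real_of_int \<bar>k\<bar>))"
    by (subst sum.inter_filter[symmetric]) (auto intro!: sum_mono2)
  also have "\<dots> = l\<^sup>2 * (2 * harm n)"
    unfolding sum_distrib_left[symmetric] sum_inverse_abs_int ..
  also have "l * (\<Sum>k\<in>{-N..N} - {0}. (cmod (fcoeff \<eta> k))\<^sup>2) \<le> l * l"
    using l by (intro mult_left_mono order_trans[OF sum_mono2 sq]) auto
  also have "harm n \<le> 1 + ln (1 / l)"
  proof -
    have "ln (real n) \<le> ln (1 / l)" using n l by (subst ln_le_cancel_iff) auto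
    then show ?thesis using harm_le_ln[OF n(1)] by linarith
  qed
  finally show ?thesis using l by (simp add: power2_eq_square algebra_simps)
qed

text \<open>Cauchy-Schwarz between the half-order norm of the function and the dual norm of the indicator; the
  zeroth coefficients split off as the product of the two averages.\<close>

lemma trace_pairing_bound:
  fixes F :: "complex \<Rightarrow> real"
  assumes F: "continuous_on (sphere 0 1) F" and E: "E \<in> sets borel"
    and l: "l = measure circ E" "0 < l" 
    and D: "\<And>N. (\<Sum>k\<in>{-N..N}. real_of_int \<bar>k\<bar> * (cmod (fcoeff (\<lambda>\<theta>. of_real (F (cis \<theta>))) k))\<^sup>2) \<le> D / 2"
  shows "(\<integral>\<theta>. F (cis \<theta>) * indicator E \<theta> \<partial>circ)
     \<le> l * (\<integral>\<theta>. F (cis \<theta>) \<partial>circ) + l * sqrt (D * (ln (1 / l) + 3 / 2))"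
proof (rule field_le_epsilon)
  fix e :: real assume e: "e > 0"
  define v where "v = (\<lambda>\<theta>. complex_of_real (F (cis \<theta>)))"
  define \<eta> where "\<eta> = (\<lambda>\<theta>. complex_of_real (indicator E \<theta>))"
  obtain N where N0: "N \<ge> 0" and N: "cmod ((\<integral>\<theta>. v \<theta> * \<eta> \<theta> \<partial>circ) - (\<Sum>k\<in>{-N..N}. fcoeff v k * cnj (fcoeff \<eta> k))) \<le> e"
    unfolding v_def \<eta>_def using fourier_pairing[OF F E e] by blast
  have l1: "l \<le> 1" using l by simp
  have D0: "0 \<le> D" using D[of 0] by simp
  have v0: "fcoeff v 0 = of_real (\<integral>\<theta>. F (cis \<theta>) \<partial>circ)" by (simp add: fcoeff_def v_def)
  have \<eta>0: "fcoeff \<eta> 0 = of_real l"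
    using E l by (simp add: fcoeff_def \<eta>_def)
  have 0: "(\<integral>\<theta>. v \<theta> * \<eta> \<theta> \<partial>circ) = of_real (\<integral>\<theta>. F (cis \<theta>) * indicator E \<theta> \<partial>circ)"
    unfolding v_def \<eta>_def of_real_mult[symmetric] by (rule integral_complex_of_real)
  have rest: "cmod (\<Sum>k\<in>{-M..M} - {0}. fcoeff v k * cnj (fcoeff \<eta> k)) \<le> l * sqrt (D * (ln (1 / l) + 3 / 2))" for M
  proof -
    have "cmod (\<Sum>k\<in>{-M..M} - {0}. fcoeff v k * cnj (fcoeff \<eta> k))
      \<le> (\<Sum>k\<in>{-M..M} - {0}. cmod (fcoeff v k) * cmod (fcoeff \<eta> k))"
      by (rule order_trans[OF norm_sum]) (simp add: norm_mult)
    also have "\<dots> = (\<Sum>k\<in>{-M..M} - {0}. (sqrt (of_int \<bar>k\<bar>) * cmod (fcoeff v k)) * (cmod (fcoeff \<eta> k) / sqrt (of_int \<bar>k\<bar>)))"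
      by (intro sum.cong) auto
    also have "\<dots> \<le> sqrt (\<Sum>k\<in>{-M..M} - {0}. (sqrt (of_int \<bar>k\<bar>) * cmod (fcoeff v k))\<^sup>2)
        * sqrt (\<Sum>k\<in>{-M..M} - {0}. (cmod (fcoeff \<eta> k) / sqrt (of_int \<bar>k\<bar>))\<^sup>2)"
      using L2_set_mult_ineq[of "\<lambda>k. sqrt (of_int \<bar>k\<bar>) * cmod (fcoeff v k)" "\<lambda>k. cmod (fcoeff \<eta> k) / sqrt (of_int \<bar>k\<bar>)" "{-M..M} - {0}"]
      by (simp add: L2_set_def)
    also have "\<dots> \<le> sqrt (D / 2) * sqrt (l\<^sup>2 * (2 * ln (1 / l) + 3))"
    proof (intro mult_mono real_sqrt_le_mono)
      have "(\<Sum>k\<in>{-M..M} - {0}. (sqrt (of_int \<bar>k\<bar>) * cmod (fcoeff v k))\<^sup>2)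
        \<le> (\<Sum>k\<in>{-M..M}. real_of_int \<bar>k\<bar> * (cmod (fcoeff v k))\<^sup>2)"
        by (simp add: power_mult_distrib) (intro sum_mono2, auto)
      then show "(\<Sum>k\<in>{-M..M} - {0}. (sqrt (of_int \<bar>k\<bar>) * cmod (fcoeff v k))\<^sup>2) \<le> D / 2"
        using D[of M] unfolding v_def by linarith
      show "(\<Sum>k\<in>{-M..M} - {0}. (cmod (fcoeff \<eta> k) / sqrt (of_int \<bar>k\<bar>))\<^sup>2) \<le> l\<^sup>2 * (2 * ln (1 / l) + 3)"
        using dual_energy_bound[OF E l, of M] by (simp add: power_divide \<eta>_def)
    qed (use D0 in \<open>auto intro: sum_nonneg\<close>)
    also have "\<dots> = sqrt (l\<^sup>2 * (D * (ln (1 / l) + 3 / 2)))"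
      unfolding real_sqrt_mult[symmetric] by (simp add: field_simps)
    also have "\<dots> = l * sqrt (D * (ln (1 / l) + 3 / 2))"
      using l by (subst real_sqrt_mult) simp
    finally show ?thesis .
  qed
  have "(\<Sum>k\<in>{-N..N}. fcoeff v k * cnj (fcoeff \<eta> k))
      = of_real (l * (\<integral>\<theta>. F (cis \<theta>) \<partial>circ)) + (\<Sum>k\<in>{-N..N} - {0}. fcoeff v k * cnj (fcoeff \<eta> k))"
    using N0 by (subst sum.remove[of _ 0]) (auto simp: v0 \<eta>0)
  then have "complex_of_real ((\<integral>\<theta>. F (cis \<theta>) * indicator E \<theta> \<partial>circ) - l * (\<integral>\<theta>. F (cis \<theta>) \<partial>circ))
      = ((\<integral>\<theta>. v \<theta> * \<eta> \<theta> \<partial>circ) - (\<Sum>k\<in>{-N..N}. fcoeff v k * cnj (fcoeff \<eta> k)))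
        + (\<Sum>k\<in>{-N..N} - {0}. fcoeff v k * cnj (fcoeff \<eta> k))"
    using 0 by simp
  then have "\<bar>(\<integral>\<theta>. F (cis \<theta>) * indicator E \<theta> \<partial>circ) - l * (\<integral>\<theta>. F (cis \<theta>) \<partial>circ)\<bar>
      \<le> e + l * sqrt (D * (ln (1 / l) + 3 / 2))"
    using norm_triangle_mono[OF N rest[of N]] by (metis norm_of_real real_norm_def)
  then show "(\<integral>\<theta>. F (cis \<theta>) * indicator E \<theta> \<partial>circ)
     \<le> l * (\<integral>\<theta>. F (cis \<theta>) \<partial>circ) + l * sqrt (D * (ln (1 / l) + 3 / 2)) + e"
    by linarith
qed

section \<open>The half-order energy of a trace and the Dirichlet integral\<close>

lemma nn_integral_Icc_circ:
  fixes f :: "real \<Rightarrow> ennreal"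
  assumes "f \<in> borel_measurable borel"
  shows "(\<integral>\<^sup>+\<theta>\<in>{0..2*pi}. f \<theta> \<partial>lborel) = ennreal (2*pi) * (\<integral>\<^sup>+\<theta>. f \<theta> \<partial>circ)"
proof -
  have "ennreal (2*pi) * (X / ennreal (2*pi)) = X" for X
    using ennreal_mult_divide_eq[of "ennreal (2*pi)" X] by (simp add: ennreal_times_divide mult.commute)
  then show ?thesis by (simp only: nn_integral_circ[OF assms])
qed

lemma nn_integral_Icc_continuous:
  fixes f :: "real \<Rightarrow> real"
  assumes f: "continuous_on {a..b} f" and nonneg: "\<And>x. x \<in> {a..b} \<Longrightarrow> 0 \<le> f x"
  shows "(\<integral>\<^sup>+x\<in>{a..b}. ennreal (f x) \<partial>lborel) = ennreal (integral {a..b} f)"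
proof -
  have si: "set_integrable lborel {a..b} f"
    by (rule borel_integrable_atLeastAtMost') fact
  have "(\<integral>\<^sup>+x\<in>{a..b}. ennreal (f x) \<partial>lborel) = (\<integral>\<^sup>+x. ennreal (indicator {a..b} x *\<^sub>R f x) \<partial>lborel)"
    by (intro nn_integral_cong) (auto split: split_indicator)
  also have "\<dots> = ennreal (\<integral>x. indicator {a..b} x *\<^sub>R f x \<partial>lborel)"
    using si nonneg unfolding set_integrable_def
    by (intro nn_integral_eq_integral) (auto split: split_indicator)
  also have "\<dots> = ennreal (integral {a..b} f)"
    using set_borel_integral_eq_integral(2)[OF si] by (simp add: set_lebesgue_integral_def)
  finally show ?thesis .
qed

lemma continuous_slice:
  fixes g :: "real \<Rightarrow> real \<Rightarrow> 'a::topological_space"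
  assumes "continuous_on ({0..R} \<times> UNIV) (\<lambda>(r, \<theta>). g r \<theta>)" "0 \<le> r" "r \<le> R"
  shows "continuous_on UNIV (g r)"
proof -
  have c: "continuous_on UNIV (\<lambda>\<theta>. (r, \<theta>))" by (intro continuous_intros)
  have s: "(\<lambda>\<theta>. (r, \<theta>)) ` UNIV \<subseteq> {0..R} \<times> UNIV" using assms(2,3) by auto
  show ?thesis using continuous_on_compose2[OF assms(1) c s] by simp
qed

lemma continuous_on_disk_polar:
  assumes "continuous_on (ball 0 1) w" "R < 1"
  shows "continuous_on ({0..R} \<times> UNIV) (\<lambda>(r, \<theta>). w (of_real r * cis \<theta>) :: real)"
  unfolding case_prod_beta
  by (rule continuous_on_compose2[OF assms(1)])
     (use assms(2) in \<open>auto intro!: continuous_intros simp: norm_mult\<close>)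

text \<open>The partial derivatives are separate arguments, so that for a composition \<open>h \<circ> u\<close> they can be
  given by the chain rule.\<close>

definition has_gradient_on :: "complex set \<Rightarrow> (complex \<Rightarrow> real) \<Rightarrow> (complex \<Rightarrow> real) \<Rightarrow> (complex \<Rightarrow> real) \<Rightarrow> bool" where
  "has_gradient_on S v vx vy \<longleftrightarrow> continuous_on S vx \<and> continuous_on S vy \<and>
     (\<forall>z\<in>S. (v has_derivative (\<lambda>h. vx z * Re h + vy z * Im h)) (at z))"

lemma has_gradient_on_continuous:
  assumes "has_gradient_on S v vx vy" shows "continuous_on S v"
  using assms unfolding has_gradient_on_def
  by (intro continuous_at_imp_continuous_on ballI) (blast intro: has_derivative_continuous)

text \<open>The integrand of the normalised Dirichlet integral, extended by zero to a Borel function on the plane.\<close>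

definition grad_density :: "(complex \<Rightarrow> real) \<Rightarrow> (complex \<Rightarrow> real) \<Rightarrow> complex \<Rightarrow> ennreal" where
  "grad_density ux uy z = ennreal (((ux z)\<^sup>2 + (uy z)\<^sup>2) / pi) * indicator (ball 0 1) z"

lemma measurable_grad_density:
  assumes grad: "has_gradient_on (ball 0 1) u ux uy"
  shows "grad_density ux uy \<in> borel_measurable borel"
proof -
  have "(\<lambda>z. indicator (ball 0 1) z *\<^sub>R (((ux z)\<^sup>2 + (uy z)\<^sup>2) / pi)) \<in> borel_measurable borel"
    using grad unfolding has_gradient_on_def
    by (intro borel_measurable_continuous_on_indicator continuous_intros) auto
  then have "(\<lambda>z. ennreal (indicator (ball 0 1) z *\<^sub>R (((ux z)\<^sup>2 + (uy z)\<^sup>2) / pi))) \<in> borel_measurable borel"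
    by measurable
  moreover have "(\<lambda>z. ennreal (indicator (ball 0 1) z *\<^sub>R (((ux z)\<^sup>2 + (uy z)\<^sup>2) / pi))) = grad_density ux uy"
    by (auto simp: grad_density_def fun_eq_iff split: split_indicator)
  ultimately show ?thesis by (simp only:)
qed

lemma circ_leibniz:
  fixes f g :: "real \<Rightarrow> real \<Rightarrow> 'a::euclidean_space"
  assumes f: "continuous_on ({0..R} \<times> UNIV) (\<lambda>(r, \<theta>). f r \<theta>)"
    and g: "continuous_on ({0..R} \<times> UNIV) (\<lambda>(r, \<theta>). g r \<theta>)"
    and deriv: "\<And>r \<theta>. r \<in> {0..R} \<Longrightarrow> ((\<lambda>r. f r \<theta>) has_vector_derivative g r \<theta>) (at r within {0..R})"
    and r: "0 \<le> r" "r \<le> R"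
  shows "((\<lambda>r. \<integral>\<theta>. f r \<theta> \<partial>circ) has_vector_derivative (\<integral>\<theta>. g r \<theta> \<partial>circ)) (at r within {0..R})"
proof -
  have "((\<lambda>r. integral (cbox 0 (2*pi)) (f r)) has_vector_derivative integral (cbox 0 (2*pi)) (g r)) (at r within {0..R})"
  proof (rule leibniz_rule_vector_derivative)
    fix x assume "x \<in> {0..R}"
    then show "f x integrable_on cbox 0 (2*pi)"
      by (intro integrable_continuous continuous_on_subset[OF continuous_slice[OF f]]) auto
  next
    show "continuous_on ({0..R} \<times> cbox 0 (2*pi)) (\<lambda>(x, t). g x t)"
      by (rule continuous_on_subset[OF g]) auto
  qed (use r deriv in auto)
  then have "((\<lambda>r. integral {0..2*pi} (f r) /\<^sub>R (2*pi)) has_vector_derivative integral {0..2*pi} (g r) /\<^sub>R (2*pi)) (at r within {0..R})"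
    by (intro bounded_linear.has_vector_derivative[OF bounded_linear_scaleR_right]) simp
  moreover have "integral {0..2*pi} (g r) /\<^sub>R (2*pi) = (\<integral>\<theta>. g r \<theta> \<partial>circ)"
    by (rule integral_circ[symmetric, OF continuous_slice[OF g r]])
  moreover have "(\<integral>\<theta>. f s \<theta> \<partial>circ) = integral {0..2*pi} (f s) /\<^sub>R (2*pi)" if "s \<in> {0..R}" for s
    using that by (intro integral_circ continuous_slice[OF f]) auto
  ultimately show ?thesis
    using r by (auto intro: has_vector_derivative_transform)
qed

lemma circ_integral_of_derivative:
  fixes F F' :: "real \<Rightarrow> 'a::euclidean_space"
  assumes "\<And>\<theta>. (F has_vector_derivative F' \<theta>) (at \<theta>)" and c: "continuous_on UNIV F'"
    and "F (2*pi) = F 0"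
  shows "(\<integral>\<theta>. F' \<theta> \<partial>circ) = 0"
proof -
  have "(F' has_integral F (2*pi) - F 0) {0..2*pi}"
    by (rule fundamental_theorem_of_calculus) (use assms in \<open>auto intro: has_vector_derivative_at_within\<close>)
  then show ?thesis
    using assms(3) by (simp add: integral_circ[OF c] integral_unique)
qed

context
  fixes v vx vy :: "complex \<Rightarrow> real"
  assumes grad: "has_gradient_on (ball 0 1) v vx vy"
begin

definition radial_deriv :: "real \<Rightarrow> real \<Rightarrow> real" where
  "radial_deriv r \<theta> = vx (r * cis \<theta>) * cos \<theta> + vy (r * cis \<theta>) * sin \<theta>"

definition angular_deriv :: "real \<Rightarrow> real \<Rightarrow> real" where
  "angular_deriv r \<theta> = r * (vy (r * cis \<theta>) * cos \<theta> - vx (r * cis \<theta>) * sin \<theta>)"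

lemma gradient_square_polar:
  "(radial_deriv r \<theta>)\<^sup>2 + (vy (r * cis \<theta>) * cos \<theta> - vx (r * cis \<theta>) * sin \<theta>)\<^sup>2
    = (vx (r * cis \<theta>))\<^sup>2 + (vy (r * cis \<theta>))\<^sup>2"
proof -
  have "(a * c + b * s)\<^sup>2 + (b * c - a * s)\<^sup>2 = (a\<^sup>2 + b\<^sup>2) * (s\<^sup>2 + c\<^sup>2)" for a b c s :: real
    by (simp add: power2_eq_square algebra_simps)
  from this[of "vx (r * cis \<theta>)" "cos \<theta>" "vy (r * cis \<theta>)" "sin \<theta>"] show ?thesis
    by (simp add: radial_deriv_def)
qed

lemma in_disk: "\<bar>r\<bar> < 1 \<Longrightarrow> of_real r * cis \<theta> \<in> ball 0 1"
  by (simp add: norm_mult)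

lemma radial_derivative:
  assumes "\<bar>r\<bar> < 1"
  shows "((\<lambda>r. v (of_real r * cis \<theta>)) has_real_derivative radial_deriv r \<theta>) (at r within A)"
proof -
  have "(v has_derivative (\<lambda>h. vx (r * cis \<theta>) * Re h + vy (r * cis \<theta>) * Im h)) (at (r * cis \<theta>))"
    using grad in_disk[OF assms] unfolding has_gradient_on_def by blast
  then have "((\<lambda>r. v (of_real r * cis \<theta>)) has_derivative
     (\<lambda>d. vx (r * cis \<theta>) * Re (d * cis \<theta>) + vy (r * cis \<theta>) * Im (d * cis \<theta>))) (at r within A)"
    by (rule has_derivative_compose[rotated]) (auto intro!: derivative_eq_intros)
  then show ?thesis
    unfolding has_real_derivative_iff_has_vector_derivative has_vector_derivative_def radial_deriv_def by (simp add: algebra_simps)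
qed

lemma angular_derivative:
  assumes "\<bar>r\<bar> < 1"
  shows "((\<lambda>\<theta>. v (of_real r * cis \<theta>)) has_real_derivative angular_deriv r \<theta>) (at \<theta> within A)"
proof -
  have "(v has_derivative (\<lambda>h. vx (r * cis \<theta>) * Re h + vy (r * cis \<theta>) * Im h)) (at (r * cis \<theta>))"
    using grad in_disk[OF assms] unfolding has_gradient_on_def by blast
  moreover have "((\<lambda>\<theta>. of_real r * cis \<theta>) has_derivative (\<lambda>d. d *\<^sub>R (of_real r * (\<i> * cis \<theta>)))) (at \<theta> within A)"
    unfolding cis_conv_exp has_vector_derivative_def[symmetric]
    by (auto intro!: derivative_eq_intros has_vector_derivative_real_field)
  ultimately have "((\<lambda>\<theta>. v (of_real r * cis \<theta>)) has_derivative
     (\<lambda>d. vx (r * cis \<theta>) * Re (d *\<^sub>R (of_real r * (\<i> * cis \<theta>))) + vy (r * cis \<theta>) * Im (d *\<^sub>R (of_real r * (\<i> * cis \<theta>))))) (at \<theta> within A)"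
    by (rule has_derivative_compose[rotated])
  then show ?thesis
    unfolding has_real_derivative_iff_has_vector_derivative has_vector_derivative_def angular_deriv_def by (simp add: algebra_simps)
qed

lemma continuous_vx: "continuous_on (ball 0 1) vx" and continuous_vy: "continuous_on (ball 0 1) vy"
  and continuous_v: "continuous_on (ball 0 1) v"
  using grad has_gradient_on_continuous[OF grad] by (auto simp: has_gradient_on_def)

lemma continuous_radial_deriv: "R < 1 \<Longrightarrow> continuous_on ({0..R} \<times> UNIV) (\<lambda>(r, \<theta>). radial_deriv r \<theta>)"
  using continuous_on_disk_polar[OF continuous_vx] continuous_on_disk_polar[OF continuous_vy]
  unfolding radial_deriv_def case_prod_beta by (intro continuous_intros)

lemma continuous_angular_deriv: "R < 1 \<Longrightarrow> continuous_on ({0..R} \<times> UNIV) (\<lambda>(r, \<theta>). angular_deriv r \<theta>)"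
  using continuous_on_disk_polar[OF continuous_vx] continuous_on_disk_polar[OF continuous_vy]
  unfolding angular_deriv_def case_prod_beta by (intro continuous_intros)

definition trace_coeff :: "int \<Rightarrow> real \<Rightarrow> complex" where
  "trace_coeff k r = fcoeff (\<lambda>\<theta>. of_real (v (of_real r * cis \<theta>))) k"

lemma trace_coeff_derivative:
  assumes r: "0 \<le> r" "r \<le> R" and R: "R < 1"
  shows "(trace_coeff k has_vector_derivative fcoeff (\<lambda>\<theta>. of_real (radial_deriv r \<theta>)) k) (at r within {0..R})"
proof -
  let ?f = "\<lambda>r \<theta>. complex_of_real (v (of_real r * cis \<theta>)) * cis (- of_int k * \<theta>)"
  let ?g = "\<lambda>r \<theta>. complex_of_real (radial_deriv r \<theta>) * cis (- of_int k * \<theta>)"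
  have cf: "continuous_on ({0..R} \<times> UNIV) (\<lambda>(r, \<theta>). ?f r \<theta>)"
    using continuous_on_disk_polar[OF continuous_v R]
    unfolding case_prod_beta by (intro continuous_intros)
  have cg: "continuous_on ({0..R} \<times> UNIV) (\<lambda>(r, \<theta>). ?g r \<theta>)"
    using continuous_radial_deriv[OF R]
    unfolding case_prod_beta by (intro continuous_intros)
  have "((\<lambda>x. ?f x \<theta>) has_vector_derivative ?g x \<theta>) (at x within {0..R})" if "x \<in> {0..R}" for x \<theta>
    using that R by (intro has_vector_derivative_mult_left has_vector_derivative_of_real radial_derivative) auto
  from circ_leibniz[OF cf cg this r] show ?thesis
    unfolding trace_coeff_def[abs_def] fcoeff_def .
qed

text \<open>Integration by parts in \<open>\<theta>\<close>.\<close>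

lemma fcoeff_angular_deriv:
  assumes r: "0 \<le> r" and R: "r < 1"
  shows "fcoeff (\<lambda>\<theta>. of_real (angular_deriv r \<theta>)) k = \<i> * of_int k * trace_coeff k r"
proof -
  let ?f = "\<lambda>\<theta>. complex_of_real (v (of_real r * cis \<theta>)) * cis (- of_int k * \<theta>)"
  let ?g = "\<lambda>\<theta>. complex_of_real (angular_deriv r \<theta>) * cis (- of_int k * \<theta>)"
  have c1: "continuous_on UNIV (\<lambda>\<theta>. v (of_real r * cis \<theta>))"
    using continuous_slice[OF continuous_on_disk_polar[OF continuous_v R] r order_refl] .
  have c2: "continuous_on UNIV (angular_deriv r)"
    using continuous_slice[OF continuous_angular_deriv[OF R] r order_refl] .
  have cf: "continuous_on UNIV ?f" and cg: "continuous_on UNIV ?g"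
    using c1 c2 by (auto intro!: continuous_intros)
  have "(\<integral>\<theta>. ?g \<theta> - \<i> * of_int k * ?f \<theta> \<partial>circ) = 0"
  proof (rule circ_integral_of_derivative)
    fix x :: real
    have "((\<lambda>\<theta>. cis (- of_int k * \<theta>)) has_vector_derivative (- \<i> * of_int k * cis (- of_int k * x))) (at x)"
      unfolding cis_conv_exp
      by (auto intro!: derivative_eq_intros has_vector_derivative_real_field)
    moreover have "((\<lambda>\<theta>. complex_of_real (v (of_real r * cis \<theta>))) has_vector_derivative of_real (angular_deriv r x)) (at x)"
      using r R by (intro has_vector_derivative_of_real angular_derivative) auto
    ultimately have "(?f has_vector_derivative complex_of_real (v (of_real r * cis x)) * (- \<i> * of_int k * cis (- of_int k * x))
        + of_real (angular_deriv r x) * cis (- of_int k * x)) (at x)"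
      using has_vector_derivative_mult by fastforce
    then show "(?f has_vector_derivative ?g x - \<i> * of_int k * ?f x) (at x)"
      by (simp add: algebra_simps)
  next
    show "continuous_on UNIV (\<lambda>\<theta>. ?g \<theta> - \<i> * of_int k * ?f \<theta>)"
      by (intro continuous_intros cf cg)
    show "?f (2*pi) = ?f 0"
      using cis_multiple_2pi[of "- of_int k"] cis_2pi by (simp add: mult_ac)
  qed
  then show ?thesis
    unfolding fcoeff_def trace_coeff_def
    by (subst (asm) Bochner_Integration.integral_diff)
       (auto intro!: integrable_circ_continuous continuous_intros c1 c2)
qed

text \<open>Twice the integral of this function over the radii is the Dirichlet integral, divided by \<open>pi\<close>.\<close>

definition circle_energy :: "real \<Rightarrow> real" where
  "circle_energy r = r * (\<integral>\<theta>. (vx (of_real r * cis \<theta>))\<^sup>2 + (vy (of_real r * cis \<theta>))\<^sup>2 \<partial>circ)"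

lemma continuous_grad2: "continuous_on (ball 0 1) (\<lambda>z. (vx z)\<^sup>2 + (vy z)\<^sup>2)"
  by (intro continuous_intros continuous_vx continuous_vy)

lemma continuous_circle_energy: "R < 1 \<Longrightarrow> continuous_on {0..R} circle_energy"
proof -
  assume R: "R < 1"
  let ?w = "\<lambda>r \<theta>. (vx (of_real r * cis \<theta>))\<^sup>2 + (vy (of_real r * cis \<theta>))\<^sup>2"
  have cw: "continuous_on ({0..R} \<times> UNIV) (\<lambda>(r, \<theta>). ?w r \<theta>)"
    using continuous_on_disk_polar[OF continuous_grad2 R] .
  have "continuous_on {0..R} (\<lambda>r. integral (cbox 0 (2*pi)) (?w r))"
    by (intro integral_continuous_on_param continuous_on_subset[OF cw]) auto
  then have "continuous_on {0..R} (\<lambda>r. r * (integral {0..2*pi} (?w r) /\<^sub>R (2*pi)))"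
    by (intro continuous_intros) simp
  moreover have "r * (integral {0..2*pi} (?w r) /\<^sub>R (2*pi)) = circle_energy r" if "r \<in> {0..R}" for r
    unfolding circle_energy_def using that by (subst integral_circ) (auto intro!: continuous_slice[OF cw])
  ultimately show ?thesis by (rule continuous_on_eq)
qed

definition half_energy :: "int \<Rightarrow> real \<Rightarrow> real" where
  "half_energy N r = (\<Sum>k\<in>{-N..N}. of_int \<bar>k\<bar> * (cmod (trace_coeff k r))\<^sup>2)"

definition half_energy' :: "int \<Rightarrow> real \<Rightarrow> real" where
  "half_energy' N r = (\<Sum>k\<in>{-N..N}. of_int \<bar>k\<bar> * (2 * (trace_coeff k r \<bullet> fcoeff (\<lambda>\<theta>. of_real (radial_deriv r \<theta>)) k)))"

lemma half_energy_derivative: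
  assumes "0 \<le> r" "r \<le> R" "R < 1"
  shows "(half_energy N has_vector_derivative half_energy' N r) (at r within {0..R})"
proof -
  have "((\<lambda>r. trace_coeff k r \<bullet> trace_coeff k r) has_vector_derivative 2 * (trace_coeff k r \<bullet> fcoeff (\<lambda>\<theta>. of_real (radial_deriv r \<theta>)) k)) (at r within {0..R})" for k
    using bounded_bilinear.has_vector_derivative[OF bounded_bilinear_inner trace_coeff_derivative[OF assms] trace_coeff_derivative[OF assms], of k k]
    by (simp add: inner_commute)
  then show ?thesis
    unfolding half_energy_def half_energy'_def power2_norm_eq_inner
    by (intro has_vector_derivative_sum has_vector_derivative_mult_right)
qed

text \<open>The coefficients \<open>a\<^sub>k(r)\<close> satisfy \<open>2 \<bar>k\<bar> \<bar>a\<^sub>k\<bar> \<bar>a\<^sub>k'\<bar> \<le> r \<bar>a\<^sub>k'\<bar>\<^sup>2 + \<bar>k a\<^sub>k\<bar>\<^sup>2 / r\<close>. On the right stand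
  the coefficients of the radial and of the angular derivative, and Bessel's inequality turns the sum
  over \<open>k\<close> into the energy of the circle. Equality would require \<open>a\<^sub>k\<close> to be a
  multiple of \<open>r ^ \<bar>k\<bar>\<close>, as it is for harmonic functions.\<close>

lemma half_energy'_le:
  assumes r: "0 < r" "r < 1"
  shows "half_energy' N r \<le> circle_energy r"
proof -
  let ?a = "\<lambda>k. cmod (fcoeff (\<lambda>\<theta>. of_real (radial_deriv r \<theta>)) k)" and ?b = "\<lambda>k. cmod (fcoeff (\<lambda>\<theta>. of_real (angular_deriv r \<theta>)) k)"
  have crad: "continuous_on UNIV (radial_deriv r)" and cang: "continuous_on UNIV (angular_deriv r)"
    using continuous_slice[OF continuous_radial_deriv, of r r] continuous_slice[OF continuous_angular_deriv, of r r] r by auto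
  have "bounded (w ` sphere 0 r)" if "continuous_on (ball 0 1) w" for w :: "complex \<Rightarrow> real"
    using r by (intro compact_imp_bounded compact_continuous_image continuous_on_subset[OF that]) auto
  from this[OF continuous_vx] this[OF continuous_vy]
  obtain B1 B2 where "\<forall>z\<in>sphere 0 r. \<bar>vx z\<bar> \<le> B1" "\<forall>z\<in>sphere 0 r. \<bar>vy z\<bar> \<le> B2"
    unfolding bounded_iff by auto
  then have B: "\<bar>vx (of_real r * cis \<theta>)\<bar> \<le> B1" "\<bar>vy (of_real r * cis \<theta>)\<bar> \<le> B2" for \<theta>
    using r by (auto simp: norm_mult)
  have tri: "\<bar>a * c + b * s\<bar> \<le> B1 + B2" if "\<bar>a\<bar> \<le> B1" "\<bar>b\<bar> \<le> B2" "\<bar>c\<bar> \<le> 1" "\<bar>s\<bar> \<le> 1" for a b c s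
  proof -
    have "0 \<le> B1" "0 \<le> B2" using that(1,2) by linarith+
    then show ?thesis
      using mult_mono[OF that(1,3)] mult_mono[OF that(2,4)] abs_triangle_ineq[of "a * c" "b * s"]
      by (simp add: abs_mult)
  qed
  have "\<bar>radial_deriv r \<theta>\<bar> \<le> B1 + B2" "\<bar>angular_deriv r \<theta>\<bar> \<le> r * (B1 + B2)" for \<theta>
  proof -
    show "\<bar>radial_deriv r \<theta>\<bar> \<le> B1 + B2" unfolding radial_deriv_def by (intro tri B) auto
    have "\<bar>vx (of_real r * cis \<theta>) * (- sin \<theta>) + vy (of_real r * cis \<theta>) * cos \<theta>\<bar> \<le> B1 + B2"
      by (intro tri B) auto
    moreover have "angular_deriv r \<theta> = r * (vx (of_real r * cis \<theta>) * (- sin \<theta>) + vy (of_real r * cis \<theta>) * cos \<theta>)"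
      by (simp add: angular_deriv_def algebra_simps)
    ultimately show "\<bar>angular_deriv r \<theta>\<bar> \<le> r * (B1 + B2)"
      using r by (simp add: abs_mult)
  qed
  then have bnd: "bdd_borel (\<lambda>\<theta>. complex_of_real (radial_deriv r \<theta>))" "bdd_borel (\<lambda>\<theta>. complex_of_real (angular_deriv r \<theta>))"
    using crad cang
    by (auto intro!: bdd_borelI borel_measurable_of_real borel_measurable_continuous_onI)
  have "half_energy' N r \<le> (\<Sum>k\<in>{-N..N}. r * (?a k)\<^sup>2 + (?b k)\<^sup>2 / r)"
    unfolding half_energy'_def
  proof (rule sum_mono)
    fix k
    have b: "?b k = of_int \<bar>k\<bar> * cmod (trace_coeff k r)"
      using fcoeff_angular_deriv[of r k] r by (simp add: norm_mult)
    have "trace_coeff k r \<bullet> fcoeff (\<lambda>\<theta>. of_real (radial_deriv r \<theta>)) k \<le> cmod (trace_coeff k r) * ?a k"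
      by (rule norm_cauchy_schwarz)
    then have "of_int \<bar>k\<bar> * (2 * (trace_coeff k r \<bullet> fcoeff (\<lambda>\<theta>. of_real (radial_deriv r \<theta>)) k)) \<le> of_int \<bar>k\<bar> * (2 * (cmod (trace_coeff k r) * ?a k))"
      by (intro mult_left_mono) auto
    also have "\<dots> = 2 * ?b k * ?a k" by (simp add: b)
    also have "\<dots> \<le> r * (?a k)\<^sup>2 + (?b k)\<^sup>2 / r"
    proof -
      have "0 \<le> (r * ?a k - ?b k)\<^sup>2 / r" using r by simp
      also have "\<dots> = r * (?a k)\<^sup>2 + (?b k)\<^sup>2 / r - 2 * ?b k * ?a k"
        using r by (simp add: power2_eq_square field_simps)
      finally show ?thesis by simp
    qed
    finally show "of_int \<bar>k\<bar> * (2 * (trace_coeff k r \<bullet> fcoeff (\<lambda>\<theta>. of_real (radial_deriv r \<theta>)) k)) \<le> r * (?a k)\<^sup>2 + (?b k)\<^sup>2 / r" .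
  qed
  also have "\<dots> = r * (\<Sum>k\<in>{-N..N}. (?a k)\<^sup>2) + (\<Sum>k\<in>{-N..N}. (?b k)\<^sup>2) / r"
    by (simp add: sum.distrib sum_distrib_left sum_divide_distrib)
  also have "\<dots> \<le> r * (\<integral>\<theta>. (cmod (of_real (radial_deriv r \<theta>)))\<^sup>2 \<partial>circ) + (\<integral>\<theta>. (cmod (of_real (angular_deriv r \<theta>)))\<^sup>2 \<partial>circ) / r"
    using r by (intro add_mono mult_left_mono divide_right_mono bessel_inequality bnd) auto
  also have "\<dots> = (\<integral>\<theta>. r * (radial_deriv r \<theta>)\<^sup>2 + (angular_deriv r \<theta>)\<^sup>2 / r \<partial>circ)"
    using crad cang r
    by (subst Bochner_Integration.integral_add) (auto intro!: integrable_circ_continuous continuous_intros)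
  also have "(\<lambda>\<theta>. r * (radial_deriv r \<theta>)\<^sup>2 + (angular_deriv r \<theta>)\<^sup>2 / r)
     = (\<lambda>\<theta>. r * ((vx (of_real r * cis \<theta>))\<^sup>2 + (vy (of_real r * cis \<theta>))\<^sup>2))"
  proof
    fix \<theta>
    have "(angular_deriv r \<theta>)\<^sup>2 / r = r * (vy (of_real r * cis \<theta>) * cos \<theta> - vx (of_real r * cis \<theta>) * sin \<theta>)\<^sup>2"
      using r by (simp add: angular_deriv_def power_mult_distrib power2_eq_square)
    then show "r * (radial_deriv r \<theta>)\<^sup>2 + (angular_deriv r \<theta>)\<^sup>2 / r = r * ((vx (of_real r * cis \<theta>))\<^sup>2 + (vy (of_real r * cis \<theta>))\<^sup>2)"
      using gradient_square_polar[of r \<theta>] by (metis distrib_left)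
  qed
  also have "(\<integral>\<theta>. r * ((vx (of_real r * cis \<theta>))\<^sup>2 + (vy (of_real r * cis \<theta>))\<^sup>2) \<partial>circ) = circle_energy r"
    by (simp add: circle_energy_def)
  finally show ?thesis .
qed

lemma circle_energy_integral_le:
  assumes \<rho>: "0 < \<rho>" "\<rho> \<le> R" "R < 1"
    and D: "(\<integral>\<^sup>+z\<in>ball 0 1. ennreal (((vx z)\<^sup>2 + (vy z)\<^sup>2) / pi) \<partial>lborel) \<le> ennreal D" "0 \<le> D"
  shows "integral {\<rho>..R} circle_energy \<le> D / 2"
proof -
  define w where "w = grad_density vx vy"
  have [measurable]: "w \<in> borel_measurable borel"
    unfolding w_def by (rule measurable_grad_density[OF grad])
  have cr: "continuous_on {\<rho>..R} circle_energy"
    using continuous_on_subset[OF continuous_circle_energy[OF \<rho>(3)]] \<rho> by auto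
  have ring0: "0 \<le> circle_energy r" if "0 \<le> r" for r
    unfolding circle_energy_def using that by (intro mult_nonneg_nonneg Bochner_Integration.integral_nonneg) auto
  have polar: "ennreal (2 * circle_energy r) = (\<integral>\<^sup>+\<theta>\<in>{0..2*pi}. w (of_real r * cis \<theta>) \<partial>lborel) * ennreal r"
    if r: "0 < r" "r < 1" for r
  proof -
    let ?g = "\<lambda>\<theta>. (vx (of_real r * cis \<theta>))\<^sup>2 + (vy (of_real r * cis \<theta>))\<^sup>2"
    have cg: "continuous_on UNIV ?g"
      using continuous_slice[OF continuous_on_disk_polar[OF continuous_grad2 r(2)], of r] r by simp
    then have [measurable]: "?g \<in> borel_measurable borel" by (rule borel_measurable_continuous_onI)
    have "(\<integral>\<^sup>+\<theta>\<in>{0..2*pi}. w (of_real r * cis \<theta>) \<partial>lborel)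
        = (\<integral>\<^sup>+\<theta>. ennreal (1 / pi) * (ennreal (?g \<theta>) * indicator {0..2*pi} \<theta>) \<partial>lborel)"
      using r unfolding w_def grad_density_def
      by (intro nn_integral_cong) (auto simp: norm_mult ennreal_mult'[symmetric] simp del: ennreal_plus split: split_indicator)
    also have "\<dots> = ennreal (1 / pi) * (\<integral>\<^sup>+\<theta>\<in>{0..2*pi}. ennreal (?g \<theta>) \<partial>lborel)"
      by (rule nn_integral_cmult) measurable
    also have "(\<integral>\<^sup>+\<theta>\<in>{0..2*pi}. ennreal (?g \<theta>) \<partial>lborel) = ennreal (2*pi) * (\<integral>\<^sup>+\<theta>. ennreal (?g \<theta>) \<partial>circ)"
      by (rule nn_integral_Icc_circ) measurable
    also have "(\<integral>\<^sup>+\<theta>. ennreal (?g \<theta>) \<partial>circ) = ennreal (\<integral>\<theta>. ?g \<theta> \<partial>circ)"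
      by (rule nn_integral_eq_integral[OF integrable_circ_continuous[OF cg]]) auto
    finally show ?thesis
      using r unfolding circle_energy_def
      by (simp add: ennreal_mult'[symmetric] Bochner_Integration.integral_nonneg mult_ac)
  qed
  have "ennreal (2 * integral {\<rho>..R} circle_energy) = ennreal (integral {\<rho>..R} (\<lambda>r. 2 * circle_energy r))"
    by simp
  also have "\<dots> = (\<integral>\<^sup>+r\<in>{\<rho>..R}. ennreal (2 * circle_energy r) \<partial>lborel)"
    by (rule nn_integral_Icc_continuous[symmetric])
       (use cr ring0 \<rho> in \<open>auto intro!: continuous_intros\<close>)
  also have "\<dots> \<le> (\<integral>\<^sup>+r\<in>{0<..}. (\<integral>\<^sup>+\<theta>\<in>{0..2*pi}. w (of_real r * cis \<theta>) \<partial>lborel) * ennreal r \<partial>lborel)"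
    using \<rho> polar by (intro nn_integral_mono) (auto split: split_indicator)
  also have "\<dots> = (\<integral>\<^sup>+z. w z \<partial>lborel)"
    by (rule nn_integral_polar[symmetric]) measurable
  also have "\<dots> \<le> ennreal D" using D(1) unfolding w_def grad_density_def .
  finally show ?thesis using D(2) by simp
qed

text \<open>The growth estimate for the half-order energy is integrated from a small radius to \<open>R\<close>. At the
  origin the function does not depend on \<open>\<theta>\<close>, so the energy starts from zero.\<close>

lemma trace_energy_le:
  assumes R: "0 < R" "R < 1"
    and D: "(\<integral>\<^sup>+z\<in>ball 0 1. ennreal (((vx z)\<^sup>2 + (vy z)\<^sup>2) / pi) \<partial>lborel) \<le> ennreal D" "0 \<le> D"
  shows "half_energy N R \<le> D / 2"
proof (rule field_le_epsilon)
  fix e :: real assume e: "e > 0"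
  have cont: "continuous_on {0..R} (half_energy N)"
    using half_energy_derivative[OF _ _ R(2)] by (intro continuous_on_vector_derivative) auto
  have "trace_coeff k 0 = of_real (v 0) * (\<integral>\<theta>. cis (of_int (-k) * \<theta>) \<partial>circ)" for k
    unfolding trace_coeff_def fcoeff_def by simp
  then have "trace_coeff k 0 = 0" if "k \<noteq> 0" for k
    unfolding integral_circ_cis using that by simp
  then have "half_energy N 0 = 0"
    unfolding half_energy_def by (intro sum.neutral) auto
  moreover obtain d where d: "d > 0" "\<And>r. r \<in> {0..R} \<Longrightarrow> dist r 0 < d \<Longrightarrow> dist (half_energy N r) (half_energy N 0) < e"
    using cont e R unfolding continuous_on_iff by (metis atLeastAtMost_iff less_imp_le order_refl)
  define \<rho> where "\<rho> = min R (d / 2)"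
  have \<rho>: "0 < \<rho>" "\<rho> \<le> R" "\<rho> < d" using R d unfolding \<rho>_def by auto
  ultimately have small: "half_energy N \<rho> \<le> e"
    using d(2)[of \<rho>] by (simp add: dist_real_def)
  have "(half_energy' N has_integral half_energy N R - half_energy N \<rho>) {\<rho>..R}"
    using \<rho> R
    by (intro fundamental_theorem_of_calculus)
       (auto intro: has_vector_derivative_within_subset[OF half_energy_derivative])
  moreover have "(circle_energy has_integral integral {\<rho>..R} circle_energy) {\<rho>..R}"
    using continuous_on_subset[OF continuous_circle_energy[OF R(2)], of "{\<rho>..R}"] \<rho>
    by (intro integrable_integral integrable_continuous_interval) auto
  ultimately have "half_energy N R - half_energy N \<rho> \<le> integral {\<rho>..R} circle_energy"
    using half_energy'_le \<rho> R by (elim has_integral_le) auto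
  then show "half_energy N R \<le> D / 2 + e"
    using circle_energy_integral_le[OF \<rho>(1,2) R(2) D] small by linarith
qed

end

section \<open>Summation over quantiles\<close>

text \<open>The function reaches \<open>s\<close> and \<open>T\<close> on sets of length about \<open>exp (- j)\<close> and \<open>exp (- k)\<close>, and both levels
  are extremal up to an additive \<open>n\<close>. Then \<open>s\<^sup>2 \<le> e * (j + 5/2)\<close> forces the energy \<open>1 - e\<close> beyond \<open>s\<close> to
  be at most \<open>\<epsilon> \<approx> n / j\<close>. Optimising \<open>\<kappa>\<close> in the estimate for the stretched function yields
  \<open>s\<^sup>2 + (T - s - \<mu>)\<^sup>2 / \<epsilon> \<le> k + 5/2\<close>, hence \<open>T\<^sup>2\<close> exceeds \<open>s\<^sup>2\<close> by little more than
  \<open>2 * sqrt (n * (k - j))\<close>; near extremality of \<open>T\<close> needs an increase of about \<open>k - j\<close>, so \<open>k - j\<close> is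
  at most a multiple of \<open>n\<close>.\<close>

lemma level_gap:
  fixes s T \<mu> e j k n :: real
  assumes pos: "0 < s" "s \<le> T" and n: "0 \<le> n" and jk: "j \<le> k"
    and Fj: "j - s\<^sup>2 \<le> n" and Fk: "k - T\<^sup>2 \<le> n"
    and below: "s \<le> sqrt (e * (j + 5/2))" "0 \<le> e" "e \<le> 1"
    and ex: "s * \<mu> \<le> 5/2" "0 \<le> \<mu>"
    and beyond: "\<And>\<kappa>. 1 \<le> \<kappa> \<Longrightarrow> s + \<kappa> * (T - s - \<mu>) \<le> sqrt ((1 + \<kappa>\<^sup>2 * (1 - e)) * (k + 5/2))"
    and large: "8 * n + 20 \<le> j"
  shows "k \<le> j + 12 * n + 70"
proof -
  define N where "N = n + 5/2"
  define Y where "Y = j + 5/2"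
  define B where "B = k - j + 2 * N"
  define \<epsilon> where "\<epsilon> = N / Y"
  have N: "5/2 \<le> N" and Y: "8 * N \<le> Y" "0 < Y" and B: "0 \<le> B"
    using n jk large by (auto simp: N_def Y_def B_def)
  have \<epsilon>: "0 < \<epsilon>" "\<epsilon> \<le> 1/8" "Y * \<epsilon> = N"
    using N Y by (auto simp: \<epsilon>_def field_simps)
  have "s\<^sup>2 \<le> (sqrt (e * Y))\<^sup>2"
    using below pos Y_def by (intro power_mono) auto
  then have s2e: "s\<^sup>2 \<le> e * Y" using below Y by simp
  have sY: "s\<^sup>2 \<ge> Y - N" using Fj by (simp add: N_def Y_def)
  have e1: "1 - e \<le> \<epsilon>"
  proof -
    have "Y - e * Y \<le> N" using s2e sY by linarith
    then show ?thesis using Y by (simp add: \<epsilon>_def field_simps)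
  qed
  have e2: "s\<^sup>2 \<le> Y"
  proof -
    have "e * Y \<le> 1 * Y" using Y below by (intro mult_right_mono) auto
    then show ?thesis using s2e by simp
  qed
  define d where "d = max 0 (T - s - \<mu>)"
  have d2: "d\<^sup>2 \<le> \<epsilon> * B"
  \<comment> \<open>In this case the optimal \<open>\<kappa>\<close> below would be at most \<open>1\<close>, and the claim is immediate.\<close>
  proof (cases "d \<le> s * \<epsilon>")
    case True
    have "d\<^sup>2 \<le> (s * \<epsilon>)\<^sup>2" using True by (intro power_mono) (auto simp: d_def)
    also have "\<dots> = s\<^sup>2 * \<epsilon> * \<epsilon>" by (simp add: power2_eq_square)
    also have "\<dots> \<le> Y * \<epsilon> * \<epsilon>" using e2 \<epsilon> by (intro mult_right_mono) auto
    also have "\<dots> = \<epsilon> * N" using \<epsilon> by simp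
    also have "\<dots> \<le> \<epsilon> * B" using \<epsilon> N jk by (intro mult_left_mono) (auto simp: B_def)
    finally show ?thesis .
  next
    case False
    then have dpos: "0 < d" "d = T - s - \<mu>" using pos \<epsilon> by (auto simp: d_def max_def split: if_splits)
      (smt (verit) mult_pos_pos)+
    \<comment> \<open>The minimiser of \<open>(1 + \<kappa>\<^sup>2 * \<epsilon>) / (s + \<kappa> * d)\<^sup>2\<close>; with it both sides become multiples of \<open>q\<close>.\<close>
    define \<kappa> where "\<kappa> = d / (s * \<epsilon>)"
    define q where "q = s\<^sup>2 + d\<^sup>2 / \<epsilon>"
    have q: "0 < q" unfolding q_def using pos \<epsilon> by (intro add_pos_nonneg) auto
    have \<kappa>1: "1 \<le> \<kappa>" using False pos \<epsilon> by (simp add: \<kappa>_def field_simps)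
    have "s + \<kappa> * d \<le> sqrt ((1 + \<kappa>\<^sup>2 * (1 - e)) * (k + 5/2))"
      using beyond[OF \<kappa>1] dpos by simp
    also have "\<dots> \<le> sqrt ((1 + \<kappa>\<^sup>2 * \<epsilon>) * (k + 5/2))"
      using e1 Y jk by (intro real_sqrt_le_mono mult_right_mono add_left_mono mult_left_mono) (auto simp: Y_def)
    finally have "(s + \<kappa> * d)\<^sup>2 \<le> (sqrt ((1 + \<kappa>\<^sup>2 * \<epsilon>) * (k + 5/2)))\<^sup>2"
      using pos \<kappa>1 dpos by (intro power_mono) auto
    also have "\<dots> = (1 + \<kappa>\<^sup>2 * \<epsilon>) * (k + 5/2)"
      using \<epsilon> Y jk by (intro real_sqrt_pow2 mult_nonneg_nonneg) (auto simp: Y_def)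
    also have "s + \<kappa> * d = q / s"
      using pos \<epsilon> by (simp add: \<kappa>_def q_def field_simps power2_eq_square)
    also have "1 + \<kappa>\<^sup>2 * \<epsilon> = q / s\<^sup>2"
      using pos \<epsilon> by (simp add: \<kappa>_def q_def field_simps power2_eq_square)
    finally have "q * q \<le> q * (k + 5/2)"
      using pos by (simp add: power_divide field_simps power2_eq_square)
    then have "q \<le> k + 5/2" using q by simp
    then have "d\<^sup>2 / \<epsilon> \<le> B" using sY N by (simp add: q_def B_def Y_def)
    then show ?thesis using \<epsilon> by (simp add: field_simps)
  qed
  \<comment> \<open>The geometric mean \<open>2 * sqrt (N * B)\<close> is split with most weight on \<open>N\<close>, so that \<open>B\<close> can be absorbed at the end.\<close>
  have sd: "2 * (s * d) \<le> 4 * N + B / 4"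
  proof (rule power2_le_imp_le)
    have "(s * d)\<^sup>2 \<le> Y * (\<epsilon> * B)"
      unfolding power_mult_distrib using e2 d2 Y by (intro mult_mono) auto
    also have "\<dots> = N * B" using \<epsilon>(3) by (metis mult.assoc)
    finally have "(2 * (s * d))\<^sup>2 \<le> 4 * (N * B)" by (simp add: power_mult_distrib)
    also have "\<dots> \<le> 4 * (N * B) + (4 * N - B / 4)\<^sup>2" by simp
    also have "\<dots> = (4 * N + B / 4)\<^sup>2" by (simp add: power2_eq_square algebra_simps)
    finally show "(2 * (s * d))\<^sup>2 \<le> (4 * N + B / 4)\<^sup>2" .
  qed (use N B in auto)
  have "1\<^sup>2 \<le> s\<^sup>2" using sY Y N by simp
  then have s1: "1 \<le> s" by (rule power2_le_imp_le) (use pos in simp)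
  have \<mu>: "\<mu> \<le> 5/2" using mult_right_mono[OF s1 ex(2)] ex(1) by simp
  have "T \<le> s + (\<mu> + d)" by (simp add: d_def)
  then have "T\<^sup>2 \<le> (s + (\<mu> + d))\<^sup>2" using pos by (intro power_mono) auto
  also have "\<dots> = s\<^sup>2 + 2 * (s * \<mu>) + 2 * (s * d) + (\<mu> + d)\<^sup>2"
    by (simp add: power2_eq_square algebra_simps)
  also have "(\<mu> + d)\<^sup>2 \<le> 2 * \<mu>\<^sup>2 + 2 * d\<^sup>2"
    using zero_le_power2[of "\<mu> - d"] by (simp add: power2_eq_square algebra_simps)
  also have "\<mu>\<^sup>2 \<le> (5/2)\<^sup>2" using \<mu> ex by (intro power_mono) auto
  also have "d\<^sup>2 \<le> B / 8"
    using d2 mult_right_mono[OF \<epsilon>(2) B] by simp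
  finally have "T\<^sup>2 \<le> s\<^sup>2 + 2 * (s * \<mu>) + 2 * (s * d) + (2 * (5/2)\<^sup>2 + 2 * (B / 8))" by simp
  also have "\<dots> \<le> Y + 5 + (4 * N + B / 4) + (2 * (5/2)\<^sup>2 + B / 4)"
    using e2 ex sd by simp
  also have "(5/2 :: real)\<^sup>2 = 25/4" by (simp add: power2_eq_square)
  finally show ?thesis
    using Fk unfolding Y_def N_def B_def by argo
qed

text \<open>By the previous lemma the indices \<open>k\<close> with \<open>k - (t k)\<^sup>2 \<le> n\<close> lie in an initial segment and in one
  further interval, both of length \<open>O(n + 1)\<close>. Grouping the sum by \<open>k - (t k)\<^sup>2\<close>, rounded up to an
  integer, leaves the convergent series \<open>\<Sum> (n + 1) * exp (- n)\<close>.\<close>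

lemma level_sum_bound:
  fixes t e \<mu> :: "nat \<Rightarrow> real"
  assumes mono: "mono t"
    and e: "\<And>k. 0 \<le> e k" "\<And>k. e k \<le> 1"
    and \<mu>: "\<And>k. 0 < t k \<Longrightarrow> t k * \<mu> k \<le> 5/2" "\<And>k. 0 \<le> \<mu> k"
    and below: "\<And>k. 0 < t k \<Longrightarrow> t k \<le> sqrt (e k * (real k + 5/2))"
    and beyond: "\<And>j k \<kappa>. 0 < t j \<Longrightarrow> 0 < t k \<Longrightarrow> j < k \<Longrightarrow> 1 \<le> \<kappa> \<Longrightarrow>
       t j + \<kappa> * (t k - t j - \<mu> j) \<le> sqrt ((1 + \<kappa>\<^sup>2 * (1 - e j)) * (real k + 5/2))"
  shows "(\<Sum>k<K. if 0 < t k then exp ((t k)\<^sup>2 - real k) else 0) \<le> 91 * exp 3 / (1 - exp (-1))\<^sup>2"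
proof -
  define A where "A n = {k. 0 < t k \<and> real k - (t k)\<^sup>2 \<le> real n}" for n :: nat
  have card_A: "finite (A n) \<and> card (A n) \<le> 91 * Suc n" for n
  proof (cases "\<exists>j\<in>A n. 8 * n + 20 \<le> j")
    case False
    then have "A n \<subseteq> {..<8 * n + 20}" by auto
    from finite_subset[OF this] card_mono[OF _ this] show ?thesis by auto
  next
    case True
    define j where "j = (LEAST j. j \<in> A n \<and> 8 * n + 20 \<le> j)"
    have j: "j \<in> A n" "8 * n + 20 \<le> j"
      using LeastI_ex[of "\<lambda>j. j \<in> A n \<and> 8 * n + 20 \<le> j"] True unfolding j_def by auto
    have "k \<in> {..<8 * n + 20} \<union> {j..j + 12 * n + 70}" if k: "k \<in> A n" for k
    proof (cases "8 * n + 20 \<le> k")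
      case True
      then have jk: "j \<le> k" unfolding j_def using k by (intro Least_le) auto
      have "real k \<le> real j + 12 * real n + 70"
      proof (cases "j = k")
        case False
        then have "j < k" using jk by simp
        show ?thesis
        proof (rule level_gap[of "t j" "t k" "real n" "real j" "real k" "e j" "\<mu> j"])
          show "8 * real n + 20 \<le> real j" using j(2) by linarith
          show "t j \<le> t k" using mono jk by (rule monoD)
        qed (use j k \<open>j < k\<close> e \<mu> below beyond in \<open>auto simp: A_def\<close>)
      qed simp
      then have "k \<le> j + 12 * n + 70" by linarith
      then show ?thesis using jk by auto
    qed auto
    then have sub: "A n \<subseteq> {..<8 * n + 20} \<union> {j..j + 12 * n + 70}" by blast
    have "card ({..<8 * n + 20} \<union> {j..j + 12 * n + 70}) \<le> 91 * Suc n"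
      by (rule order_trans[OF card_Un_le]) simp
    then show ?thesis
      using finite_subset[OF sub] card_mono[OF _ sub] by auto
  qed
  define m where "m k = nat \<lceil>real k - (t k)\<^sup>2\<rceil>" for k
  define P where "P = {k. k < K \<and> 0 < t k}"
  have fP: "finite P" by (simp add: P_def)
  have in_A: "k \<in> A (m k)" if "0 < t k" for k
    using that unfolding A_def m_def by (auto simp: of_nat_nat) linarith
  have bound: "exp ((t k)\<^sup>2 - real k) \<le> exp 3 * exp (-1) ^ m k" if "0 < t k" for k
  proof -
    have "(t k)\<^sup>2 \<le> (sqrt (e k * (real k + 5/2)))\<^sup>2"
      using below[OF that] that by (intro power_mono) auto
    also have "\<dots> = e k * (real k + 5/2)" using e by simp
    also have "\<dots> \<le> 1 * (real k + 5/2)" using e by (intro mult_right_mono) auto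
    finally have tk: "(t k)\<^sup>2 - real k \<le> 5/2" by simp
    have "real (nat \<lceil>x\<rceil>) \<le> max 0 (x + 1)" for x :: real
    proof (cases "x \<le> 0")
      case False
      then have "real (nat \<lceil>x\<rceil>) = of_int \<lceil>x\<rceil>" by (intro of_nat_nat) simp
      then show ?thesis using ceiling_correct[of x] by linarith
    qed auto
    from this[of "real k - (t k)\<^sup>2"] have "(t k)\<^sup>2 - real k \<le> 3 - real (m k)"
      using tk unfolding m_def by (auto simp: max_def split: if_splits)
    then show ?thesis by (simp add: exp_of_nat_mult[symmetric] exp_add[symmetric])
  qed
  have "(\<Sum>k<K. if 0 < t k then exp ((t k)\<^sup>2 - real k) else 0) = (\<Sum>k\<in>P. exp ((t k)\<^sup>2 - real k))"
    unfolding P_def by (subst sum.inter_filter[symmetric]) (auto intro!: sum.cong)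
  also have "\<dots> \<le> (\<Sum>k\<in>P. exp 3 * exp (-1) ^ m k)"
    by (intro sum_mono bound) (simp add: P_def)
  also have "\<dots> = (\<Sum>n\<in>m ` P. \<Sum>k\<in>{k\<in>P. m k = n}. exp 3 * exp (-1) ^ m k)"
    by (rule sum.image_gen[OF fP])
  also have "\<dots> \<le> (\<Sum>n\<in>m ` P. 91 * exp 3 * (real (Suc n) * exp (-1) ^ n))"
  proof (rule sum_mono)
    fix n
    have "{k\<in>P. m k = n} \<subseteq> A n" using in_A by (auto simp: P_def)
    then have "card {k\<in>P. m k = n} \<le> 91 * Suc n"
      using card_A[of n] card_mono by (meson le_trans)
    then have "real (card {k\<in>P. m k = n}) \<le> 91 * real (Suc n)" by linarith
    then have "real (card {k\<in>P. m k = n}) * (exp 3 * exp (-1) ^ n) \<le> 91 * real (Suc n) * (exp 3 * exp (-1) ^ n)"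
      by (intro mult_right_mono) auto
    then show "(\<Sum>k\<in>{k\<in>P. m k = n}. exp 3 * exp (-1) ^ m k) \<le> 91 * exp 3 * (real (Suc n) * exp (-1) ^ n)"
      by (simp add: mult_ac)
  qed
  also have "\<dots> = 91 * exp 3 * (\<Sum>n\<in>m ` P. real (Suc n) * exp (-1) ^ n)"
    by (simp add: sum_distrib_left)
  also have "(\<Sum>n\<in>m ` P. real (Suc n) * exp (-1) ^ n) \<le> 1 / (1 - exp (-1))\<^sup>2"
  proof -
    have "(\<lambda>n. real (Suc n) * exp (-1) ^ n) sums (1 / (1 - exp (-1))\<^sup>2)"
      using geometric_deriv_sums[of "exp (-1) :: real"] by simp
    then show ?thesis
      using sum_le_suminf[of "\<lambda>n. real (Suc n) * exp (-1) ^ n" "m ` P"] fP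
      by (simp add: sums_iff)
  qed
  finally show ?thesis by (simp add: mult_left_mono)
qed

section \<open>Energy estimates for the level sets\<close>

lemma max_0_square_deriv:
  "((\<lambda>x. (max 0 x)\<^sup>2) has_real_derivative 2 * max 0 x) (at x)" for x :: real
proof -
  consider "x > 0" | "x < 0" | "x = 0" by linarith
  then show ?thesis
  proof cases
    case 1
    have "((\<lambda>x. x\<^sup>2) has_real_derivative 2 * max 0 x) (at x)"
      using 1 by (auto intro!: derivative_eq_intros)
    then show ?thesis
      by (rule has_field_derivative_transform_within_open[where S="{0<..}"]) (use 1 in auto)
  next
    case 2
    have "((\<lambda>x. 0) has_real_derivative 2 * max 0 x) (at x)"
      using 2 by simp
    then show ?thesis
      by (rule has_field_derivative_transform_within_open[where S="{..<0}"]) (use 2 in auto)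
  next
    case 3
    have "((\<lambda>h. (max 0 h)\<^sup>2 / h) \<longlongrightarrow> 0) (at (0::real))"
    proof (rule Lim_null_comparison)
      show "\<forall>\<^sub>F h in at 0. norm ((max 0 h)\<^sup>2 / h) \<le> \<bar>h\<bar>"
        by (intro always_eventually allI) (simp add: max_def power2_eq_square)
      show "((\<lambda>h. \<bar>h\<bar>) \<longlongrightarrow> 0) (at (0::real))"
        by (rule tendsto_rabs_zero) (rule tendsto_ident_at)
    qed
    then show ?thesis using 3 by (simp add: DERIV_def)
  qed
qed

text \<open>A \<open>C\<^sup>1\<close> version of \<open>max 0 (x - s)\<close> whose derivative climbs from \<open>0\<close> to \<open>1\<close> on \<open>{s..s + \<delta>}\<close>. The energy
  estimates need differentiable compositions; \<open>\<delta>\<close> tends to zero at the end of each argument.\<close>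

definition ramp :: "real \<Rightarrow> real \<Rightarrow> real \<Rightarrow> real" where
  "ramp s \<delta> x = ((max 0 (x - s))\<^sup>2 - (max 0 (x - s - \<delta>))\<^sup>2) / (2 * \<delta>)"

definition ramp' :: "real \<Rightarrow> real \<Rightarrow> real \<Rightarrow> real" where
  "ramp' s \<delta> x = (max 0 (x - s) - max 0 (x - s - \<delta>)) / \<delta>"

lemma ramp_deriv: "(ramp s \<delta> has_real_derivative ramp' s \<delta> x) (at x)"
proof -
  have "((\<lambda>x. (max 0 (x - c))\<^sup>2) has_real_derivative 2 * max 0 (x - c)) (at x)" for c
  proof -
    have "((\<lambda>x. x - c) has_real_derivative 1) (at x)" by (auto intro!: derivative_eq_intros)
    from DERIV_chain2[OF max_0_square_deriv this] show ?thesis by simp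
  qed
  from this[of s] this[of "s + \<delta>"]
  have "((\<lambda>x. ((max 0 (x - s))\<^sup>2 - (max 0 (x - (s + \<delta>)))\<^sup>2) / (2 * \<delta>)) has_real_derivative
      (2 * max 0 (x - s) - 2 * max 0 (x - (s + \<delta>))) / (2 * \<delta>)) (at x)"
    by (intro DERIV_cdivide DERIV_diff)
  moreover have "(2 * a - 2 * b) / (2 * \<delta>) = (a - b) / \<delta>" for a b :: real
    unfolding right_diff_distrib[symmetric] by (rule mult_divide_mult_cancel_left) simp
  ultimately show ?thesis
    unfolding ramp_def[abs_def] ramp'_def by (simp add: diff_diff_eq)
qed

lemma continuous_ramp': "continuous_on S (ramp' s \<delta>)"
  unfolding ramp'_def[abs_def] divide_inverse by (intro continuous_intros)

lemma ramp_props: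
  assumes "\<delta> > 0"
  shows "0 \<le> ramp' s \<delta> x" "ramp' s \<delta> x \<le> 1" "x \<le> s \<Longrightarrow> ramp' s \<delta> x = 0"
    "s + \<delta> \<le> x \<Longrightarrow> ramp' s \<delta> x = 1" "s + \<delta> \<le> x \<Longrightarrow> ramp s \<delta> x = x - s - \<delta> / 2"
    "0 \<le> ramp s \<delta> x" "ramp s \<delta> x \<le> max 0 (x - s)" "x - s - \<delta> / 2 \<le> ramp s \<delta> x"
proof -
  show "0 \<le> ramp' s \<delta> x" "ramp' s \<delta> x \<le> 1" "x \<le> s \<Longrightarrow> ramp' s \<delta> x = 0"
    "s + \<delta> \<le> x \<Longrightarrow> ramp' s \<delta> x = 1"
    using assms by (auto simp: ramp'_def field_simps max_def)
  have ramp: "ramp s \<delta> x = (if x \<le> s then 0 else if x \<le> s + \<delta> then (x - s)\<^sup>2 / (2 * \<delta>) else x - s - \<delta> / 2)"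
    using assms by (auto simp: ramp_def max_def power2_eq_square field_simps)
  then show "s + \<delta> \<le> x \<Longrightarrow> ramp s \<delta> x = x - s - \<delta> / 2"
    using assms by (auto simp: power2_eq_square field_simps)
  show "0 \<le> ramp s \<delta> x" using assms by (auto simp: ramp)
  have "(x - s)\<^sup>2 \<le> (x - s) * (2 * \<delta>)" if "s < x" "x \<le> s + \<delta>"
    using that assms unfolding power2_eq_square by (intro mult_left_mono) auto
  then show "ramp s \<delta> x \<le> max 0 (x - s)"
    using assms by (auto simp: ramp pos_divide_le_eq)
  have "(x - s - \<delta> / 2) * (2 * \<delta>) \<le> (x - s)\<^sup>2"
    using zero_le_power2[of "x - s - \<delta>"] by (simp add: power2_eq_square algebra_simps)
  then show "x - s - \<delta> / 2 \<le> ramp s \<delta> x"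
    using assms by (auto simp: ramp pos_le_divide_eq)
qed

lemma ramp_mono: "\<delta> > 0 \<Longrightarrow> x \<le> y \<Longrightarrow> ramp s \<delta> x \<le> ramp s \<delta> y"
  by (rule DERIV_nonneg_imp_nondecreasing) (auto intro!: exI conjI ramp_deriv ramp_props(1))

context
  fixes u ux uy :: "complex \<Rightarrow> real"
  assumes grad: "has_gradient_on (ball 0 1) u ux uy"
    and energy: "(\<integral>\<^sup>+z\<in>ball 0 1. ennreal (((ux z)\<^sup>2 + (uy z)\<^sup>2) / pi) \<partial>lborel) \<le> 1"
    and mean: "\<And>r. 0 < r \<Longrightarrow> r < 1 \<Longrightarrow> (\<integral>\<theta>. u (of_real r * cis \<theta>) \<partial>circ) = 0"
begin

lemmas [measurable] = measurable_grad_density[OF grad]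

definition energy_below :: "real \<Rightarrow> real" where
  "energy_below s = enn2real (\<integral>\<^sup>+z. grad_density ux uy z * indicator {z\<in>ball 0 1. u z \<le> s} z \<partial>lborel)"

lemma sublevel_measurable[measurable]: "{z\<in>ball 0 1. u z \<le> s} \<in> sets borel"
proof -
  have "(\<lambda>z. indicator (ball 0 1) z *\<^sub>R u z) \<in> borel_measurable borel"
    using has_gradient_on_continuous[OF grad] by (intro borel_measurable_continuous_on_indicator) auto
  then have "{z \<in> space borel. indicator (ball 0 1) z *\<^sub>R u z \<le> s} \<in> sets borel"
    by measurable
  then have "ball 0 1 \<inter> {z \<in> space borel. indicator (ball 0 1) z *\<^sub>R u z \<le> s} \<in> sets borel"
    by auto
  also have "ball 0 1 \<inter> {z \<in> space borel. indicator (ball 0 1) z *\<^sub>R u z \<le> s} = {z\<in>ball 0 1. u z \<le> s}"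
    by (auto simp: indicator_def)
  finally show ?thesis .
qed

lemma energy_below_bounds: "0 \<le> energy_below s" "energy_below s \<le> 1"
  "(\<integral>\<^sup>+z. grad_density ux uy z * indicator {z\<in>ball 0 1. u z \<le> s} z \<partial>lborel) = ennreal (energy_below s)"
  "(\<integral>\<^sup>+z. grad_density ux uy z * indicator (- {z\<in>ball 0 1. u z \<le> s}) z \<partial>lborel) \<le> ennreal (1 - energy_below s)"
proof -
  define A where "A = {z\<in>ball 0 1. u z \<le> s}"
  have [measurable]: "A \<in> sets borel" unfolding A_def by (rule sublevel_measurable)
  let ?a = "\<integral>\<^sup>+z. grad_density ux uy z * indicator A z \<partial>lborel" and ?b = "\<integral>\<^sup>+z. grad_density ux uy z * indicator (- A) z \<partial>lborel"
  have "?a + ?b = (\<integral>\<^sup>+z. grad_density ux uy z * indicator A z + grad_density ux uy z * indicator (- A) z \<partial>lborel)"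
    by (rule nn_integral_add[symmetric]) measurable
  also have "\<dots> = (\<integral>\<^sup>+z. grad_density ux uy z \<partial>lborel)"
    by (intro nn_integral_cong) (auto split: split_indicator)
  also have "\<dots> \<le> 1" using energy by (simp add: grad_density_def)
  finally have ab: "?a + ?b \<le> 1" .
  then have a1: "?a \<le> 1" by (rule order_trans[rotated]) simp
  then have a: "?a = ennreal (energy_below s)" unfolding energy_below_def A_def[symmetric]
    by (intro ennreal_enn2real[symmetric]) (rule le_less_trans, auto)
  show "0 \<le> energy_below s" by (simp add: energy_below_def)
  show "(\<integral>\<^sup>+z. grad_density ux uy z * indicator {z\<in>ball 0 1. u z \<le> s} z \<partial>lborel) = ennreal (energy_below s)"
    using a unfolding A_def .
  show b1: "energy_below s \<le> 1" using a1 unfolding a by simp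
  have "?b \<le> 1 - ennreal (energy_below s)"
    using ab unfolding a by (intro ennreal_le_minus_iff[THEN iffD2] disjI1) (simp_all add: add.commute)
  also have "1 - ennreal (energy_below s) = ennreal (1 - energy_below s)"
    using ennreal_minus[of "energy_below s" 1] by (simp add: energy_below_def)
  finally show "(\<integral>\<^sup>+z. grad_density ux uy z * indicator (- {z\<in>ball 0 1. u z \<le> s}) z \<partial>lborel) \<le> ennreal (1 - energy_below s)"
    unfolding A_def .
qed

lemma continuous_circle:
  assumes "0 < R" "R < 1" shows "continuous_on UNIV (\<lambda>\<theta>. u (of_real R * cis \<theta>))"
  by (rule continuous_on_compose2[OF has_gradient_on_continuous[OF grad]])
     (use assms in \<open>auto intro!: continuous_intros simp: norm_mult\<close>)

lemma composed_bound:
  assumes R: "0 < R" "R < 1" and E: "E \<in> sets borel" and l: "l = measure circ E" "0 < l"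
    and h: "\<And>x. (h has_real_derivative h' x) (at x)" "continuous_on UNIV h'"
    and D: "(\<integral>\<^sup>+z. ennreal ((h' (u z))\<^sup>2) * grad_density ux uy z \<partial>lborel) \<le> ennreal D" "0 \<le> D"
  shows "(\<integral>\<theta>. h (u (of_real R * cis \<theta>)) * indicator E \<theta> \<partial>circ)
    \<le> l * (\<integral>\<theta>. h (u (of_real R * cis \<theta>)) \<partial>circ) + l * sqrt (D * (ln (1 / l) + 3 / 2))"
proof -
  define v where "v z = h (u z)" for z
  define vx where "vx z = h' (u z) * ux z" for z
  define vy where "vy z = h' (u z) * uy z" for z
  have contu: "continuous_on (ball 0 1) u" by (rule has_gradient_on_continuous[OF grad])
  have "continuous_on (ball 0 1) (\<lambda>z. h' (u z))"
    by (rule continuous_on_compose2[OF h(2) contu]) auto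
  moreover have "(v has_derivative (\<lambda>d. vx z * Re d + vy z * Im d)) (at z)" if "z \<in> ball 0 1" for z
  proof -
    have "(u has_derivative (\<lambda>d. ux z * Re d + uy z * Im d)) (at z)"
      using grad that unfolding has_gradient_on_def by blast
    then have "((\<lambda>z. h (u z)) has_derivative (\<lambda>d. h' (u z) * (ux z * Re d + uy z * Im d))) (at z)"
      by (rule has_derivative_compose) (use h(1)[of "u z"] in \<open>simp add: has_field_derivative_def\<close>)
    then show ?thesis unfolding v_def vx_def vy_def by (simp add: algebra_simps)
  qed
  ultimately have gv: "has_gradient_on (ball 0 1) v vx vy"
    using grad unfolding has_gradient_on_def vx_def vy_def by (auto intro!: continuous_intros)
  have "(\<integral>\<^sup>+z\<in>ball 0 1. ennreal (((vx z)\<^sup>2 + (vy z)\<^sup>2) / pi) \<partial>lborel)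
     = (\<integral>\<^sup>+z. ennreal ((h' (u z))\<^sup>2) * grad_density ux uy z \<partial>lborel)"
    unfolding grad_density_def vx_def vy_def mult.assoc[symmetric] ennreal_mult''[symmetric, OF divide_nonneg_pos[OF sum_power2_ge_zero pi_gt_zero]]
    by (intro nn_integral_cong) (simp add: power_mult_distrib distrib_left[symmetric])
  then have Dv: "(\<integral>\<^sup>+z\<in>ball 0 1. ennreal (((vx z)\<^sup>2 + (vy z)\<^sup>2) / pi) \<partial>lborel) \<le> ennreal D"
    using D(1) by simp
  have cF: "continuous_on (sphere 0 1) (\<lambda>z. v (of_real R * z))"
    by (rule continuous_on_compose2[OF has_gradient_on_continuous[OF gv]])
       (use R in \<open>auto intro!: continuous_intros simp: norm_mult\<close>)
  show ?thesis
    using trace_pairing_bound[OF cF E l, of D] trace_energy_le[OF gv R Dv D(2)]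
    unfolding half_energy_def[OF gv] trace_coeff_def[OF gv] v_def by blast
qed

definition superlevel :: "real \<Rightarrow> real \<Rightarrow> real set" where
  "superlevel R t = {\<theta>. t \<le> u (of_real R * cis \<theta>)}"

lemma superlevel_borel:
  assumes "0 < R" "R < 1" shows "superlevel R t \<in> sets borel"
  unfolding superlevel_def using continuous_circle[OF assms]
  by (intro borel_closed closed_Collect_le continuous_intros)

lemma integrable_composed:
  assumes "0 < R" "R < 1" and "continuous_on UNIV (h :: real \<Rightarrow> real)"
  shows "integrable circ (\<lambda>\<theta>. h (u (of_real R * cis \<theta>)))"
  by (intro integrable_circ_continuous continuous_on_compose2[OF assms(3) continuous_circle[OF assms(1,2)]]) auto

text \<open>The form in which averages over sets are used: a lower bound for \<open>h\<close> above the level \<open>t\<close> is a lower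
  bound for the average of \<open>h \<circ> u\<close> over \<open>{u \<ge> t}\<close>.\<close>

lemma composed_level_bound:
  assumes R: "0 < R" "R < 1" and l: "l = measure circ (superlevel R t)" "0 < l"
    and h: "\<And>x. (h has_real_derivative h' x) (at x)" "continuous_on UNIV h'"
    and D: "(\<integral>\<^sup>+z. ennreal ((h' (u z))\<^sup>2) * grad_density ux uy z \<partial>lborel) \<le> ennreal D" "0 \<le> D"
    and c: "\<And>x. t \<le> x \<Longrightarrow> c \<le> h x"
  shows "c \<le> (\<integral>\<theta>. h (u (of_real R * cis \<theta>)) \<partial>circ) + sqrt (D * (ln (1 / l) + 3 / 2))"
proof -
  have ch: "continuous_on UNIV h"
    using h(1) by (intro continuous_at_imp_continuous_on ballI DERIV_isCont)
  have E: "superlevel R t \<in> sets borel" by (rule superlevel_borel) fact+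
  have "c * l = (\<integral>\<theta>. c * indicator (superlevel R t) \<theta> \<partial>circ)"
    using E l by simp
  also have "\<dots> \<le> (\<integral>\<theta>. h (u (of_real R * cis \<theta>)) * indicator (superlevel R t) \<theta> \<partial>circ)"
    using E c
    by (intro integral_mono integrable_real_mult_indicator integrable_composed[OF R ch])
       (auto simp: superlevel_def split: split_indicator)
  also have "\<dots> \<le> l * (\<integral>\<theta>. h (u (of_real R * cis \<theta>)) \<partial>circ) + l * sqrt (D * (ln (1 / l) + 3 / 2))"
    by (rule composed_bound) fact+
  finally have "l * c \<le> l * ((\<integral>\<theta>. h (u (of_real R * cis \<theta>)) \<partial>circ) + sqrt (D * (ln (1 / l) + 3 / 2)))"
    by (simp add: distrib_left mult.commute)
  then show ?thesis using l by (simp only: mult_le_cancel_left_pos)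
qed

lemma two_speed_energy:
  assumes "\<And>x. x \<le> s \<Longrightarrow> (h' x)\<^sup>2 \<le> 1" "\<And>x. s < x \<Longrightarrow> (h' x)\<^sup>2 \<le> q"
    and [measurable]: "h' \<in> borel_measurable borel" and "0 \<le> q"
  shows "(\<integral>\<^sup>+z. ennreal ((h' (u z))\<^sup>2) * grad_density ux uy z \<partial>lborel) \<le> ennreal (energy_below s + q * (1 - energy_below s))"
proof -
  define A where "A = {z\<in>ball 0 1. u z \<le> s}"
  have [measurable]: "A \<in> sets borel" unfolding A_def by (rule sublevel_measurable)
  have "(\<integral>\<^sup>+z. ennreal ((h' (u z))\<^sup>2) * grad_density ux uy z \<partial>lborel)
      \<le> (\<integral>\<^sup>+z. grad_density ux uy z * indicator A z + ennreal q * (grad_density ux uy z * indicator (- A) z) \<partial>lborel)"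
  proof (rule nn_integral_mono)
    fix z
    show "ennreal ((h' (u z))\<^sup>2) * grad_density ux uy z \<le> grad_density ux uy z * indicator A z + ennreal q * (grad_density ux uy z * indicator (- A) z)"
    proof (cases "z \<in> ball 0 1")
      case True
      have "ennreal ((h' (u z))\<^sup>2) \<le> (if u z \<le> s then 1 else ennreal q)"
        using assms(1)[of "u z"] assms(2)[of "u z"] \<open>0 \<le> q\<close> by (auto simp: not_le intro: ennreal_leI)
      then have "ennreal ((h' (u z))\<^sup>2) * grad_density ux uy z \<le> (if u z \<le> s then 1 else ennreal q) * grad_density ux uy z"
        by (rule mult_right_mono) simp
      then show ?thesis using True by (auto simp: A_def split: if_splits)
    qed (simp add: grad_density_def)
  qed
  also have "\<dots> = (\<integral>\<^sup>+z. grad_density ux uy z * indicator A z \<partial>lborel) + ennreal q * (\<integral>\<^sup>+z. grad_density ux uy z * indicator (- A) z \<partial>lborel)"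
    by (simp add: nn_integral_add nn_integral_cmult)
  also have "\<dots> \<le> ennreal (energy_below s) + ennreal q * ennreal (1 - energy_below s)"
    unfolding A_def using energy_below_bounds(3,4)[of s] by (intro add_mono mult_left_mono) auto
  also have "\<dots> = ennreal (energy_below s + q * (1 - energy_below s))"
    using energy_below_bounds(1,2)[of s] \<open>0 \<le> q\<close> by (simp add: ennreal_mult)
  finally show ?thesis .
qed

text \<open>The test function is \<open>u\<close> truncated just below \<open>t\<close>. Its energy lives on \<open>{u \<le> t}\<close>, it still takes
  nearly the value \<open>t\<close> on the set \<open>{u \<ge> t}\<close>, and truncation can only lower the average from \<open>0\<close>.\<close>

lemma level_vs_energy_below:
  assumes R: "0 < R" "R < 1" and l: "l = measure circ (superlevel R t)" "0 < l"
  shows "t \<le> sqrt (energy_below t * (ln (1 / l) + 3 / 2))"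
proof (rule field_le_epsilon)
  fix e :: real assume "e > 0"
  define \<delta> where "\<delta> = 2 * e"
  have \<delta>: "\<delta> > 0" using \<open>e > 0\<close> by (simp add: \<delta>_def)
  define h where "h x = x - ramp (t - \<delta>) \<delta> x" for x
  define h' where "h' x = 1 - ramp' (t - \<delta>) \<delta> x" for x
  have ch': "continuous_on UNIV h'"
    unfolding h'_def by (intro continuous_intros continuous_ramp')
  have "t - \<delta> / 2 \<le> (\<integral>\<theta>. h (u (of_real R * cis \<theta>)) \<partial>circ) + sqrt (energy_below t * (ln (1 / l) + 3 / 2))"
  proof (rule composed_level_bound[OF R l])
    show "(h has_real_derivative h' x) (at x)" for x
      unfolding h_def[abs_def] h'_def by (intro DERIV_diff DERIV_ident ramp_deriv)
    have "(\<integral>\<^sup>+z. ennreal ((h' (u z))\<^sup>2) * grad_density ux uy z \<partial>lborel) \<le> ennreal (energy_below t + 0 * (1 - energy_below t))"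
    proof (rule two_speed_energy)
      show "(h' x)\<^sup>2 \<le> 1" if "x \<le> t" for x
        using ramp_props(1,2)[OF \<delta>, of "t - \<delta>" x] by (simp add: h'_def abs_square_le_1)
      show "(h' x)\<^sup>2 \<le> 0" if "t < x" for x
        using ramp_props(4)[OF \<delta>, of "t - \<delta>" x] that by (simp add: h'_def)
    qed (use ch' in \<open>auto intro: borel_measurable_continuous_onI\<close>)
    then show "(\<integral>\<^sup>+z. ennreal ((h' (u z))\<^sup>2) * grad_density ux uy z \<partial>lborel) \<le> ennreal (energy_below t)" by simp
    show "t - \<delta> / 2 \<le> h x" if "t \<le> x" for x
      using ramp_props(5)[OF \<delta>, of "t - \<delta>" x] that by (simp add: h_def)
  qed (use ch' energy_below_bounds in auto)
  also have "(\<integral>\<theta>. h (u (of_real R * cis \<theta>)) \<partial>circ) \<le> (\<integral>\<theta>. u (of_real R * cis \<theta>) \<partial>circ)"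
  proof (rule integral_mono)
    have "continuous_on UNIV h"
      unfolding h_def[abs_def]
      using ramp_deriv by (intro continuous_intros continuous_at_imp_continuous_on ballI DERIV_isCont) blast
    then show "integrable circ (\<lambda>\<theta>. h (u (of_real R * cis \<theta>)))" by (rule integrable_composed[OF R])
    show "integrable circ (\<lambda>\<theta>. u (of_real R * cis \<theta>))"
      by (rule integrable_composed[OF R, of "\<lambda>x. x"]) (intro continuous_intros)
    show "h (u (of_real R * cis \<theta>)) \<le> u (of_real R * cis \<theta>)" for \<theta>
      using ramp_props(6)[OF \<delta>] by (simp add: h_def)
  qed
  finally show "t \<le> sqrt (energy_below t * (ln (1 / l) + 3 / 2)) + e"
    using mean[OF R] by (simp add: \<delta>_def)
qed

definition excess :: "real \<Rightarrow> real \<Rightarrow> real" where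
  "excess R s = (\<integral>\<theta>. max 0 (u (of_real R * cis \<theta>) - s) \<partial>circ)"

lemma excess_nonneg: "0 \<le> excess R s"
  unfolding excess_def by (intro Bochner_Integration.integral_nonneg) simp

text \<open>The test function follows \<open>u\<close> up to \<open>s\<close> and has slope \<open>\<kappa>\<close> beyond. This multiplies the energy
  beyond \<open>s\<close> by \<open>\<kappa>\<^sup>2\<close> and raises the average by at most \<open>\<kappa> - 1\<close> times the excess.\<close>

lemma level_vs_energy_beyond:
  assumes R: "0 < R" "R < 1" and l: "l = measure circ (superlevel R t)" "0 < l"
    and \<kappa>: "1 \<le> \<kappa>"
  shows "s + \<kappa> * (t - s - excess R s) \<le> sqrt ((1 + \<kappa>\<^sup>2 * (1 - energy_below s)) * (ln (1 / l) + 3 / 2))"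
proof (rule field_le_epsilon)
  fix e :: real assume "e > 0"
  define \<delta> where "\<delta> = 2 * e / \<kappa>"
  have \<delta>: "\<delta> > 0" using \<open>e > 0\<close> \<kappa> by (simp add: \<delta>_def)
  have l1: "l \<le> 1" using l by simp
  have "0 \<le> ln (1 / l)" using l(2) l1 by (intro ln_ge_zero) simp
  then have X: "0 \<le> ln (1 / l) + 3 / 2" by simp
  define h where "h x = x + (\<kappa> - 1) * ramp s \<delta> x" for x
  define h' where "h' x = 1 + (\<kappa> - 1) * ramp' s \<delta> x" for x
  have ch': "continuous_on UNIV h'"
    unfolding h'_def by (intro continuous_intros continuous_ramp')
  have "t + (\<kappa> - 1) * (t - s - \<delta> / 2)
    \<le> (\<integral>\<theta>. h (u (of_real R * cis \<theta>)) \<partial>circ) + sqrt ((energy_below s + \<kappa>\<^sup>2 * (1 - energy_below s)) * (ln (1 / l) + 3 / 2))"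
  proof (rule composed_level_bound[OF R l])
    show "(h has_real_derivative h' x) (at x)" for x
      unfolding h_def[abs_def] h'_def by (intro DERIV_add DERIV_ident DERIV_cmult ramp_deriv)
    show "(\<integral>\<^sup>+z. ennreal ((h' (u z))\<^sup>2) * grad_density ux uy z \<partial>lborel) \<le> ennreal (energy_below s + \<kappa>\<^sup>2 * (1 - energy_below s))"
    proof (rule two_speed_energy)
      show "(h' x)\<^sup>2 \<le> 1" if "x \<le> s" for x
        using ramp_props(3)[OF \<delta> that] by (simp add: h'_def)
      show "(h' x)\<^sup>2 \<le> \<kappa>\<^sup>2" if "s < x" for x
      proof (rule power_mono)
        show "0 \<le> h' x" using ramp_props(1)[OF \<delta>, of s x] \<kappa> by (simp add: h'_def)
        show "h' x \<le> \<kappa>"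
          using mult_left_mono[OF ramp_props(2)[OF \<delta>, of s x], of "\<kappa> - 1"] \<kappa> by (simp add: h'_def)
      qed
    qed (use ch' in \<open>auto intro: borel_measurable_continuous_onI\<close>)
    show "t + (\<kappa> - 1) * (t - s - \<delta> / 2) \<le> h x" if "t \<le> x" for x
      using ramp_props(8)[OF \<delta>, where s=s and x=t] ramp_mono[OF \<delta> that, of s] that \<kappa>
      unfolding h_def by (intro add_mono mult_left_mono) auto
  qed (use ch' energy_below_bounds[of s] in \<open>auto intro!: add_nonneg_nonneg\<close>)
  also have "(\<integral>\<theta>. h (u (of_real R * cis \<theta>)) \<partial>circ)
      \<le> (\<integral>\<theta>. u (of_real R * cis \<theta>) + (\<kappa> - 1) * max 0 (u (of_real R * cis \<theta>) - s) \<partial>circ)"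
  proof (rule integral_mono)
    have "continuous_on UNIV h"
      unfolding h_def[abs_def]
      using ramp_deriv by (intro continuous_intros continuous_at_imp_continuous_on ballI DERIV_isCont) blast
    then show "integrable circ (\<lambda>\<theta>. h (u (of_real R * cis \<theta>)))" by (rule integrable_composed[OF R])
    show "integrable circ (\<lambda>\<theta>. u (of_real R * cis \<theta>) + (\<kappa> - 1) * max 0 (u (of_real R * cis \<theta>) - s))"
      by (rule integrable_composed[OF R, of "\<lambda>x. x + (\<kappa> - 1) * max 0 (x - s)"]) (intro continuous_intros)
    show "h (u (of_real R * cis \<theta>)) \<le> u (of_real R * cis \<theta>) + (\<kappa> - 1) * max 0 (u (of_real R * cis \<theta>) - s)" for \<theta>
      using ramp_props(7)[OF \<delta>] \<kappa> unfolding h_def by (intro add_mono mult_left_mono) auto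
  qed
  also have "\<dots> = (\<kappa> - 1) * excess R s"
    using mean[OF R] integrable_composed[OF R, of "\<lambda>x. x"] integrable_composed[OF R, of "\<lambda>x. max 0 (x - s)"]
    unfolding excess_def by (subst Bochner_Integration.integral_add) (auto intro!: continuous_intros)
  also have "sqrt ((energy_below s + \<kappa>\<^sup>2 * (1 - energy_below s)) * (ln (1 / l) + 3 / 2))
      \<le> sqrt ((1 + \<kappa>\<^sup>2 * (1 - energy_below s)) * (ln (1 / l) + 3 / 2))"
    using energy_below_bounds[of s] X by (intro real_sqrt_le_mono mult_right_mono) auto
  finally have "t + (\<kappa> - 1) * (t - s - \<delta> / 2)
      \<le> (\<kappa> - 1) * excess R s + sqrt ((1 + \<kappa>\<^sup>2 * (1 - energy_below s)) * (ln (1 / l) + 3 / 2))" by simp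
  moreover have "(\<kappa> - 1) * (\<delta> / 2) \<le> e"
    using \<kappa> \<open>e > 0\<close> by (simp add: \<delta>_def field_simps)
  moreover have "s + \<kappa> * (t - s - m) \<le> S + e"
    if "t + (\<kappa> - 1) * (t - s - \<delta> / 2) \<le> (\<kappa> - 1) * m + S" "(\<kappa> - 1) * (\<delta> / 2) \<le> e" "0 \<le> m" for m S
    using that unfolding left_diff_distrib right_diff_distrib by simp
  ultimately show "s + \<kappa> * (t - s - excess R s) \<le> sqrt ((1 + \<kappa>\<^sup>2 * (1 - energy_below s)) * (ln (1 / l) + 3 / 2)) + e"
    using excess_nonneg[of R s] by blast
qed

text \<open>The excess is an integral over \<open>{u \<ge> s}\<close>, of length \<open>l\<close>, so it is at most \<open>l * sqrt X\<close> with
  \<open>X = ln (1 / l) + 3 / 2\<close>. Since \<open>s \<le> sqrt X\<close> as well, the product with \<open>s\<close> is at most \<open>l * X\<close>, which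
  is bounded. Thus the shift by the excess changes \<open>s\<^sup>2\<close> by a constant only.\<close>

lemma excess_bound:
  assumes R: "0 < R" "R < 1" and l: "l = measure circ (superlevel R s)" "0 < l" and s: "0 \<le> s"
  shows "s * excess R s \<le> 5 / 2"
proof -
  define X where "X = ln (1 / l) + 3 / 2"
  have l1: "l \<le> 1" using l by simp
  have "0 \<le> ln (1 / l)" using l(2) l1 by (intro ln_ge_zero) simp
  then have X: "0 \<le> X" by (simp add: X_def)
  have E: "superlevel R s \<in> sets borel" by (rule superlevel_borel) fact+
  have iu: "integrable circ (\<lambda>\<theta>. u (of_real R * cis \<theta>))"
    using integrable_composed[OF R, of "\<lambda>x. x"] by (auto intro!: continuous_intros)
  have "s \<le> sqrt (energy_below s * X)"
    using level_vs_energy_below[OF R l] by (simp add: X_def)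
  also have "\<dots> \<le> sqrt (1 * X)"
    using energy_below_bounds[of s] X by (intro real_sqrt_le_mono mult_right_mono) auto
  finally have sX: "s \<le> sqrt X" by simp
  have "(\<integral>\<theta>. u (of_real R * cis \<theta>) * indicator (superlevel R s) \<theta> \<partial>circ)
      \<le> l * (\<integral>\<theta>. u (of_real R * cis \<theta>) \<partial>circ) + l * sqrt (1 * (ln (1 / l) + 3 / 2))"
    by (rule composed_bound[OF R E l, of "\<lambda>x. x" "\<lambda>x. 1"])
       (use energy in \<open>auto simp: grad_density_def intro!: derivative_eq_intros continuous_intros\<close>)
  then have le: "(\<integral>\<theta>. u (of_real R * cis \<theta>) * indicator (superlevel R s) \<theta> \<partial>circ) \<le> l * sqrt X"
    using mean[OF R] by (simp add: X_def)
  have "excess R s = (\<integral>\<theta>. u (of_real R * cis \<theta>) * indicator (superlevel R s) \<theta> - s * indicator (superlevel R s) \<theta> \<partial>circ)"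
    unfolding excess_def
    by (intro Bochner_Integration.integral_cong) (auto simp: superlevel_def split: split_indicator)
  also have "\<dots> \<le> l * sqrt X - s * l"
  proof -
    have "integrable circ (indicator (superlevel R s) :: real \<Rightarrow> real)"
      using E by (intro integrable_real_indicator) (auto simp: less_top[symmetric])
    then show ?thesis
      using le E l iu
      by (subst Bochner_Integration.integral_diff) (auto intro!: integrable_real_mult_indicator)
  qed
  also have "\<dots> \<le> l * sqrt X" using s l by simp
  finally have "s * excess R s \<le> sqrt X * (l * sqrt X)"
    using sX s excess_nonneg X by (intro mult_mono) auto
  also have "\<dots> = l * X" using X by simp
  also have "\<dots> = l * ln (1 / l) + 3 / 2 * l" by (simp add: X_def algebra_simps)
  also have "l * ln (1 / l) \<le> l * (1 / l)"
    using l ln_le_minus_one[of "1 / l"] by (intro mult_left_mono) auto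
  also have "l * (1 / l) + 3 / 2 * l \<le> 5 / 2" using l l1 by simp
  finally show ?thesis by simp
qed

lemma superlevel_measure_antimono:
  assumes "0 < R" "R < 1" "s \<le> t"
  shows "measure circ (superlevel R t) \<le> measure circ (superlevel R s)"
  using assms superlevel_borel[of R s] by (intro circ.finite_measure_mono) (auto simp: superlevel_def)

definition quantile :: "real \<Rightarrow> nat \<Rightarrow> real" where
  "quantile R k = Sup {t. exp (- real (Suc k)) \<le> measure circ (superlevel R t)}"

lemma quantile_props:
  assumes R: "0 < R" "R < 1"
  shows "mono (quantile R)"
    and "exp (- real (Suc k)) \<le> measure circ (superlevel R (quantile R k))"
    and "measure circ {\<theta>. quantile R k < u (of_real R * cis \<theta>)} \<le> exp (- real (Suc k))"
proof -
  note borel = superlevel_borel[OF R]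
  have sub: "superlevel R t \<subseteq> superlevel R s" if "s \<le> t" for s t
    using that by (auto simp: superlevel_def)
  have inv_mono: "1 / real (Suc n) \<le> 1 / real (Suc m)" if "m \<le> n" for m n
    using that by (intro frac_le) auto
  let ?S = "\<lambda>k. {t. exp (- real (Suc k)) \<le> measure circ (superlevel R t)}"
  have "compact (u ` sphere 0 R)"
    using R by (intro compact_continuous_image continuous_on_subset[OF has_gradient_on_continuous[OF grad]]) auto
  from compact_imp_bounded[OF this] obtain B where "\<forall>z\<in>sphere 0 R. \<bar>u z\<bar> \<le> B"
    unfolding bounded_iff by auto
  then have "\<bar>u (of_real R * cis \<theta>)\<bar> \<le> B" for \<theta>
    using R by (simp add: norm_mult)
  then have B: "- B \<le> u (of_real R * cis \<theta>)" "u (of_real R * cis \<theta>) \<le> B" for \<theta>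
    by (simp_all add: abs_le_iff minus_le_iff)
  have "superlevel R (- B) = UNIV" using B(1) by (auto simp: superlevel_def)
  then have ne: "- B \<in> ?S k" for k by simp
  have bdd: "bdd_above (?S k)" for k
  proof (rule bdd_aboveI)
    fix t assume t: "t \<in> ?S k"
    show "t \<le> B"
    proof (rule ccontr)
      assume "\<not> t \<le> B"
      then have "\<theta> \<notin> superlevel R t" for \<theta> using B(2)[of \<theta>] by (simp add: superlevel_def)
      then have "superlevel R t = {}" by blast
      then show False using t by (simp add: not_le[symmetric])
    qed
  qed
  show "mono (quantile R)"
    unfolding mono_def quantile_def
  proof (intro allI impI cSup_subset_mono bdd)
    fix j k :: nat assume "j \<le> k"
    then have "exp (- real (Suc k)) \<le> exp (- real (Suc j))" by simp
    then show "?S j \<subseteq> ?S k" by (blast intro: order_trans)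
  qed (use ne in blast)
  show "exp (- real (Suc k)) \<le> measure circ (superlevel R (quantile R k))"
  proof -
    let ?A = "\<lambda>n. superlevel R (quantile R k - 1 / real (Suc n))"
    have "(\<lambda>n. measure circ (?A n)) \<longlonglongrightarrow> measure circ (\<Inter>n. ?A n)"
    proof (rule circ.finite_Lim_measure_decseq)
      show "decseq ?A"
        unfolding decseq_def using inv_mono by (intro allI impI sub) simp
    qed (use borel in auto)
    moreover have "(\<Inter>n. ?A n) = superlevel R (quantile R k)"
    proof safe
      fix \<theta> assume "\<theta> \<in> (\<Inter>n. ?A n)"
      then have "quantile R k - 1 / real (Suc n) \<le> u (of_real R * cis \<theta>)" for n
        by (auto simp: superlevel_def)
      moreover have "(\<lambda>n. quantile R k - 1 / real (Suc n)) \<longlonglongrightarrow> quantile R k - 0"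
        by (intro tendsto_intros LIMSEQ_Suc lim_1_over_n)
      ultimately have "quantile R k - 0 \<le> u (of_real R * cis \<theta>)"
        by (intro LIMSEQ_le_const2) auto
      then show "\<theta> \<in> superlevel R (quantile R k)" by (simp add: superlevel_def)
    next
      fix \<theta> n assume "\<theta> \<in> superlevel R (quantile R k)"
      then show "\<theta> \<in> ?A n" using sub[of "quantile R k - 1 / real (Suc n)" "quantile R k"] by auto
    qed
    moreover have "exp (- real (Suc k)) \<le> measure circ (?A n)" for n
    proof -
      have "quantile R k - 1 / real (Suc n) < Sup (?S k)" by (simp add: quantile_def)
      then obtain t where "t \<in> ?S k" "quantile R k - 1 / real (Suc n) < t"
        using less_cSupE ne by (metis (no_types, lifting) empty_iff)
      then show ?thesis
        using superlevel_measure_antimono[OF R, of "quantile R k - 1 / real (Suc n)" t] by simp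
    qed
    ultimately show ?thesis
      using LIMSEQ_le_const[of "\<lambda>n. measure circ (?A n)"] by auto
  qed
  show "measure circ {\<theta>. quantile R k < u (of_real R * cis \<theta>)} \<le> exp (- real (Suc k))"
  proof -
    let ?A = "\<lambda>n. superlevel R (quantile R k + 1 / real (Suc n))"
    have "(\<lambda>n. measure circ (?A n)) \<longlonglongrightarrow> measure circ (\<Union>n. ?A n)"
    proof (rule circ.finite_Lim_measure_incseq)
      show "incseq ?A"
        unfolding incseq_def using inv_mono by (intro allI impI sub) simp
    qed (use borel in auto)
    moreover have "(\<Union>n. ?A n) = {\<theta>. quantile R k < u (of_real R * cis \<theta>)}"
    proof safe
      fix \<theta> assume "quantile R k < u (of_real R * cis \<theta>)"
      then obtain n where "1 / real (Suc n) < u (of_real R * cis \<theta>) - quantile R k"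
        using nat_approx_posE by (metis diff_gt_0_iff_gt)
      then show "\<theta> \<in> (\<Union>n. ?A n)" by (auto simp: superlevel_def intro!: exI[of _ n])
    next
      fix \<theta> n assume "\<theta> \<in> ?A n"
      moreover have "0 < 1 / real (Suc n)" by simp
      ultimately show "quantile R k < u (of_real R * cis \<theta>)" unfolding superlevel_def mem_Collect_eq by linarith
    qed
    moreover have "measure circ (?A n) \<le> exp (- real (Suc k))" for n
    proof (rule ccontr)
      assume "\<not> ?thesis"
      then have "quantile R k + 1 / real (Suc n) \<in> ?S k" by simp
      then have "quantile R k + 1 / real (Suc n) \<le> quantile R k"
        unfolding quantile_def by (rule cSup_upper[OF _ bdd])
      then show False by (simp add: field_simps)
    qed
    ultimately show ?thesis
      using LIMSEQ_le_const2[of "\<lambda>n. measure circ (?A n)"] by auto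
  qed
qed

lemma quantile_sum_bound:
  assumes R: "0 < R" "R < 1"
  shows "(\<Sum>k<K. if 0 < quantile R k then exp ((quantile R k)\<^sup>2 - real k) else 0) \<le> 91 * exp 3 / (1 - exp (-1))\<^sup>2"
proof (rule level_sum_bound[where e = "\<lambda>k. energy_below (quantile R k)" and \<mu> = "\<lambda>k. excess R (quantile R k)"])
  define l where "l k = measure circ (superlevel R (quantile R k))" for k
  have l0: "0 < l k" for k
    using quantile_props(2)[OF R, of k] unfolding l_def by (rule less_le_trans[rotated]) simp
  have ln_l: "ln (1 / l k) + 3/2 \<le> real k + 5/2" for k
  proof -
    have "- real (Suc k) \<le> ln (l k)"
      using quantile_props(2)[OF R, of k] l0[of k] unfolding l_def by (subst ln_ge_iff) auto
    then show ?thesis using l0[of k] by (simp add: ln_div)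
  qed
  note b = energy_below_bounds
  show "quantile R k \<le> sqrt (energy_below (quantile R k) * (real k + 5/2))" for k
  proof -
    have "quantile R k \<le> sqrt (energy_below (quantile R k) * (ln (1 / l k) + 3 / 2))"
      by (rule level_vs_energy_below[OF R l_def l0])
    also have "\<dots> \<le> sqrt (energy_below (quantile R k) * (real k + 5/2))"
      using ln_l b by (intro real_sqrt_le_mono mult_left_mono)
    finally show ?thesis .
  qed
  show "quantile R j + \<kappa> * (quantile R k - quantile R j - excess R (quantile R j))
      \<le> sqrt ((1 + \<kappa>\<^sup>2 * (1 - energy_below (quantile R j))) * (real k + 5 / 2))" if "1 \<le> \<kappa>" for j k \<kappa>
  proof -
    have "quantile R j + \<kappa> * (quantile R k - quantile R j - excess R (quantile R j))
      \<le> sqrt ((1 + \<kappa>\<^sup>2 * (1 - energy_below (quantile R j))) * (ln (1 / l k) + 3 / 2))"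
      by (rule level_vs_energy_beyond[OF R l_def l0 that])
    also have "\<dots> \<le> sqrt ((1 + \<kappa>\<^sup>2 * (1 - energy_below (quantile R j))) * (real k + 5 / 2))"
      using ln_l b(1,2)[of "quantile R j"] by (intro real_sqrt_le_mono mult_left_mono add_nonneg_nonneg mult_nonneg_nonneg) auto
    finally show ?thesis .
  qed
  show "quantile R k * excess R (quantile R k) \<le> 5/2" if "0 < quantile R k" for k
    using excess_bound[OF R l_def l0] that by simp
qed (use quantile_props(1)[OF R] energy_below_bounds(1,2) excess_nonneg in auto)

text \<open>Between two consecutive quantiles \<open>u\<close> is at most the larger one, and this happens on a set of length
  at most \<open>exp (- k)\<close>. The points above all quantiles form a null set.\<close>

lemma exp_square_positive_part:
  assumes R: "0 < R" "R < 1"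
  shows "(\<integral>\<^sup>+\<theta>. (if 0 < u (of_real R * cis \<theta>) then ennreal (exp ((u (of_real R * cis \<theta>))\<^sup>2)) else 0) \<partial>circ)
    \<le> ennreal (91 * exp 3 / (1 - exp (-1))\<^sup>2)"
proof -
  let ?\<phi> = "\<lambda>\<theta>. u (of_real R * cis \<theta>)" and ?t = "quantile R"
  have [measurable]: "?\<phi> \<in> borel_measurable borel"
    by (rule borel_measurable_continuous_onI[OF continuous_circle[OF R]])
  \<comment> \<open>\<open>T k\<close> contains the points between the quantiles \<open>k - 1\<close> and \<open>k\<close>; for \<open>k = 0\<close> there is no lower quantile.\<close>
  define T where "T k = (case k of 0 \<Rightarrow> UNIV | Suc k \<Rightarrow> {\<theta>. ?t k < ?\<phi> \<theta>})" for k
  have mT[measurable]: "T k \<in> sets borel" for k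
    by (cases k) (auto simp: T_def)
  have T_le: "measure circ (T k) \<le> exp (- real k)" for k
    using quantile_props(3)[OF R] by (cases k) (auto simp: T_def simp del: of_nat_Suc)
  define c where "c k = (if 0 < ?t k then exp ((?t k)\<^sup>2) else 0)" for k
  have "emeasure circ {\<theta>. \<forall>k. ?t k < ?\<phi> \<theta>} = 0"
  proof -
    have "measure circ {\<theta>. \<forall>k. ?t k < ?\<phi> \<theta>} \<le> exp (-1) ^ k" for k
    proof -
      have "measure circ {\<theta>. \<forall>k. ?t k < ?\<phi> \<theta>} \<le> measure circ (T k)"
        by (intro circ.finite_measure_mono) (auto simp: T_def split: nat.split)
      also have "\<dots> \<le> exp (-1) ^ k" using T_le[of k] by (simp add: exp_of_nat_mult[symmetric])
      finally show ?thesis .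
    qed
    moreover have "(\<lambda>k. exp (-1) ^ k) \<longlonglongrightarrow> (0::real)" by (intro LIMSEQ_power_zero) simp
    ultimately have "measure circ {\<theta>. \<forall>k. ?t k < ?\<phi> \<theta>} \<le> 0"
      by (intro LIMSEQ_le_const) auto
    then have "measure circ {\<theta>. \<forall>k. ?t k < ?\<phi> \<theta>} = 0"
      using measure_nonneg[of circ] by (intro antisym) auto
    then show ?thesis by (simp add: circ.emeasure_eq_measure)
  qed
  then have "AE \<theta> in circ. \<not> (\<forall>k. ?t k < ?\<phi> \<theta>)"
    by (intro AE_I[where N="{\<theta>. \<forall>k. ?t k < ?\<phi> \<theta>}"]) auto
  then have "AE \<theta> in circ. (if 0 < ?\<phi> \<theta> then ennreal (exp ((?\<phi> \<theta>)\<^sup>2)) else 0)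
      \<le> (\<Sum>k. ennreal (c k) * indicator (T k) \<theta>)"
  proof eventually_elim
    case (elim \<theta>)
    define k where "k = (LEAST k. ?\<phi> \<theta> \<le> ?t k)"
    from elim obtain k0 where k0: "?\<phi> \<theta> \<le> ?t k0" by (auto simp: not_less)
    have k: "?\<phi> \<theta> \<le> ?t k" unfolding k_def using k0 by (rule LeastI)
    have kmin: "?t j < ?\<phi> \<theta>" if "j < k" for j
      using not_less_Least[OF that[unfolded k_def]] by simp
    have "\<theta> \<in> T k" using kmin[of "k - 1"] by (cases k) (auto simp: T_def)
    have "(if 0 < ?\<phi> \<theta> then ennreal (exp ((?\<phi> \<theta>)\<^sup>2)) else 0) \<le> ennreal (c k) * indicator (T k) \<theta>"
    proof (cases "0 < ?\<phi> \<theta>")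
      case True
      then have "exp ((?\<phi> \<theta>)\<^sup>2) \<le> c k" using k by (auto simp: c_def intro: power_mono)
      then show ?thesis using True \<open>\<theta> \<in> T k\<close> by (simp add: ennreal_leI)
    qed simp
    also have "\<dots> = (\<Sum>j\<in>{k}. ennreal (c j) * indicator (T j) \<theta>)"
      by (subst sum.insert) auto
    also have "\<dots> \<le> (\<Sum>k. ennreal (c k) * indicator (T k) \<theta>)"
      by (intro sum_le_suminf summableI) auto
    finally show ?case .
  qed
  then have "(\<integral>\<^sup>+\<theta>. (if 0 < ?\<phi> \<theta> then ennreal (exp ((?\<phi> \<theta>)\<^sup>2)) else 0) \<partial>circ)
      \<le> (\<integral>\<^sup>+\<theta>. (\<Sum>k. ennreal (c k) * indicator (T k) \<theta>) \<partial>circ)"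
    by (rule nn_integral_mono_AE)
  also have "\<dots> = (\<Sum>k. \<integral>\<^sup>+\<theta>. ennreal (c k) * indicator (T k) \<theta> \<partial>circ)"
    by (rule nn_integral_suminf) measurable
  also have "\<dots> = (\<Sum>k. ennreal (c k) * emeasure circ (T k))"
    by (simp add: nn_integral_cmult_indicator)
  also have "\<dots> \<le> (\<Sum>k. ennreal (if 0 < ?t k then exp ((?t k)\<^sup>2 - real k) else 0))"
  proof (intro suminf_le summableI)
    fix k
    have "ennreal (c k) * emeasure circ (T k) \<le> ennreal (c k) * ennreal (exp (- real k))"
      using T_le[of k] by (intro mult_left_mono) (auto simp: circ.emeasure_eq_measure ennreal_leI)
    also have "\<dots> = ennreal (if 0 < ?t k then exp ((?t k)\<^sup>2 - real k) else 0)"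
      by (simp add: c_def ennreal_mult[symmetric] exp_add[symmetric])
    finally show "ennreal (c k) * emeasure circ (T k) \<le> ennreal (if 0 < ?t k then exp ((?t k)\<^sup>2 - real k) else 0)" .
  qed
  also have "\<dots> \<le> ennreal (91 * exp 3 / (1 - exp (-1))\<^sup>2)"
  proof (rule suminf_le_const[OF summableI])
    fix K
    have "(\<Sum>k<K. ennreal (if 0 < ?t k then exp ((?t k)\<^sup>2 - real k) else 0))
        = ennreal (\<Sum>k<K. if 0 < ?t k then exp ((?t k)\<^sup>2 - real k) else 0)"
      by (rule sum_ennreal) simp
    also have "\<dots> \<le> ennreal (91 * exp 3 / (1 - exp (-1))\<^sup>2)"
      by (rule ennreal_leI[OF quantile_sum_bound[OF R]])
    finally show "(\<Sum>k<K. ennreal (if 0 < ?t k then exp ((?t k)\<^sup>2 - real k) else 0)) \<le> ennreal (91 * exp 3 / (1 - exp (-1))\<^sup>2)" .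
  qed
  finally show ?thesis .
qed

end

section \<open>Mean value property and null sets on the circle\<close>

lemma C1_on_has_gradient:
  fixes f :: "complex \<Rightarrow> real"
  assumes "C1_on S f"
  shows "has_gradient_on S f (partial_deriv 1 f) (partial_deriv \<i> f)"
proof -
  have "(f has_derivative (\<lambda>h. partial_deriv 1 f z * Re h + partial_deriv \<i> f z * Im h)) (at z)" if "z \<in> S" for z
  proof -
    let ?L = "frechet_derivative f (at z)"
    have L: "(f has_derivative ?L) (at z)"
      using assms that unfolding C1_on_def frechet_derivative_works[symmetric] by blast
    have "?L h = partial_deriv 1 f z * Re h + partial_deriv \<i> f z * Im h" for h
    proof -
      have lin: "linear ?L" using L has_derivative_linear by blast
      have "h = Re h *\<^sub>R 1 + Im h *\<^sub>R \<i>" by (simp add: complex_eq_iff)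
      then have "?L h = ?L (Re h *\<^sub>R 1 + Im h *\<^sub>R \<i>)" by simp
      also have "\<dots> = Re h * ?L 1 + Im h * ?L \<i>"
        using lin by (simp add: linear_add linear_cmul)
      finally show ?thesis by (simp add: partial_deriv_def mult.commute)
    qed
    then have "?L = (\<lambda>h. partial_deriv 1 f z * Re h + partial_deriv \<i> f z * Im h)" by blast
    then show ?thesis using L by simp
  qed
  then show ?thesis
    using assms unfolding has_gradient_on_def C1_on_def by (auto simp: Basis_complex_def)
qed

lemma norm_gradient_complex:
  fixes f :: "complex \<Rightarrow> real"
  shows "(norm (gradient f z))\<^sup>2 = (partial_deriv 1 f z)\<^sup>2 + (partial_deriv \<i> f z)\<^sup>2"
  unfolding gradient_def by (simp add: Basis_complex_def cmod_power2)

lemma constant_of_deriv_zero: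
  fixes f :: "real \<Rightarrow> real"
  assumes "continuous_on {0..R} f" "\<And>r. 0 < r \<Longrightarrow> r \<le> R \<Longrightarrow> (f has_vector_derivative 0) (at r within {0..R})"
    and "0 \<le> r" "r \<le> R"
  shows "f r = f 0"
  by (rule has_derivative_zero_unique_strong_interval[of "{0}" 0 R f])
     (use assms in \<open>auto simp: has_vector_derivative_def\<close>)

text \<open>In polar coordinates the Laplace equation reads \<open>r \<partial>\<^sub>r (r \<partial>\<^sub>r u) = - \<partial>\<^sub>\<theta> (\<partial>\<^sub>\<theta> u)\<close>. Averaging over \<open>\<theta>\<close>
  kills the right side, so the average of \<open>r \<partial>\<^sub>r u\<close> is constant in \<open>r\<close>; it vanishes at \<open>r = 0\<close>.
  Therefore the average of \<open>\<partial>\<^sub>r u\<close> vanishes too, and the average of \<open>u\<close> is constant.\<close>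

lemma mean_value_circle:
  fixes u ux uy :: "complex \<Rightarrow> real"
  assumes u: "has_gradient_on (ball 0 1) u ux uy"
    and ux: "has_gradient_on (ball 0 1) ux uxx uxy" and uy: "has_gradient_on (ball 0 1) uy uyx uyy"
    and laplace: "\<And>z. z \<in> ball 0 1 \<Longrightarrow> uxx z + uyy z = 0"
    and R: "0 < R" "R < 1"
  shows "(\<integral>\<theta>. u (of_real R * cis \<theta>) \<partial>circ) = u 0"
proof -
  define p where "p r \<theta> = r * radial_deriv ux uy r \<theta>" for r \<theta>
  define q where "q r \<theta> = radial_deriv ux uy r \<theta> + r * (radial_deriv uxx uxy r \<theta> * cos \<theta> + radial_deriv uyx uyy r \<theta> * sin \<theta>)" for r \<theta>
  have cont: "continuous_on ({0..R} \<times> UNIV) (\<lambda>(r, \<theta>). u (of_real r * cis \<theta>))"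
    "continuous_on ({0..R} \<times> UNIV) (\<lambda>(r, \<theta>). radial_deriv ux uy r \<theta>)"
    "continuous_on ({0..R} \<times> UNIV) (\<lambda>(r, \<theta>). radial_deriv uxx uxy r \<theta>)"
    "continuous_on ({0..R} \<times> UNIV) (\<lambda>(r, \<theta>). radial_deriv uyx uyy r \<theta>)"
    using continuous_radial_deriv[OF u R(2)] continuous_radial_deriv[OF ux R(2)] continuous_radial_deriv[OF uy R(2)]
      continuous_on_disk_polar[OF has_gradient_on_continuous[OF u] R(2)] by auto
  have cp: "continuous_on ({0..R} \<times> UNIV) (\<lambda>(r, \<theta>). p r \<theta>)"
    and cq: "continuous_on ({0..R} \<times> UNIV) (\<lambda>(r, \<theta>). q r \<theta>)"
    using cont unfolding p_def q_def case_prod_beta by (auto intro!: continuous_intros)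
  have dp: "((\<lambda>r. p r \<theta>) has_vector_derivative q r \<theta>) (at r within {0..R})" if "r \<in> {0..R}" for r \<theta>
  proof -
    have "((\<lambda>r. ux (of_real r * cis \<theta>)) has_real_derivative radial_deriv uxx uxy r \<theta>) (at r within {0..R})"
      "((\<lambda>r. uy (of_real r * cis \<theta>)) has_real_derivative radial_deriv uyx uyy r \<theta>) (at r within {0..R})"
      using radial_derivative[OF ux] radial_derivative[OF uy] that R by auto
    then have "((\<lambda>r. r * (ux (of_real r * cis \<theta>) * cos \<theta> + uy (of_real r * cis \<theta>) * sin \<theta>)) has_real_derivative
       (ux (of_real r * cis \<theta>) * cos \<theta> + uy (of_real r * cis \<theta>) * sin \<theta>)
        + r * (radial_deriv uxx uxy r \<theta> * cos \<theta> + radial_deriv uyx uyy r \<theta> * sin \<theta>)) (at r within {0..R})"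
      by (auto intro!: derivative_eq_intros simp: algebra_simps)
    then show ?thesis
      unfolding p_def q_def radial_deriv_def[OF u] has_real_derivative_iff_has_vector_derivative .
  qed
  have q0: "(\<integral>\<theta>. q r \<theta> \<partial>circ) = 0" if r: "0 < r" "r \<le> R" for r
  proof -
    define s where "s \<theta> = r * (angular_deriv uyx uyy r \<theta> * cos \<theta> - uy (of_real r * cis \<theta>) * sin \<theta>
       - angular_deriv uxx uxy r \<theta> * sin \<theta> - ux (of_real r * cis \<theta>) * cos \<theta>)" for \<theta>
    have cs: "q r \<theta> = - (s \<theta> / r)" for \<theta>
    proof -
      have z: "uyy (of_real r * cis \<theta>) = - uxx (of_real r * cis \<theta>)"
        using laplace[of "of_real r * cis \<theta>"] r R by (simp add: norm_mult)
      have "r * q r \<theta> + s \<theta> = 0"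
        unfolding q_def s_def radial_deriv_def[OF u] radial_deriv_def[OF ux] radial_deriv_def[OF uy] angular_deriv_def[OF ux] angular_deriv_def[OF uy] z
        by (simp add: algebra_simps)
      then show ?thesis using r by (simp add: field_simps)
    qed
    have "(\<integral>\<theta>. s \<theta> \<partial>circ) = 0"
    proof (rule circ_integral_of_derivative)
      fix \<theta>
      have "((\<lambda>\<theta>. ux (of_real r * cis \<theta>)) has_real_derivative angular_deriv uxx uxy r \<theta>) (at \<theta>)"
        "((\<lambda>\<theta>. uy (of_real r * cis \<theta>)) has_real_derivative angular_deriv uyx uyy r \<theta>) (at \<theta>)"
        using angular_derivative[OF ux] angular_derivative[OF uy] r R by auto
      then have "((\<lambda>\<theta>. r * (uy (of_real r * cis \<theta>) * cos \<theta> - ux (of_real r * cis \<theta>) * sin \<theta>)) has_real_derivative s \<theta>) (at \<theta>)"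
        unfolding s_def by (auto intro!: derivative_eq_intros simp: algebra_simps)
      then show "(angular_deriv ux uy r has_vector_derivative s \<theta>) (at \<theta>)"
        unfolding angular_deriv_def[OF u, abs_def] has_real_derivative_iff_has_vector_derivative .
    next
      have "s = (\<lambda>\<theta>. - (r * q r \<theta>))" using cs r by (auto simp: fun_eq_iff)
      then show "continuous_on UNIV s"
        using continuous_slice[OF cq, of r] r by (auto intro!: continuous_intros)
      show "angular_deriv ux uy r (2*pi) = angular_deriv ux uy r 0"
        unfolding angular_deriv_def[OF u] using cis_2pi by simp
    qed
    then show ?thesis unfolding cs by simp
  qed
  have "(\<integral>\<theta>. p r \<theta> \<partial>circ) = (\<integral>\<theta>. p 0 \<theta> \<partial>circ)" if "0 \<le> r" "r \<le> R" for r
  proof (rule constant_of_deriv_zero[OF _ _ that])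
    have d: "((\<lambda>r. \<integral>\<theta>. p r \<theta> \<partial>circ) has_vector_derivative (\<integral>\<theta>. q r \<theta> \<partial>circ)) (at r within {0..R})"
      if "0 \<le> r" "r \<le> R" for r
      by (rule circ_leibniz[OF cp cq dp that])
    show "continuous_on {0..R} (\<lambda>r. \<integral>\<theta>. p r \<theta> \<partial>circ)"
      using d by (intro continuous_on_vector_derivative) auto
    show "((\<lambda>r. \<integral>\<theta>. p r \<theta> \<partial>circ) has_vector_derivative 0) (at r within {0..R})" if "0 < r" "r \<le> R" for r
      using d[of r] q0[OF that] that by simp
  qed
  then have p0: "(\<integral>\<theta>. p r \<theta> \<partial>circ) = (\<integral>\<theta>. p 0 \<theta> \<partial>circ)" if "0 \<le> r" "r \<le> R" for r
    using that by blast
  have rad0: "(\<integral>\<theta>. radial_deriv ux uy r \<theta> \<partial>circ) = 0" if "0 < r" "r \<le> R" for r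
    using p0[of r] that unfolding p_def[abs_def] by simp
  have "(\<integral>\<theta>. u (of_real R * cis \<theta>) \<partial>circ) = (\<integral>\<theta>. u (of_real 0 * cis \<theta>) \<partial>circ)"
  proof (rule constant_of_deriv_zero)
    have d: "((\<lambda>r. \<integral>\<theta>. u (of_real r * cis \<theta>) \<partial>circ) has_vector_derivative (\<integral>\<theta>. radial_deriv ux uy r \<theta> \<partial>circ)) (at r within {0..R})"
      if "0 \<le> r" "r \<le> R" for r
      using that R radial_derivative[OF u]
      by (intro circ_leibniz[OF cont(1,2)]) (auto simp: has_real_derivative_iff_has_vector_derivative)
    show "continuous_on {0..R} (\<lambda>r. \<integral>\<theta>. u (of_real r * cis \<theta>) \<partial>circ)"
      using d by (intro continuous_on_vector_derivative) auto
    show "((\<lambda>r. \<integral>\<theta>. u (of_real r * cis \<theta>) \<partial>circ) has_vector_derivative 0) (at r within {0..R})" if "0 < r" "r \<le> R" for r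
      using d[of r] rad0[OF that] that by simp
  qed (use R in auto)
  then show ?thesis by simp
qed

lemma cis_lipschitz: "cmod (cis x - cis y) \<le> \<bar>x - y\<bar>"
proof -
  have "cis x - cis y = cis y * (cis (x - y) - 1)" by (simp add: right_diff_distrib cis_mult)
  then have "cmod (cis x - cis y) = cmod (exp (\<i> * of_real (x - y)) - 1)"
    by (simp only: norm_mult norm_cis cis_conv_exp[of "x - y"] mult_1)
  also have "\<dots> = 2 * \<bar>sin ((x - y) / 2)\<bar>" by (rule dist_exp_i_1)
  also have "\<dots> \<le> 2 * \<bar>(x - y) / 2\<bar>" by (intro mult_left_mono abs_sin_x_le_abs_x) auto
  finally show ?thesis by simp
qed

text \<open>A null set of angles is covered by intervals of total length at most \<open>min \<delta> \<epsilon>\<close>; then each single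
  interval is automatically shorter than the prescribed mesh \<open>\<delta>\<close>, and \<open>cis\<close> does not increase distances.\<close>

lemma hausdorff1_cis_null:
  assumes N: "N \<in> null_sets lborel" and A: "A \<subseteq> cis ` (N \<inter> {0..2*pi})"
  shows "hausdorff1 A = 0"
proof -
  have "hausdorff1_pre \<delta> A \<le> ennreal \<epsilon>" if "0 < \<delta>" "0 < \<epsilon>" for \<delta> \<epsilon>
  proof -
    define e where "e = min \<delta> \<epsilon>"
    have e: "0 < e" "e \<le> \<delta>" "e \<le> \<epsilon>" using that by (auto simp: e_def)
    let ?S = "N \<inter> {0..2*pi}"
    have S: "?S \<in> null_sets lebesgue"
      using N by (intro null_sets_completionI null_set_Int2) auto
    have Sm: "?S \<in> lmeasurable"
      using S by (intro negligible_imp_measurable) (simp add: negligible_iff_null_sets)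
    have sub: "?S \<subseteq> cbox 0 (2*pi)" by auto
    obtain \<D> where D: "countable \<D>"
        "\<And>K. K \<in> \<D> \<Longrightarrow> K \<subseteq> cbox 0 (2*pi) \<and> K \<noteq> {} \<and> (\<exists>c d. K = cbox c d)"
        "pairwise (\<lambda>A B. interior A \<inter> interior B = {}) \<D>"
        "?S \<subseteq> \<Union>\<D>" "\<Union>\<D> \<in> lmeasurable" "measure lebesgue (\<Union>\<D>) \<le> measure lebesgue ?S + e"
      by (rule measurable_outer_intervals_bounded[OF Sm sub e(1)]) blast
    \<comment> \<open>The cover may be finite, so the sequence is padded with empty sets. The interiors are disjoint, and they have the same lengths as the intervals.\<close>
    define X where "X n = (if n \<in> to_nat_on \<D> ` \<D> then interior (from_nat_into \<D> n) else {})" for n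
    define U where "U n = (if n \<in> to_nat_on \<D> ` \<D> then cis ` from_nat_into \<D> n else {})" for n
    have fn: "from_nat_into \<D> n \<in> \<D>" if "n \<in> to_nat_on \<D> ` \<D>" for n
      using that D(1) by auto
    have disj: "disjoint_family X"
      unfolding disjoint_family_on_def
    proof (intro ballI impI)
      fix m n :: nat assume "m \<noteq> n"
      show "X m \<inter> X n = {}"
      proof (cases "m \<in> to_nat_on \<D> ` \<D> \<and> n \<in> to_nat_on \<D> ` \<D>")
        case True
        then have "from_nat_into \<D> m \<noteq> from_nat_into \<D> n"
          using \<open>m \<noteq> n\<close> D(1) by auto
        then show ?thesis using D(3) fn True unfolding pairwise_def X_def by auto
      qed (auto simp: X_def)
    qed
    have X_sub: "(\<Union>n. X n) \<subseteq> \<Union>\<D>"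
    proof
      fix x assume "x \<in> (\<Union>n. X n)"
      then obtain n where "x \<in> X n" by blast
      then have n: "n \<in> to_nat_on \<D> ` \<D>" "x \<in> interior (from_nat_into \<D> n)"
        by (auto simp: X_def split: if_splits)
      then show "x \<in> \<Union>\<D>" using fn[OF n(1)] interior_subset by blast
    qed
    have Xb: "X n \<in> sets lborel" for n by (simp add: X_def)
    have sumX: "(\<Sum>n. emeasure lborel (X n)) \<le> ennreal e"
    proof -
      have "(\<Sum>n. emeasure lborel (X n)) = emeasure lborel (\<Union>n. X n)"
        using disj Xb by (intro suminf_emeasure) auto
      also have "\<dots> = emeasure lebesgue (\<Union>n. X n)"
        using sets.countable_UN[of X UNIV lborel] Xb by (simp add: image_subset_iff)
      also have "\<dots> \<le> emeasure lebesgue (\<Union>\<D>)"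
        using X_sub D(5) by (intro emeasure_mono) auto
      also have "\<dots> = ennreal (measure lebesgue (\<Union>\<D>))"
        using D(5) by (simp add: emeasure_eq_measure2)
      also have "\<dots> \<le> ennreal e"
        using D(6) S by (intro ennreal_leI) (simp add: measure_eq_0_null_sets)
      finally show ?thesis .
    qed
    have diam: "bounded (U n) \<and> ennreal (diameter (U n)) \<le> emeasure lborel (X n)" for n
    proof (cases "n \<in> to_nat_on \<D> ` \<D>")
      case True
      then obtain c d where K: "from_nat_into \<D> n = {c..d}" "{c..d} \<noteq> {}"
        using D(2)[OF fn[OF True]] by (auto simp: cbox_interval)
      then have "c \<le> d" by simp
      have "compact (cis ` {c..d})"
        by (intro compact_continuous_image continuous_intros) auto
      moreover have "diameter (cis ` {c..d}) \<le> d - c"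
        using \<open>c \<le> d\<close> by (intro diameter_le) (auto intro!: order_trans[OF cis_lipschitz])
      ultimately show ?thesis
        using True K \<open>c \<le> d\<close> by (auto simp: U_def X_def interior_atLeastAtMost_real compact_imp_bounded ennreal_leI)
    qed (simp add: U_def X_def)
    have "A \<subseteq> (\<Union>n. U n)"
    proof
      fix \<zeta> assume "\<zeta> \<in> A"
      then obtain x where x: "\<zeta> = cis x" "x \<in> ?S" using A by blast
      then obtain K where K: "K \<in> \<D>" "x \<in> K" using D(4) by blast
      then have "\<zeta> \<in> U (to_nat_on \<D> K)"
        using D(1) x by (auto simp: U_def)
      then show "\<zeta> \<in> (\<Union>n. U n)" by blast
    qed
    moreover have "diameter (U n) \<le> \<delta>" for n
    proof -
      have "ennreal (diameter (U n)) \<le> (\<Sum>n. emeasure lborel (X n))"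
        using diam[of n] sum_le_suminf[of "\<lambda>n. emeasure lborel (X n)" "{n}"] by (auto intro: order_trans)
      then have "ennreal (diameter (U n)) \<le> ennreal \<delta>"
        using sumX e by (meson ennreal_leI order_trans)
      then show ?thesis using that by (simp add: ennreal_le_iff)
    qed
    ultimately have "hausdorff1_pre \<delta> A \<le> (\<Sum>n. ennreal (diameter (U n)))"
      unfolding hausdorff1_pre_def using diam by (intro INF_lower) auto
    also have "\<dots> \<le> (\<Sum>n. emeasure lborel (X n))"
      using diam by (intro suminf_le summableI) auto
    also have "\<dots> \<le> ennreal \<epsilon>" using sumX e by (meson ennreal_leI order_trans)
    finally show ?thesis .
  qed
  note small = this
  have "hausdorff1_pre \<delta> A \<le> 0" if "0 < \<delta>" for \<delta>
  proof (rule ennreal_le_epsilon)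
    fix \<epsilon> :: real assume "0 < \<epsilon>"
    then show "hausdorff1_pre \<delta> A \<le> 0 + ennreal \<epsilon>" using small[OF that] by simp
  qed
  then have "hausdorff1 A \<le> 0"
    unfolding hausdorff1_def by (intro SUP_least) simp
  then show ?thesis by simp
qed

section \<open>Radial limits and the exponential integral\<close>

text \<open>By Cauchy-Schwarz a function with square integrable derivative is Hoelder continuous of order one
  half, hence has a limit at the end of the interval.\<close>

lemma has_radial_limit_of_energy:
  fixes u :: "complex \<Rightarrow> real"
  assumes grad: "has_gradient_on (ball 0 1) u ux uy"
    and K: "(\<integral>\<^sup>+r\<in>{1/2..<1}. ennreal ((radial_deriv ux uy r \<theta>)\<^sup>2) \<partial>lborel) \<le> ennreal K" "0 \<le> K"
  shows "\<exists>l. has_radial_limit u l (cis \<theta>)"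
proof -
  define f where "f t = u (of_real t * cis \<theta>)" for t :: real
  let ?f' = "\<lambda>r. radial_deriv ux uy r \<theta>"
  have lip: "\<bar>f t - f s\<bar> \<le> sqrt (t - s) * (1 + K) / 2" if st: "1/2 \<le> s" "s < t" "t < 1" for s t
  proof -
    have "continuous_on {s..t} (\<lambda>r. case (r, \<theta>) of (r, \<theta>) \<Rightarrow> radial_deriv ux uy r \<theta>)"
      by (rule continuous_on_compose2[OF continuous_radial_deriv[OF grad st(3)]])
         (use st in \<open>auto intro!: continuous_intros\<close>)
    then have c: "continuous_on {s..t} ?f'" by simp
    have "(?f' has_integral f t - f s) {s..t}"
      using st radial_derivative[OF grad] unfolding f_def
      by (intro fundamental_theorem_of_calculus) (auto simp: has_real_derivative_iff_has_vector_derivative[symmetric])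
    then have ft: "f t - f s = integral {s..t} ?f'" by (simp add: integral_unique)
    have "ennreal (integral {s..t} (\<lambda>r. (?f' r)\<^sup>2)) = (\<integral>\<^sup>+r\<in>{s..t}. ennreal ((?f' r)\<^sup>2) \<partial>lborel)"
      by (rule nn_integral_Icc_continuous[symmetric]) (auto intro!: continuous_intros c)
    also have "\<dots> \<le> (\<integral>\<^sup>+r\<in>{1/2..<1}. ennreal ((?f' r)\<^sup>2) \<partial>lborel)"
      using st by (intro nn_integral_mono) (auto split: split_indicator)
    also note K(1)
    finally have IK: "integral {s..t} (\<lambda>r. (?f' r)\<^sup>2) \<le> K" using K(2) by simp
    \<comment> \<open>The weight that optimises \<open>\<bar>a\<bar> \<le> c / 2 + a\<^sup>2 / (2 * c)\<close> after integration over \<open>{s..t}\<close>.\<close>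
    define c where "c = 1 / sqrt (t - s)"
    have cpos: "0 < c" "1 / c = sqrt (t - s)" "c * (t - s) = sqrt (t - s)"
      using st by (auto simp: c_def real_div_sqrt)
    have "norm (integral {s..t} ?f') \<le> integral {s..t} (\<lambda>r. c / 2 + (?f' r)\<^sup>2 * (1 / (2 * c)))"
    proof (rule integral_norm_bound_integral)
      fix r
      have "0 \<le> (c - \<bar>?f' r\<bar>)\<^sup>2 / (2 * c)" using cpos by simp
      also have "\<dots> = c / 2 + (?f' r)\<^sup>2 * (1 / (2 * c)) - \<bar>?f' r\<bar>"
        using cpos(1) by (simp add: field_simps power2_eq_square)
      finally show "norm (?f' r) \<le> c / 2 + (?f' r)\<^sup>2 * (1 / (2 * c))" by simp
    qed (intro integrable_continuous_interval continuous_intros c)+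
    also have "\<dots> = integral {s..t} (\<lambda>r. c / 2) + integral {s..t} (\<lambda>r. (?f' r)\<^sup>2 * (1 / (2 * c)))"
      by (intro Henstock_Kurzweil_Integration.integral_add integrable_continuous_interval continuous_intros c)
    also have "\<dots> = c * (t - s) / 2 + integral {s..t} (\<lambda>r. (?f' r)\<^sup>2) * (1 / c) / 2"
      using st by (simp add: mult.commute)
    also have "\<dots> \<le> sqrt (t - s) / 2 + K * sqrt (t - s) / 2"
      unfolding cpos using IK st by (intro add_mono divide_right_mono mult_right_mono) auto
    finally show ?thesis unfolding ft by (simp add: algebra_simps add_divide_distrib)
  qed
  have "uniformly_continuous_on {1/2..<1} f"
    unfolding uniformly_continuous_on_def
  proof (intro allI impI)
    fix e :: real assume e: "e > 0"
    define d where "d = (e / (1 + K))\<^sup>2"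
    have "d > 0" using e K by (simp add: d_def)
    have close: "\<bar>f t - f s\<bar> < e" if "1/2 \<le> s" "s < t" "t < 1" "t - s < d" for s t
    proof -
      have "sqrt (t - s) < e / (1 + K)"
        using that e K real_sqrt_less_mono[of "t - s" d] by (simp add: d_def)
      then have "sqrt (t - s) * (1 + K) < e" using K by (simp add: field_simps)
      then show ?thesis using lip[OF that(1-3)] e by linarith
    qed
    have "dist (f x') (f x) < e" if "x \<in> {1/2..<1}" "x' \<in> {1/2..<1}" "dist x' x < d" for x x'
      using that e close[of x x'] close[of x' x] by (cases x x' rule: linorder_cases) (auto simp: dist_real_def abs_minus_commute)
    then show "\<exists>d>0. \<forall>x\<in>{1/2..<1}. \<forall>x'\<in>{1/2..<1}. dist x' x < d \<longrightarrow> dist (f x') (f x) < e"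
      using \<open>d > 0\<close> by blast
  qed
  then obtain l where "(f \<longlongrightarrow> l) (at 1 within {1/2..<1})"
    by (rule uniformly_continuous_on_extension_at_closure[where x=1]) auto
  moreover have "at 1 within {1/2..<1} = at_left (1::real)"
    by (rule at_within_nhd[where S="{1/2<..}"]) auto
  ultimately show ?thesis unfolding has_radial_limit_def f_def by auto
qed

text \<open>Tonelli in polar coordinates: almost every radius carries finite energy. Staying away from the
  origin keeps the factor \<open>r\<close> bounded below.\<close>

lemma radial_limit_AE:
  fixes u :: "complex \<Rightarrow> real"
  assumes grad: "has_gradient_on (ball 0 1) u ux uy"
    and energy: "(\<integral>\<^sup>+z\<in>ball 0 1. ennreal (((ux z)\<^sup>2 + (uy z)\<^sup>2) / pi) \<partial>lborel) \<le> 1"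
    and mean: "\<And>r. 0 < r \<Longrightarrow> r < 1 \<Longrightarrow> (\<integral>\<theta>. u (of_real r * cis \<theta>) \<partial>circ) = 0"
  shows "AE \<theta> in lborel. \<theta> \<in> {0..2*pi} \<longrightarrow> (\<exists>l. has_radial_limit u l (cis \<theta>))"
proof -
  let ?w = "grad_density ux uy"
  note [measurable] = measurable_grad_density[OF grad]
  have [measurable]: "cis \<in> borel_measurable borel"
    by (intro borel_measurable_continuous_onI continuous_intros)
  define J where "J \<theta> = (\<integral>\<^sup>+r\<in>{0<..}. ?w (of_real r * cis \<theta>) * ennreal r \<partial>lborel)" for \<theta>
  have [measurable]: "J \<in> borel_measurable borel" unfolding J_def by measurable
  have "(\<integral>\<^sup>+\<theta>. J \<theta> * indicator {0..2*pi} \<theta> \<partial>lborel)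
     = (\<integral>\<^sup>+\<theta>. \<integral>\<^sup>+r. ?w (of_real r * cis \<theta>) * ennreal r * indicator {0<..} r * indicator {0..2*pi} \<theta> \<partial>lborel \<partial>lborel)"
    unfolding J_def by (simp add: nn_integral_multc)
  also have "\<dots> = (\<integral>\<^sup>+r. \<integral>\<^sup>+\<theta>. ?w (of_real r * cis \<theta>) * ennreal r * indicator {0<..} r * indicator {0..2*pi} \<theta> \<partial>lborel \<partial>lborel)"
    by (rule lborel_pair.Fubini') measurable
  also have "\<dots> = (\<integral>\<^sup>+r\<in>{0<..}. (\<integral>\<^sup>+\<theta>\<in>{0..2*pi}. ?w (of_real r * cis \<theta>) \<partial>lborel) * ennreal r \<partial>lborel)"
  proof (rule nn_integral_cong)
    fix r :: real
    have "(\<integral>\<^sup>+\<theta>. ?w (of_real r * cis \<theta>) * ennreal r * indicator {0<..} r * indicator {0..2*pi} \<theta> \<partial>lborel)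
      = (\<integral>\<^sup>+\<theta>. ?w (of_real r * cis \<theta>) * indicator {0..2*pi} \<theta> * (ennreal r * indicator {0<..} r) \<partial>lborel)"
      by (intro nn_integral_cong) (simp add: mult_ac)
    also have "\<dots> = (\<integral>\<^sup>+\<theta>\<in>{0..2*pi}. ?w (of_real r * cis \<theta>) \<partial>lborel) * (ennreal r * indicator {0<..} r)"
      by (rule nn_integral_multc) measurable
    finally show "(\<integral>\<^sup>+\<theta>. ?w (of_real r * cis \<theta>) * ennreal r * indicator {0<..} r * indicator {0..2*pi} \<theta> \<partial>lborel)
      = (\<integral>\<^sup>+\<theta>\<in>{0..2*pi}. ?w (of_real r * cis \<theta>) \<partial>lborel) * ennreal r * indicator {0<..} r"
      by (simp add: mult.assoc)
  qed
  also have "\<dots> = (\<integral>\<^sup>+z. ?w z \<partial>lborel)"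
    by (rule nn_integral_polar[symmetric]) measurable
  also have "\<dots> \<le> 1" using energy by (simp add: grad_density_def)
  finally have "(\<integral>\<^sup>+\<theta>. J \<theta> * indicator {0..2*pi} \<theta> \<partial>lborel) \<noteq> \<infinity>"
    by (auto simp: top_unique)
  then have "AE \<theta> in lborel. J \<theta> * indicator {0..2*pi} \<theta> \<noteq> \<infinity>"
    by (intro nn_integral_noteq_infinite) measurable
  then show ?thesis
  proof eventually_elim
    case (elim \<theta>)
    show ?case
    proof
      assume "\<theta> \<in> {0..2*pi}"
      then have "J \<theta> \<noteq> \<infinity>" using elim by simp
      then obtain k where k: "J \<theta> = ennreal k" "0 \<le> k"
        by (cases "J \<theta>") auto
      have "(\<integral>\<^sup>+r\<in>{1/2..<1}. ennreal ((radial_deriv ux uy r \<theta>)\<^sup>2) \<partial>lborel)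
         \<le> (\<integral>\<^sup>+r. ennreal (2 * pi) * (?w (of_real r * cis \<theta>) * ennreal r * indicator {0<..} r) \<partial>lborel)"
      proof (rule nn_integral_mono)
        fix r :: real
        show "ennreal ((radial_deriv ux uy r \<theta>)\<^sup>2) * indicator {1/2..<1} r
          \<le> ennreal (2 * pi) * (?w (of_real r * cis \<theta>) * ennreal r * indicator {0<..} r)"
        proof (cases "r \<in> {1/2..<1}")
          case True
          let ?x = "ux (of_real r * cis \<theta>)" and ?y = "uy (of_real r * cis \<theta>)"
          have "(radial_deriv ux uy r \<theta>)\<^sup>2 + (?y * cos \<theta> - ?x * sin \<theta>)\<^sup>2 = ?x\<^sup>2 + ?y\<^sup>2"
            by (rule gradient_square_polar[OF grad])
          then have "(radial_deriv ux uy r \<theta>)\<^sup>2 \<le> ?x\<^sup>2 + ?y\<^sup>2"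
            using zero_le_power2[of "?y * cos \<theta> - ?x * sin \<theta>"] by linarith
          also have "\<dots> \<le> (?x\<^sup>2 + ?y\<^sup>2) * (2 * r)"
            using True mult_left_mono[of 1 "2 * r" "?x\<^sup>2 + ?y\<^sup>2"] by simp
          also have "\<dots> = 2 * pi * ((?x\<^sup>2 + ?y\<^sup>2) / pi * r)" by simp
          finally have "ennreal ((radial_deriv ux uy r \<theta>)\<^sup>2) \<le> ennreal (2 * pi * ((?x\<^sup>2 + ?y\<^sup>2) / pi * r))"
            by (rule ennreal_leI)
          also have "\<dots> = ennreal (2 * pi) * ennreal ((?x\<^sup>2 + ?y\<^sup>2) / pi * r)"
            using True by (intro ennreal_mult mult_nonneg_nonneg) auto
          also have "ennreal ((?x\<^sup>2 + ?y\<^sup>2) / pi * r) = ennreal ((?x\<^sup>2 + ?y\<^sup>2) / pi) * ennreal r"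
            using True by (intro ennreal_mult) auto
          finally show ?thesis
            using True by (simp add: grad_density_def norm_mult)
        qed simp
      qed
      also have "\<dots> = ennreal (2 * pi) * J \<theta>"
        unfolding J_def by (rule nn_integral_cmult) measurable
      also have "\<dots> = ennreal (2 * pi * k)"
        using k by (simp add: ennreal_mult)
      finally show "\<exists>l. has_radial_limit u l (cis \<theta>)"
        using k by (intro has_radial_limit_of_energy[OF grad, where K="2 * pi * k"]) auto
    qed
  qed
qed

lemma has_radial_limit_trace:
  assumes "\<exists>l. has_radial_limit u l \<zeta>"
  shows "has_radial_limit u (trace_circle u \<zeta>) \<zeta>"
proof -
  from assms obtain l where l: "has_radial_limit u l \<zeta>" by blast
  have "trace_circle u \<zeta> = l"
    unfolding trace_circle_def using l
    by (intro the_equality) (auto simp: has_radial_limit_def intro: tendsto_unique[OF trivial_limit_at_left_real])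
  then show ?thesis using l by simp
qed

lemma exp_square_circle:
  fixes u :: "complex \<Rightarrow> real"
  assumes grad: "has_gradient_on (ball 0 1) u ux uy"
    and energy: "(\<integral>\<^sup>+z\<in>ball 0 1. ennreal (((ux z)\<^sup>2 + (uy z)\<^sup>2) / pi) \<partial>lborel) \<le> 1"
    and mean: "\<And>r. 0 < r \<Longrightarrow> r < 1 \<Longrightarrow> (\<integral>\<theta>. u (of_real r * cis \<theta>) \<partial>circ) = 0"
    and R: "0 < R" "R < 1"
  shows "(\<integral>\<^sup>+\<theta>. ennreal (exp ((u (of_real R * cis \<theta>))\<^sup>2)) \<partial>circ)
    \<le> ennreal (1 + 2 * (91 * exp 3 / (1 - exp (-1))\<^sup>2))"
proof -
  let ?\<phi> = "\<lambda>\<theta>. u (of_real R * cis \<theta>)" and ?c = "91 * exp 3 / (1 - exp (-1))\<^sup>2 :: real"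
  define v where "v z = - u z" for z
  define vx where "vx z = - ux z" for z
  define vy where "vy z = - uy z" for z
  have [measurable]: "?\<phi> \<in> borel_measurable borel"
    by (rule borel_measurable_continuous_onI[OF continuous_circle[OF grad energy mean R]])
  have gv: "has_gradient_on (ball 0 1) v vx vy"
  proof -
    have "(v has_derivative (\<lambda>h. vx z * Re h + vy z * Im h)) (at z)" if "z \<in> ball 0 1" for z
    proof -
      have "(u has_derivative (\<lambda>h. ux z * Re h + uy z * Im h)) (at z)"
        using grad that unfolding has_gradient_on_def by blast
      from has_derivative_minus[OF this] show ?thesis
        by (simp add: v_def[abs_def] vx_def vy_def)
    qed
    then show ?thesis
      using grad unfolding has_gradient_on_def vx_def[abs_def] vy_def[abs_def] by (auto intro!: continuous_intros)
  qed
  have "(\<integral>\<^sup>+\<theta>. (if 0 < v (of_real R * cis \<theta>) then ennreal (exp ((v (of_real R * cis \<theta>))\<^sup>2)) else 0) \<partial>circ) \<le> ennreal ?c"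
    by (rule exp_square_positive_part[OF gv _ _ R]) (use energy mean in \<open>simp_all add: v_def vx_def vy_def\<close>)
  then have neg: "(\<integral>\<^sup>+\<theta>. (if ?\<phi> \<theta> < 0 then ennreal (exp ((?\<phi> \<theta>)\<^sup>2)) else 0) \<partial>circ) \<le> ennreal ?c"
    unfolding v_def power2_minus neg_0_less_iff_less .
  have pos: "(\<integral>\<^sup>+\<theta>. (if 0 < ?\<phi> \<theta> then ennreal (exp ((?\<phi> \<theta>)\<^sup>2)) else 0) \<partial>circ) \<le> ennreal ?c"
    by (rule exp_square_positive_part[OF grad energy mean R])
  have "(\<integral>\<^sup>+\<theta>. ennreal (exp ((?\<phi> \<theta>)\<^sup>2)) \<partial>circ)
     \<le> (\<integral>\<^sup>+\<theta>. 1 + ((if 0 < ?\<phi> \<theta> then ennreal (exp ((?\<phi> \<theta>)\<^sup>2)) else 0)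
           + (if ?\<phi> \<theta> < 0 then ennreal (exp ((?\<phi> \<theta>)\<^sup>2)) else 0)) \<partial>circ)"
  proof (rule nn_integral_mono)
    fix \<theta>
    show "ennreal (exp ((?\<phi> \<theta>)\<^sup>2)) \<le> 1 + ((if 0 < ?\<phi> \<theta> then ennreal (exp ((?\<phi> \<theta>)\<^sup>2)) else 0)
           + (if ?\<phi> \<theta> < 0 then ennreal (exp ((?\<phi> \<theta>)\<^sup>2)) else 0))"
      by (cases "?\<phi> \<theta>" "0::real" rule: linorder_cases) (auto simp: le_iff_add add.commute)
  qed
  also have "\<dots> = 1 + ((\<integral>\<^sup>+\<theta>. (if 0 < ?\<phi> \<theta> then ennreal (exp ((?\<phi> \<theta>)\<^sup>2)) else 0) \<partial>circ)
     + (\<integral>\<^sup>+\<theta>. (if ?\<phi> \<theta> < 0 then ennreal (exp ((?\<phi> \<theta>)\<^sup>2)) else 0) \<partial>circ))"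
    by (simp add: nn_integral_add)
  also have "\<dots> \<le> 1 + (ennreal ?c + ennreal ?c)"
    using pos neg by (intro add_mono) auto
  also have "\<dots> = ennreal (1 + 2 * ?c)"
    by (simp flip: ennreal_plus ennreal_1)
  finally show ?thesis .
qed

theorem corollaryD:
  shows "\<exists>C::real. \<forall>u::complex \<Rightarrow> real.
    harmonic_on (ball 0 1) u \<longrightarrow> u 0 = 0 \<longrightarrow>
    (\<integral>\<^sup>+z\<in>ball 0 1. ennreal ((norm (gradient u z))\<^sup>2 / pi) \<partial>lborel) \<le> 1 \<longrightarrow>
      hausdorff1 {\<zeta> \<in> sphere 0 1. \<not> has_radial_limit u (trace_circle u \<zeta>) \<zeta>} = 0 \<and>
      (\<integral>\<^sup>+\<theta>\<in>{0..2*pi}. ennreal (exp ((trace_circle u (exp (\<i> * of_real \<theta>)))\<^sup>2)) \<partial>lborel)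
        \<le> ennreal C"
proof (intro exI allI impI)
  fix u :: "complex \<Rightarrow> real"
  let ?c = "1 + 2 * (91 * exp 3 / (1 - exp (-1))\<^sup>2) :: real"
  assume harm: "harmonic_on (ball 0 1) u" and u0: "u 0 = 0"
    and en: "(\<integral>\<^sup>+z\<in>ball 0 1. ennreal ((norm (gradient u z))\<^sup>2 / pi) \<partial>lborel) \<le> 1"
  define ux where "ux = partial_deriv 1 u"
  define uy where "uy = partial_deriv \<i> u"
  have C1: "C1_on (ball 0 1) u" "C1_on (ball 0 1) ux" "C1_on (ball 0 1) uy"
    using harm unfolding harmonic_on_def C2_on_def ux_def uy_def by (auto simp: Basis_complex_def)
  have grad: "has_gradient_on (ball 0 1) u ux uy"
    unfolding ux_def uy_def by (rule C1_on_has_gradient[OF C1(1)])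
  have energy: "(\<integral>\<^sup>+z\<in>ball 0 1. ennreal (((ux z)\<^sup>2 + (uy z)\<^sup>2) / pi) \<partial>lborel) \<le> 1"
    using en unfolding norm_gradient_complex ux_def uy_def .
  have mean: "(\<integral>\<theta>. u (of_real r * cis \<theta>) \<partial>circ) = 0" if "0 < r" "r < 1" for r
  proof -
    have "partial_deriv 1 ux z + partial_deriv \<i> uy z = 0" if "z \<in> ball 0 1" for z
      using harm that unfolding harmonic_on_def laplacian_def ux_def uy_def by (simp add: Basis_complex_def)
    from mean_value_circle[OF grad C1_on_has_gradient[OF C1(2)] C1_on_has_gradient[OF C1(3)] this \<open>0 < r\<close> \<open>r < 1\<close>]
    show ?thesis using u0 by simp
  qed
  have "AE \<theta> in lborel. \<theta> \<in> {0..2*pi} \<longrightarrow> (\<exists>l. has_radial_limit u l (cis \<theta>))"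
    by (rule radial_limit_AE[OF grad energy mean])
  then have lim: "AE \<theta> in lborel. \<theta> \<in> {0..2*pi} \<longrightarrow> has_radial_limit u (trace_circle u (cis \<theta>)) (cis \<theta>)"
    by eventually_elim (auto intro: has_radial_limit_trace)
  show "hausdorff1 {\<zeta> \<in> sphere 0 1. \<not> has_radial_limit u (trace_circle u \<zeta>) \<zeta>} = 0 \<and>
      (\<integral>\<^sup>+\<theta>\<in>{0..2*pi}. ennreal (exp ((trace_circle u (exp (\<i> * of_real \<theta>)))\<^sup>2)) \<partial>lborel)
        \<le> ennreal (2 * pi * ?c)"
  proof
    obtain N where N: "N \<in> null_sets lborel"
      "{\<theta>. \<not> (\<theta> \<in> {0..2*pi} \<longrightarrow> has_radial_limit u (trace_circle u (cis \<theta>)) (cis \<theta>))} \<subseteq> N"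
      using lim by (auto elim!: AE_E simp: null_sets_def)
    have "{\<zeta> \<in> sphere 0 1. \<not> has_radial_limit u (trace_circle u \<zeta>) \<zeta>} \<subseteq> cis ` (N \<inter> {0..2*pi})"
    proof
      fix \<zeta> assume "\<zeta> \<in> {\<zeta> \<in> sphere 0 1. \<not> has_radial_limit u (trace_circle u \<zeta>) \<zeta>}"
      then have \<zeta>: "cmod \<zeta> = 1" "\<not> has_radial_limit u (trace_circle u \<zeta>) \<zeta>" by auto
      obtain \<theta> where \<theta>: "0 \<le> \<theta>" "\<theta> < 2*pi" "\<zeta> = cis \<theta>"
        using complex_unimodular_polar[OF \<zeta>(1)] by (metis cis.ctr)
      then show "\<zeta> \<in> cis ` (N \<inter> {0..2*pi})" using N(2) \<zeta>(2) by auto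
    qed
    from hausdorff1_cis_null[OF N(1) this]
    show "hausdorff1 {\<zeta> \<in> sphere 0 1. \<not> has_radial_limit u (trace_circle u \<zeta>) \<zeta>} = 0" .
  next
    define R where "R n = 1 - 1 / real (n + 2)" for n
    have R: "0 < R n" "R n < 1" for n by (auto simp: R_def field_simps)
    have "(\<lambda>n. 1 / real (n + 2)) \<longlonglongrightarrow> 0" by (rule LIMSEQ_ignore_initial_segment[OF lim_1_over_n])
    then have "R \<longlonglongrightarrow> 1 - 0" unfolding R_def[abs_def] by (intro tendsto_intros)
    then have R1: "filterlim R (at_left 1) sequentially"
      using R less_imp_neq[OF R(2)] by (simp add: filterlim_at)
    have [measurable]: "(\<lambda>\<theta>. u (of_real (R n) * cis \<theta>)) \<in> borel_measurable borel" for n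
      by (rule borel_measurable_continuous_onI[OF continuous_circle[OF grad energy mean R]])
    let ?g = "\<lambda>n \<theta>. ennreal (exp ((u (of_real (R n) * cis \<theta>))\<^sup>2)) * indicator {0..2*pi} \<theta>"
    have "(\<integral>\<^sup>+\<theta>\<in>{0..2*pi}. ennreal (exp ((trace_circle u (exp (\<i> * of_real \<theta>)))\<^sup>2)) \<partial>lborel)
       = (\<integral>\<^sup>+\<theta>. liminf (\<lambda>n. ?g n \<theta>) \<partial>lborel)"
      using lim
    proof (intro nn_integral_cong_AE, eventually_elim)
      case (elim \<theta>)
      show ?case
      proof (cases "\<theta> \<in> {0..2*pi}")
        case True
        then have "((\<lambda>t. u (of_real t * cis \<theta>)) \<longlongrightarrow> trace_circle u (cis \<theta>)) (at_left 1)"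
          using elim by (simp add: has_radial_limit_def)
        then have "(\<lambda>n. u (of_real (R n) * cis \<theta>)) \<longlonglongrightarrow> trace_circle u (cis \<theta>)"
          by (rule filterlim_compose[OF _ R1])
        then have "(\<lambda>n. ennreal (exp ((u (of_real (R n) * cis \<theta>))\<^sup>2))) \<longlonglongrightarrow> ennreal (exp ((trace_circle u (cis \<theta>))\<^sup>2))"
          by (intro tendsto_intros)
        from lim_imp_Liminf[OF sequentially_bot this] show ?thesis
          using True by (simp add: cis_conv_exp[symmetric])
      qed (auto simp: Liminf_const)
    qed
    also have "\<dots> \<le> liminf (\<lambda>n. \<integral>\<^sup>+\<theta>. ?g n \<theta> \<partial>lborel)"
      by (rule nn_integral_liminf) measurable
    also have "\<dots> \<le> liminf (\<lambda>n. ennreal (2 * pi * ?c))"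
    proof (intro Liminf_mono always_eventually allI)
      fix n
      have "(\<integral>\<^sup>+\<theta>. ?g n \<theta> \<partial>lborel) = ennreal (2 * pi) * (\<integral>\<^sup>+\<theta>. ennreal (exp ((u (of_real (R n) * cis \<theta>))\<^sup>2)) \<partial>circ)"
        by (rule nn_integral_Icc_circ) measurable
      also have "\<dots> \<le> ennreal (2 * pi) * ennreal ?c"
        by (intro mult_left_mono exp_square_circle[OF grad energy mean R]) auto
      also have "\<dots> = ennreal (2 * pi * ?c)" by (rule ennreal_mult[symmetric]) auto
      finally show "(\<integral>\<^sup>+\<theta>. ?g n \<theta> \<partial>lborel) \<le> ennreal (2 * pi * ?c)" .
    qed
    also have "\<dots> = ennreal (2 * pi * ?c)" by (simp add: Liminf_const)
    finally show "(\<integral>\<^sup>+\<theta>\<in>{0..2*pi}. ennreal (exp ((trace_circle u (exp (\<i> * of_real \<theta>)))\<^sup>2)) \<partial>lborel)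
        \<le> ennreal (2 * pi * ?c)" .
  qed
qed

end
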